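(* For every integer $d\ge 2$ and every $\epsilon>0$ there is $p_d(\epsilon)$ such that for all integers $p\ge p_d(\epsilon)$ and $q$ with $p^{\frac{d-1}{d}+\epsilon}\le q\le p$ we have $$p-q+1\le \mathrm{HD}_d(p,q)\le p-q+2.$$
   Context: A family $\mathcal F$ of sets satisfies the $(p,q)$-property (for integers $p\ge q\ge 1$) if $|\mathcal F|\ge p$, no member of $\mathcal F$ is empty, and among any $p$ members of $\mathcal F$ there are $q$ with a common point. A set $T$ is a transversal of $\mathcal F$ if $T$ meets every member of $\mathcal F$. For integers $p\ge q\ge d+1$, $\mathrm{HD}_d(p,q)$ denotes the smallest integer $s$ such that every family of compact convex sets in $\mathbb R^d$ satisfying the $(p,q)$-property has a transversal of size at most $s$. *)

theory Defs
  imports "HOL-Analysis.Analysis"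
begin

definition pq_property :: "nat \<Rightarrow> nat \<Rightarrow> 'a set set \<Rightarrow> bool" where
  "pq_property p q F \<longleftrightarrow>
     (\<exists>G\<subseteq>F. finite G \<and> card G = p) \<and>
     (\<forall>C\<in>F. C \<noteq> {}) \<and>
     (\<forall>G\<subseteq>F. finite G \<and> card G = p \<longrightarrow> (\<exists>H\<subseteq>G. card H = q \<and> \<Inter>H \<noteq> {}))"

definition transversal :: "'a set \<Rightarrow> 'a set set \<Rightarrow> bool" where
  "transversal T F \<longleftrightarrow> (\<forall>C\<in>F. T \<inter> C \<noteq> {})"

text \<open>HD_d(p,q), where d = DIM('a) is the dimension of the Euclidean space 'a.\<close>
definition HD :: "'a::euclidean_space itself \<Rightarrow> nat \<Rightarrow> nat \<Rightarrow> nat" where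
  "HD _ p q = (LEAST s. \<forall>F :: 'a set set.
       (\<forall>C\<in>F. compact C \<and> convex C) \<and> pq_property p q F \<longrightarrow>
       (\<exists>T. finite T \<and> card T \<le> s \<and> transversal T F))"

end

theory Submission
  imports Defs "HOL-Real_Asymp.Real_Asymp"
begin

text \<open>
  Write depth for the largest number of members of a family with a common point. Removing a subfamily A
  of depth m from a family with the (p,q)-property leaves the (p - |A|, q - m)-property, while A itself is
  pierced by |A| - m + 1 points. If A has small depth and p - |A| is slightly larger than q, then the rest
  is covered by the Hadwiger-Debrunner theorem, and the two bounds add up to p - q + 2. Such an A is
  collected greedily from subfamilies of k = \<delta>(p - |A|) members and depth less than r, where r is smaller
  than q only by a logarithmic factor. When no further piece exists, the rest has the (k,r)-property,
  and then O(k) points together with a weak net of size about (k/r)^d pierce it, which beats p - q because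
  q exceeds p^((d-1)/d + \<epsilon>).

  The bound for families with the (k,r)-property comes from a weighted fractional Helly theorem for
  j-tuples with large j, a Frank-Wolfe iteration in place of linear programming duality, and weak nets.
  The weak nets of size \<epsilon>^(-d-\<eta>) follow Matousek and Wagner: in a partition into r classes with
  crossing number about r^(1-1/d), a convex set either contains a centerpoint of the classes it meets,
  or meets few classes and is denser in one of them. The partition is built by cuttings and reweighting,
  and no general position is assumed.
\<close>

section \<open>Chambers of hyperplane arrangements\<close>

text \<open>The Hadwiger-Debrunner theorem asks for (d - 1) p < d (q - 1), so q must be a fixed
  fraction of p; here q may be far smaller, and the removed subfamily A has to bridge the gap. Two
  budgets fix the parameters. Each removed piece takes a fixed fraction of p - |A|, so about log p
  pieces suffice, and together they may spend only a small fraction of q on depth; hence r is q over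
  a multiple of log p. On the other side, a net of size (y / r)^D with y = p - |A| must stay below
  \<delta> y; as y \<le> p, this asks r^D to exceed p^(D-1) by a constant factor, and with D close
  to d this is where the exponent (d - 1)/d comes from. So nothing may be lost in D: fractional
  Helly for (d + 1)-tuples would raise k / r to the power d + 1 before the net is applied, whereas
  for j-tuples the power is j / (j - d), which tends to 1. Cuttings, partitions and nets may each
  lose an arbitrarily small amount in the exponent, which permits simple nonoptimal choices such as
  samples of size s^(1+\<theta>).\<close>

definition hval :: "'b::euclidean_space \<times> real \<Rightarrow> 'b \<Rightarrow> real" where
  "hval h x = fst h \<bullet> x - snd h"

text \<open>The closed face of the arrangement that has y in its relative interior; for generic y it
  is a full cell. Naming a face by one of its points instead of a sign vector makes every face
  nonempty.\<close>

definition chamber :: "('b::euclidean_space \<times> real) set \<Rightarrow> 'b \<Rightarrow> 'b set" where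
  "chamber R y = {x. \<forall>h\<in>R. (hval h y \<le> 0 \<longrightarrow> hval h x \<le> 0) \<and> (hval h y \<ge> 0 \<longrightarrow> hval h x \<ge> 0)}"

definition flat :: "('b::euclidean_space \<times> real) set \<Rightarrow> 'b set" where
  "flat J = {x. \<forall>h\<in>J. hval h x = 0}"

text \<open>Describes the points in full-dimensional faces of the arrangement that R induces on
  L.\<close>

definition generic_in :: "('b::euclidean_space \<times> real) set \<Rightarrow> 'b set \<Rightarrow> 'b \<Rightarrow> bool" where
  "generic_in R L y \<longleftrightarrow> y \<in> L \<and> (\<forall>h\<in>R. hval h y = 0 \<longrightarrow> (\<forall>x\<in>L. hval h x = 0))"

definition same_signs :: "('b::euclidean_space \<times> real) set \<Rightarrow> 'b \<Rightarrow> 'b \<Rightarrow> bool" where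
  "same_signs R y z \<longleftrightarrow> (\<forall>h\<in>R. sgn (hval h y) = sgn (hval h z))"

text \<open>The vertices of the arrangement, expressed by uniqueness of the solution so that no rank
  condition enters.\<close>

definition vtx :: "('b::euclidean_space \<times> real) set \<Rightarrow> 'b set" where
  "vtx R = {v. \<forall>x. (\<forall>h\<in>R. hval h v = 0 \<longrightarrow> hval h x = 0) \<longrightarrow> x = v}"

lemma hval_affine: "hval h (x + t *\<^sub>R (y - x)) = hval h x + t * (hval h y - hval h x)"
  by (simp add: hval_def algebra_simps inner_add_right inner_diff_right)

lemma hval_convex_comb: "u + v = 1 \<Longrightarrow> hval h (u *\<^sub>R x + v *\<^sub>R y) = u * hval h x + v * hval h y"
proof -
  assume "u + v = 1"
  then have "snd h = u * snd h + v * snd h" by (metis distrib_right mult_1)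
  then show ?thesis by (simp add: hval_def algebra_simps inner_add_right)
qed

lemma hval_sum:
  assumes "sum u V = 1"
  shows "hval h (\<Sum>v\<in>V. u v *\<^sub>R v) = (\<Sum>v\<in>V. u v * hval h v)"
proof -
  have "(\<Sum>v\<in>V. u v * hval h v) = (\<Sum>v\<in>V. u v * (fst h \<bullet> v)) - (\<Sum>v\<in>V. u v) * snd h"
    by (simp add: hval_def sum_subtractf right_diff_distrib sum_distrib_right)
  then show ?thesis using assms by (simp add: hval_def inner_sum_right)
qed

lemma same_signs_iff: "same_signs R y z \<longleftrightarrow>
   (\<forall>h\<in>R. (hval h y > 0 \<longleftrightarrow> hval h z > 0) \<and> (hval h y < 0 \<longleftrightarrow> hval h z < 0))"
  unfolding same_signs_def by (rule ball_cong) (auto simp: sgn_if)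

lemma chamber_same_signs:
  assumes "same_signs R y z" shows "chamber R y = chamber R z"
proof -
  have "(hval h y \<le> 0 \<longleftrightarrow> hval h z \<le> 0) \<and> (hval h y \<ge> 0 \<longleftrightarrow> hval h z \<ge> 0)" if "h \<in> R" for h
    using assms that unfolding same_signs_iff by (meson not_le)
  then show ?thesis by (auto simp: chamber_def)
qed

lemma chamber_refl [simp]: "y \<in> chamber R y" by (simp add: chamber_def)

lemma chamber_mono: "z \<in> chamber R y \<Longrightarrow> chamber R z \<subseteq> chamber R y"
  by (auto simp: chamber_def)

lemma chamber_sign:
  assumes "z \<in> chamber R y" "h \<in> R"
  shows "hval h z > 0 \<Longrightarrow> hval h y > 0" "hval h z < 0 \<Longrightarrow> hval h y < 0"
    "hval h y = 0 \<Longrightarrow> hval h z = 0"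
  using assms by (fastforce simp: chamber_def)+

lemma mem_chamberI:
  assumes "\<And>h. h \<in> R \<Longrightarrow> hval h y > 0 \<Longrightarrow> hval h x > 0" "\<And>h. h \<in> R \<Longrightarrow> hval h y < 0 \<Longrightarrow> hval h x < 0"
    "\<And>h. h \<in> R \<Longrightarrow> hval h y = 0 \<Longrightarrow> hval h x = 0"
  shows "x \<in> chamber R y"
  unfolding chamber_def using assms by (force simp: le_less)

lemma polyhedron_chamber:
  assumes "finite R" shows "polyhedron (chamber R y)"
proof -
  have "polyhedron (if hval h y \<le> 0 then {x. fst h \<bullet> x \<le> snd h} else UNIV)"
    "polyhedron (if hval h y \<ge> 0 then {x. fst h \<bullet> x \<ge> snd h} else UNIV)" for h
    by (auto intro: polyhedron_halfspace_le polyhedron_halfspace_ge)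
  moreover have "chamber R y = (\<Inter>h\<in>R. (if hval h y \<le> 0 then {x. fst h \<bullet> x \<le> snd h} else UNIV)) \<inter>
       (\<Inter>h\<in>R. (if hval h y \<ge> 0 then {x. fst h \<bullet> x \<ge> snd h} else UNIV))"
    (is "_ = ?A \<inter> ?B")
  proof -
    have "x \<in> ?A \<longleftrightarrow> (\<forall>h\<in>R. hval h y \<le> 0 \<longrightarrow> hval h x \<le> 0)"
      "x \<in> ?B \<longleftrightarrow> (\<forall>h\<in>R. hval h y \<ge> 0 \<longrightarrow> hval h x \<ge> 0)" for x
      unfolding INT_iff by (rule ball_cong; simp add: hval_def)+
    then show ?thesis by (intro set_eqI) (simp only: Int_iff chamber_def mem_Collect_eq ball_conj_distrib)
  qed
  moreover have "polyhedron (\<Inter>h\<in>R. (if hval h y \<le> 0 then {x. fst h \<bullet> x \<le> snd h} else UNIV))"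
    "polyhedron (\<Inter>h\<in>R. (if hval h y \<ge> 0 then {x. fst h \<bullet> x \<ge> snd h} else UNIV))"
    by (rule polyhedron_Inter; (rule finite_imageI[OF assms] | erule imageE, simp only: calculation))+
  ultimately show ?thesis by (simp only: polyhedron_Int)
qed

lemma convex_chamber: "finite R \<Longrightarrow> convex (chamber R y)"
  using polyhedron_chamber polyhedron_imp_convex by blast

lemma small_step_keeps_signs:
  assumes "finite R"
  obtains \<delta> where "\<delta> > 0" "\<And>h t. \<lbrakk>h \<in> R; \<bar>t\<bar> \<le> \<delta>; hval h y > 0\<rbrakk> \<Longrightarrow> hval h (y + t *\<^sub>R (x - y)) > 0"
    "\<And>h t. \<lbrakk>h \<in> R; \<bar>t\<bar> \<le> \<delta>; hval h y < 0\<rbrakk> \<Longrightarrow> hval h (y + t *\<^sub>R (x - y)) < 0"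
proof -
  have "\<exists>\<delta>>0. \<forall>h\<in>R. \<forall>t. \<bar>t\<bar> \<le> \<delta> \<longrightarrow> (hval h y > 0 \<longrightarrow> hval h (y + t *\<^sub>R (x - y)) > 0) \<and>
      (hval h y < 0 \<longrightarrow> hval h (y + t *\<^sub>R (x - y)) < 0)"
    using assms
  proof (induction R rule: finite_induct)
    case empty
    show ?case by (rule exI[of _ 1]) auto
  next
    case (insert h R)
    obtain \<delta> where \<delta>: "\<delta> > 0" "\<forall>h\<in>R. \<forall>t. \<bar>t\<bar> \<le> \<delta> \<longrightarrow> (hval h y > 0 \<longrightarrow> hval h (y + t *\<^sub>R (x - y)) > 0) \<and>
      (hval h y < 0 \<longrightarrow> hval h (y + t *\<^sub>R (x - y)) < 0)" using insert by blast
    define c where "c = \<bar>hval h x - hval h y\<bar> + 1"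
    define \<delta>' where "\<delta>' = (if hval h y = 0 then 1 else \<bar>hval h y\<bar> / (2 * c))"
    have c: "c \<ge> 1" by (simp add: c_def)
    have d': "\<delta>' > 0" using c by (auto simp: \<delta>'_def)
    have "(hval h y > 0 \<longrightarrow> hval h (y + t *\<^sub>R (x - y)) > 0) \<and> (hval h y < 0 \<longrightarrow> hval h (y + t *\<^sub>R (x - y)) < 0)"
      if t: "\<bar>t\<bar> \<le> \<delta>'" for t
    proof (cases "hval h y = 0")
      case False
      have "\<bar>t * (hval h x - hval h y)\<bar> \<le> \<delta>' * c"
        unfolding abs_mult by (rule mult_mono) (use t d' in \<open>auto simp: c_def\<close>)
      also have "\<dots> = \<bar>hval h y\<bar> / 2" using False c by (simp add: \<delta>'_def)
      finally show ?thesis using False unfolding hval_affine by (auto simp: abs_if split: if_splits)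
    qed simp
    then show ?case using \<delta> d' by (intro exI[of _ "min \<delta> \<delta>'"]) auto
  qed
  then show ?thesis using that by blast
qed

text \<open>A segment from a point x of the chamber to y can be prolonged a little beyond y: nonzero
  signs at y survive small steps, and functionals vanishing at y vanish at x too. This is the
  prolongation criterion for relative interiors.\<close>

lemma chamber_rel_interior:
  assumes "finite R" shows "y \<in> rel_interior (chamber R y)"
proof -
  have "\<exists>e>1. (1 - e) *\<^sub>R x + e *\<^sub>R y \<in> chamber R y" if x: "x \<in> chamber R y" for x
  proof -
    obtain \<delta> where \<delta>: "\<delta> > 0" "\<And>h t. \<lbrakk>h \<in> R; \<bar>t\<bar> \<le> \<delta>; hval h y > 0\<rbrakk> \<Longrightarrow> hval h (y + t *\<^sub>R (x - y)) > 0"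
    "\<And>h t. \<lbrakk>h \<in> R; \<bar>t\<bar> \<le> \<delta>; hval h y < 0\<rbrakk> \<Longrightarrow> hval h (y + t *\<^sub>R (x - y)) < 0"
      using small_step_keeps_signs[OF assms] by metis
    have eq: "(1 - (1 + \<delta>)) *\<^sub>R x + (1 + \<delta>) *\<^sub>R y = y + (-\<delta>) *\<^sub>R (x - y)"
      by (simp add: algebra_simps)
    have "hval h (y + (-\<delta>) *\<^sub>R (x - y)) = 0" if "h \<in> R" "hval h y = 0" for h
      using chamber_sign(3)[OF x that] that by (simp add: hval_affine del: scaleR_minus_left)
    then have "y + (-\<delta>) *\<^sub>R (x - y) \<in> chamber R y"
      using \<delta>(1) \<delta>(2)[of _ "-\<delta>"] \<delta>(3)[of _ "-\<delta>"] by (intro mem_chamberI) auto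
    then show ?thesis using \<delta>(1) eq by (intro exI[of _ "1+\<delta>"]) auto
  qed
  then show ?thesis using convex_rel_interior_iff[OF convex_chamber[OF assms], of y y]
    by (metis chamber_refl convex_chamber[OF assms] convex_rel_interior_iff empty_iff)
qed

text \<open>If a second point x solved the equations active at v, then v would be the midpoint of
  two points of the chamber on the line through v and x.\<close>

lemma extreme_point_chamber_vtx:
  assumes "finite R" "v extreme_point_of chamber R y"
  shows "v \<in> vtx R"
proof -
  have v: "v \<in> chamber R y" using assms(2) by (simp add: extreme_point_of_def)
  have "x = v" if x: "\<forall>h\<in>R. hval h v = 0 \<longrightarrow> hval h x = 0" for x
  proof (rule ccontr)
    assume ne: "x \<noteq> v"
    obtain \<delta> where \<delta>: "\<delta> > 0" "\<And>h t. \<lbrakk>h \<in> R; \<bar>t\<bar> \<le> \<delta>; hval h v > 0\<rbrakk> \<Longrightarrow> hval h (v + t *\<^sub>R (x - v)) > 0"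
    "\<And>h t. \<lbrakk>h \<in> R; \<bar>t\<bar> \<le> \<delta>; hval h v < 0\<rbrakk> \<Longrightarrow> hval h (v + t *\<^sub>R (x - v)) < 0"
      using small_step_keeps_signs[OF assms(1)] by metis
    have zero: "hval h (v + t *\<^sub>R (x - v)) = 0" if "h \<in> R" "hval h v = 0" for h t
      using x that by (simp add: hval_affine)
    have in_ch: "v + t *\<^sub>R (x - v) \<in> chamber R v" if "\<bar>t\<bar> \<le> \<delta>" for t
      using \<delta>(2)[of _ t] \<delta>(3)[of _ t] that zero[of _ t] by (intro mem_chamberI) auto
    have "v + \<delta> *\<^sub>R (x - v) \<in> chamber R y" "v + (-\<delta>) *\<^sub>R (x - v) \<in> chamber R y"
      using in_ch[of \<delta>] in_ch[of "-\<delta>"] \<delta>(1) chamber_mono[OF v] by auto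
    moreover have "v \<in> open_segment (v + \<delta> *\<^sub>R (x - v)) (v + (-\<delta>) *\<^sub>R (x - v))"
    proof -
      have "v = (1 - 1/2) *\<^sub>R (v + \<delta> *\<^sub>R (x - v)) + (1/2) *\<^sub>R (v + (-\<delta>) *\<^sub>R (x - v))"
        by (simp add: scaleR_right_distrib scaleR_right_diff_distrib flip: scaleR_add_left)
      moreover have "v + \<delta> *\<^sub>R (x - v) \<noteq> v + (-\<delta>) *\<^sub>R (x - v)"
      proof
        assume "v + \<delta> *\<^sub>R (x - v) = v + (-\<delta>) *\<^sub>R (x - v)"
        then have "\<delta> *\<^sub>R (x - v) - (-\<delta>) *\<^sub>R (x - v) = 0" by (simp only: add_left_cancel) simp
        then have "(2 * \<delta>) *\<^sub>R (x - v) = 0" by (simp only: scaleR_diff_left[symmetric]) simp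
        then show False using ne \<delta>(1) by simp
      qed
      ultimately show ?thesis unfolding in_segment by (intro conjI exI[of _ "1/2"]) auto
    qed
    ultimately show False using assms(2) unfolding extreme_point_of_def by blast
  qed
  then show ?thesis by (simp add: vtx_def)
qed

text \<open>A basis of the span of the active normals already determines the vertex. This bounds the
  number of sampled functionals on which a simplex of the triangulation depends.\<close>

lemma vtx_few:
  fixes R :: "('b::euclidean_space \<times> real) set"
  assumes "v \<in> vtx R"
  obtains A where "A \<subseteq> R" "finite A" "card A \<le> DIM('b)" "flat A = {v}"
proof -
  define T where "T = {h\<in>R. hval h v = 0}"
  obtain B where B: "B \<subseteq> fst ` T" "independent B" "fst ` T \<subseteq> span B"
    using maximal_independent_subset by blast
  obtain A where A: "A \<subseteq> T" "inj_on fst A" "B = fst ` A"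
    using B(1) subset_image_inj by metis
  have fB: "finite B" "card B \<le> DIM('b)" using independent_bound[OF B(2)] by auto
  have "finite A" "card A \<le> DIM('b)"
    using fB A finite_image_iff[of fst A] card_image[OF A(2)] by auto
  have "x = v" if x: "\<forall>h\<in>A. hval h v = 0 \<longrightarrow> hval h x = 0" for x
  proof -
    have "(x - v) \<bullet> a = 0" if aB: "a \<in> B" for a
    proof -
      obtain h where h: "h \<in> A" "a = fst h" using aB unfolding A(3) by blast
      then have "hval h v = 0" "hval h x = 0" using x A T_def by auto
      then show ?thesis using h by (simp add: hval_def inner_commute[of _ "fst h"] inner_diff_right)
    qed
    then have orth: "(x - v) \<bullet> a = 0" if "a \<in> span B" for a
      using that orthogonal_to_span[of a B "x - v"] by (simp add: orthogonal_def)
    have "hval h x = 0" if "h \<in> R" "hval h v = 0" for h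
    proof -
      have "h \<in> T" using that by (simp add: T_def)
      then have "fst h \<in> span B" using B(3) by blast
      from orth[OF this] show ?thesis using that(2) by (simp add: hval_def inner_commute[of _ "fst h"] inner_diff_right)
    qed
    then show ?thesis using assms unfolding vtx_def by blast
  qed
  moreover have "\<forall>h\<in>A. hval h v = 0" using A(1) by (auto simp: T_def)
  ultimately have "flat A = {v}" unfolding flat_def by blast
  then show ?thesis using that A \<open>finite A\<close> \<open>card A \<le> DIM('b)\<close> by (auto simp: T_def)
qed

lemma flat_eq_Inter: "flat J = (\<Inter>h\<in>J. {x. fst h \<bullet> x = snd h})"
  by (auto simp: flat_def hval_def)

lemma affine_flat: "affine (flat J)"
  unfolding flat_eq_Inter by (intro affine_Inter) (auto intro: affine_hyperplane)

lemma flat_insert: "flat (insert h J) = flat J \<inter> {x. fst h \<bullet> x = snd h}"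
  by (auto simp: flat_def hval_def)

lemma chamber_subset_flat: "J \<subseteq> R \<Longrightarrow> y \<in> flat J \<Longrightarrow> chamber R y \<subseteq> flat J"
  using chamber_sign(3) by (fastforce simp: flat_def)

lemma generic_same_signs:
  assumes "generic_in R (flat J) y" "same_signs R y z" "J \<subseteq> R"
  shows "generic_in R (flat J) z"
proof -
  have "hval h y = 0 \<longleftrightarrow> hval h z = 0" if "h \<in> R" for h
    using assms(2) that unfolding same_signs_def by (metis sgn_0_0)
  then show ?thesis using assms unfolding generic_in_def flat_def by (auto 0 4)
qed

text \<open>Modulo functionals vanishing on \<open>flat J\<close>, those vanishing on the facet flat
  are multiples of i, so the side of i decides their signs; every other sign is inherited from the
  facet point z. Hence a facet has at most one chamber on each side.\<close>

lemma chamber_from_facet: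
  assumes J: "J \<subseteq> R" and i: "i \<in> R"
    and y: "generic_in R (flat J) y" "z \<in> chamber R y"
    and y': "generic_in R (flat J) y'" "z \<in> chamber R y'"
    and z: "generic_in R (flat (insert i J)) z"
    and side: "hval i y * hval i y' > 0"
  shows "same_signs R y y'"
  unfolding same_signs_def
proof
  fix j assume j: "j \<in> R"
  show "sgn (hval j y) = sgn (hval j y')"
  proof (cases "hval j z = 0")
    case False
    then consider "hval j z > 0" | "hval j z < 0" by linarith
    then show ?thesis
      using chamber_sign(1,2)[OF y(2) j] chamber_sign(1,2)[OF y'(2) j] by cases auto
  next
    case True
    have jz: "hval j x = 0" if "x \<in> flat (insert i J)" for x
      using z True j that by (auto simp: generic_in_def)
    have zi: "hval i z = 0" "z \<in> flat J" using z by (auto simp: generic_in_def flat_def)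
    \<comment> \<open>The coefficients are chosen so that the values of i cancel; w then lies in the
      smaller flat, where j vanishes, and this makes the values of j at y and y' proportional to
      those of i.\<close>
    define w where "w = z + hval i y' *\<^sub>R (y - z) - hval i y *\<^sub>R (y' - z)"
    have hw: "hval h w = hval h z + hval i y' * (hval h y - hval h z) - hval i y * (hval h y' - hval h z)" for h
      by (simp add: w_def hval_def inner_add_right inner_diff_right algebra_simps)
    have "w \<in> flat (insert i J)"
      using zi y(1) y'(1) by (auto simp: flat_def hw generic_in_def)
    from jz[OF this] have eq: "hval i y' * hval j y = hval i y * hval j y'"
      using True hw[of j] by simp
    have "sgn (hval i y) = sgn (hval i y')" "sgn (hval i y) \<noteq> 0"
      using side by (auto simp: zero_less_mult_iff)
    moreover have "sgn (hval i y') * sgn (hval j y) = sgn (hval i y) * sgn (hval j y')"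
      using eq by (metis sgn_mult)
    ultimately show ?thesis by simp
  qed
qed

text \<open>A boundary point x lies in a facet G of the chamber, and a relative interior point z of
  G represents it. A dimension count identifies the affine hull of G with the flat obtained by
  adding one functional i.\<close>

lemma facet_through_exit_point:
  assumes R: "finite R" and J: "J \<subseteq> R" and y: "generic_in R (flat J) y"
    and x: "x \<in> chamber R y" "x \<notin> rel_interior (chamber R y)"
    and dim: "aff_dim (chamber R y) = aff_dim (flat J)"
  obtains i z where "i \<in> R" "hval i y \<noteq> 0" "generic_in R (flat (insert i J)) z" "z \<in> chamber R y" "x \<in> chamber R z"
    "aff_dim (flat (insert i J)) = aff_dim (flat J) - 1"
proof -
  let ?P = "chamber R y"
  obtain G where G: "G facet_of ?P" "x \<in> G"
    using rel_boundary_of_polyhedron[OF polyhedron_chamber[OF R, of y]] x by blast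
  have Gf: "G face_of ?P" "G \<noteq> {}" "aff_dim G = aff_dim ?P - 1" "G \<subseteq> ?P" "convex G"
    using G(1) facet_of_imp_subset face_of_imp_convex unfolding facet_of_def by blast+
  have "rel_interior G \<noteq> {}" using Gf(2,5) rel_interior_eq_empty by blast
  then obtain z where z: "z \<in> rel_interior G" by blast
  have zG: "z \<in> G" using z rel_interior_subset by blast
  then have zP: "z \<in> ?P" using Gf by blast
  \<comment> \<open>Prolonging the segment from u beyond z would give a point of G where h has the
    sign opposite to that at u, but on a chamber h never takes both signs.\<close>
  have zero: "hval h u = 0" if h: "h \<in> R" "hval h z = 0" and u: "u \<in> G" for h u
  proof -
    obtain e where e: "e > 1" "(1 - e) *\<^sub>R u + e *\<^sub>R z \<in> G"
      using z u convex_rel_interior_iff[OF Gf(5,2)] by blast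
    have val: "hval h ((1 - e) *\<^sub>R u + e *\<^sub>R z) = (1 - e) * hval h u"
      using h(2) by (subst hval_convex_comb) auto
    have inP: "u \<in> ?P" "(1 - e) *\<^sub>R u + e *\<^sub>R z \<in> ?P" using u e Gf(4) by auto
    show ?thesis
    proof (rule ccontr)
      assume "hval h u \<noteq> 0"
      then consider "hval h u > 0" | "hval h u < 0" by linarith
      then show False
      proof cases
        case 1
        then have "(1 - e) * hval h u < 0" using e(1) by (simp add: mult_neg_pos)
        then show False using 1 chamber_sign(1)[OF inP(1) h(1)] chamber_sign(2)[OF inP(2) h(1)] val by simp
      next
        case 2
        then have "(1 - e) * hval h u > 0" using e(1) by (simp add: mult_neg_neg)
        then show False using 2 chamber_sign(2)[OF inP(1) h(1)] chamber_sign(1)[OF inP(2) h(1)] val by simp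
      qed
    qed
  qed
  \<comment> \<open>Otherwise z would have the signs of y and lie in the relative interior of the
    chamber, which a facet avoids.\<close>
  have "\<exists>i\<in>R. hval i z = 0 \<and> hval i y \<noteq> 0"
  proof (rule ccontr)
    assume no: "\<not> ?thesis"
    have "same_signs R y z"
      unfolding same_signs_iff
    proof (intro ballI)
      fix h assume h: "h \<in> R"
      show "(0 < hval h y \<longleftrightarrow> 0 < hval h z) \<and> (hval h y < 0 \<longleftrightarrow> hval h z < 0)"
        using no h chamber_sign[OF zP h] by (metis linorder_neqE not_less_iff_gr_or_eq)
    qed
    then have "z \<in> rel_interior ?P"
      using chamber_same_signs chamber_rel_interior[OF R] by metis
    moreover have "G \<noteq> ?P" using Gf(3) by auto
    ultimately show False using face_of_disjoint_rel_interior[OF Gf(1)] zG by blast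
  qed
  then obtain i where i: "i \<in> R" "hval i z = 0" "hval i y \<noteq> 0" by blast
  have yJ: "y \<in> flat J" using y by (simp add: generic_in_def)
  have GJ: "G \<subseteq> flat (insert i J)"
    using zero[OF i(1,2)] Gf(4) chamber_subset_flat[OF J yJ] by (auto simp: flat_def)
  have ad: "aff_dim (flat (insert i J)) = aff_dim (flat J) - 1"
  proof -
    have "flat J \<inter> {v. fst i \<bullet> v = snd i} \<noteq> {}" using GJ Gf(2) unfolding flat_insert by blast
    moreover have "\<not> flat J \<subseteq> {v. fst i \<bullet> v = snd i}" using yJ i(3) by (auto simp: hval_def)
    ultimately show ?thesis unfolding flat_insert by (simp add: aff_dim_affine_Int_hyperplane[OF affine_flat])
  qed
  have hull: "affine hull G = flat (insert i J)"
  proof (rule affine_dim_equal)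
    show "affine hull G \<subseteq> flat (insert i J)" by (rule hull_minimal[where S = affine, OF GJ affine_flat])
    show "aff_dim (affine hull G) = aff_dim (flat (insert i J))"
      using ad Gf(3) dim by simp
  qed (auto simp: affine_flat Gf(2))
  have gen: "generic_in R (flat (insert i J)) z"
    unfolding generic_in_def
  proof (intro conjI ballI impI)
    show "z \<in> flat (insert i J)" using GJ zG by blast
    fix h u assume h: "h \<in> R" "hval h z = 0" and u: "u \<in> flat (insert i J)"
    have "affine hull G \<subseteq> flat {h}"
      by (rule hull_minimal[where S = affine, OF _ affine_flat]) (use zero[OF h] in \<open>auto simp: flat_def\<close>)
    then show "hval h u = 0" using u hull by (auto simp: flat_def)
  qed
  have "x \<in> chamber R z"
    unfolding chamber_def mem_Collect_eq
  proof
    fix h assume h: "h \<in> R"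
    have "hval h z = 0 \<Longrightarrow> hval h x = 0" using zero[OF h] G(2) by blast
    moreover have "hval h z > 0 \<Longrightarrow> hval h x \<ge> 0" "hval h z < 0 \<Longrightarrow> hval h x \<le> 0"
      using chamber_sign(1,2)[OF zP h] x(1) h unfolding chamber_def by auto
    ultimately show "(hval h z \<le> 0 \<longrightarrow> hval h x \<le> 0) \<and> (0 \<le> hval h z \<longrightarrow> 0 \<le> hval h x)" by argo
  qed
  then show ?thesis using that i gen zP ad by blast
qed

text \<open>Follow the ray from v through x to the last parameter \<open>\<tau>\<close> at which it
  is still in P. This reduces the triangulation of a cell to that of its boundary, with v as the
  apex of all cones.\<close>

lemma exit_point:
  fixes P :: "'b::euclidean_space set"
  assumes "compact P" "convex P" "v \<in> P" "x \<in> P" "P \<noteq> {v}"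
  obtains x' where "x' \<in> P" "x' \<notin> rel_interior P" "x \<in> convex hull {v, x'}"
proof -
  obtain u where u: "u \<in> P" "u \<noteq> v" "x \<in> convex hull {v, u}"
  proof (cases "x = v")
    case True
    obtain u where "u \<in> P" "u \<noteq> v" using assms by blast
    then show ?thesis using that True by (simp add: hull_inc)
  next
    case False
    then show ?thesis using that assms(4) by (simp add: hull_inc)
  qed
  define T where "T = {t. t \<ge> 0 \<and> v + t *\<^sub>R (u - v) \<in> P}"
  have "closed T"
  proof -
    have "T = {0..} \<inter> (\<lambda>t. v + t *\<^sub>R (u - v)) -` P" by (auto simp: T_def)
    then show ?thesis using compact_imp_closed[OF assms(1)]
      by (auto intro!: closed_Int continuous_closed_vimage continuous_intros)
  qed
  moreover have "bounded T"
  proof -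
    obtain B where B: "\<And>z. z \<in> P \<Longrightarrow> norm z \<le> B" using compact_imp_bounded[OF assms(1)] by (auto simp: bounded_iff)
    have "norm t \<le> (B + norm v) / norm (u - v)" if "t \<in> T" for t
    proof -
      have "\<bar>t\<bar> * norm (u - v) \<le> norm (v + t *\<^sub>R (u - v)) + norm v"
        by (metis add.commute add_diff_cancel_left' norm_scaleR norm_triangle_ineq4)
      also have "\<dots> \<le> B + norm v" using B that by (auto simp: T_def)
      finally show ?thesis using u(2) by (simp add: field_simps)
    qed
    then show ?thesis by (auto simp: bounded_iff)
  qed
  ultimately have "compact T" by (simp add: compact_eq_bounded_closed)
  moreover have T1: "1 \<in> T" using u by (simp add: T_def)
  ultimately obtain \<tau> where \<tau>: "\<tau> \<in> T" "\<And>t. t \<in> T \<Longrightarrow> t \<le> \<tau>"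
    using compact_attains_sup[of T] by blast
  have \<tau>1: "\<tau> \<ge> 1" using \<tau>(2) T1 by blast
  define x' where "x' = v + \<tau> *\<^sub>R (u - v)"
  have "x' \<in> P" using \<tau>(1) by (simp add: T_def x'_def)
  moreover have "x' \<notin> rel_interior P"
  proof
    assume "x' \<in> rel_interior P"
    then obtain e where e: "e > 1" "(1 - e) *\<^sub>R v + e *\<^sub>R x' \<in> P"
      using assms convex_rel_interior_iff[OF assms(2), of x'] by blast
    have "(1 - e) *\<^sub>R v + e *\<^sub>R x' = v + (e * \<tau>) *\<^sub>R (u - v)" by (simp add: x'_def algebra_simps)
    then have "e * \<tau> \<in> T" using e \<tau>1 by (simp add: T_def)
    then have "e * \<tau> \<le> \<tau>" using \<tau>(2) by blast
    then show False using e(1) \<tau>1 by simp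
  qed
  moreover have "u \<in> convex hull {v, x'}"
  proof -
    have "u = (1 - 1/\<tau>) *\<^sub>R v + (1/\<tau>) *\<^sub>R x'" using \<tau>1 by (simp add: x'_def algebra_simps)
    moreover have "1 / \<tau> \<le> 1" using \<tau>1 by simp
    ultimately show ?thesis unfolding convex_hull_2
      using \<tau>1 by (intro CollectI exI[of _ "1 - 1/\<tau>"] exI[of _ "1/\<tau>"]) auto
  qed
  then have "convex hull {v, u} \<subseteq> convex hull {v, x'}"
    by (intro hull_minimal) (auto simp: hull_inc)
  ultimately show ?thesis using that u(3) by blast
qed

text \<open>From y one can move a little towards any point of the flat without leaving the chamber,
  so the chamber spans the flat.\<close>

lemma aff_dim_chamber_generic:
  assumes R: "finite R" and J: "J \<subseteq> R" and y: "generic_in R (flat J) y"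
  shows "aff_dim (chamber R y) = aff_dim (flat J)"
proof -
  have yJ: "y \<in> flat J" using y by (simp add: generic_in_def)
  have "flat J \<subseteq> affine hull (chamber R y)"
  proof
    fix x assume x: "x \<in> flat J"
    obtain \<delta> where \<delta>: "\<delta> > 0" "\<And>h t. \<lbrakk>h \<in> R; \<bar>t\<bar> \<le> \<delta>; hval h y > 0\<rbrakk> \<Longrightarrow> hval h (y + t *\<^sub>R (x - y)) > 0"
    "\<And>h t. \<lbrakk>h \<in> R; \<bar>t\<bar> \<le> \<delta>; hval h y < 0\<rbrakk> \<Longrightarrow> hval h (y + t *\<^sub>R (x - y)) < 0"
      using small_step_keeps_signs[OF R] by metis
    have "hval h (y + \<delta> *\<^sub>R (x - y)) = 0" if "h \<in> R" "hval h y = 0" for h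
      using y that x by (simp add: hval_affine generic_in_def)
    then have "y + \<delta> *\<^sub>R (x - y) \<in> chamber R y"
      using \<delta>(1) \<delta>(2)[of _ \<delta>] \<delta>(3)[of _ \<delta>] by (intro mem_chamberI) auto
    then have "y + \<delta> *\<^sub>R (x - y) \<in> affine hull (chamber R y)" "y \<in> affine hull (chamber R y)"
      by (simp_all add: hull_inc)
    then have "(1 - 1/\<delta>) *\<^sub>R y + (1/\<delta>) *\<^sub>R (y + \<delta> *\<^sub>R (x - y)) \<in> affine hull (chamber R y)"
      by (intro mem_affine affine_affine_hull) auto
    moreover have "(1 - 1/\<delta>) *\<^sub>R y + (1/\<delta>) *\<^sub>R (y + \<delta> *\<^sub>R (x - y)) = x" using \<delta>(1) by (simp add: algebra_simps)
    ultimately show "x \<in> affine hull (chamber R y)" by simp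
  qed
  then have "aff_dim (flat J) \<le> aff_dim (chamber R y)" by (metis aff_dim_affine_hull aff_dim_subset)
  moreover have "aff_dim (chamber R y) \<le> aff_dim (flat J)"
    by (rule aff_dim_subset[OF chamber_subset_flat[OF J yJ]])
  ultimately show ?thesis by simp
qed

definition some_extreme :: "'b::euclidean_space set \<Rightarrow> 'b" where
  "some_extreme P = (SOME v. v extreme_point_of P)"

lemma some_extreme:
  assumes "compact P" "convex P" "P \<noteq> {}"
  shows "some_extreme P extreme_point_of P"
  unfolding some_extreme_def using extreme_point_exists_convex[OF assms] by (metis someI)

text \<open>The pair consists of a point marking a chamber and the vertex set of one simplex of its triangulation.
  Carrying the chamber along is what makes the count work without any general position assumption:
  a chamber of the flat is reached from a facet chamber in at most two ways.\<close>
lemma flat_triangulation: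
  fixes R :: "('b::euclidean_space \<times> real) set"
  assumes R: "finite R" and B: "\<And>y. y \<in> B \<Longrightarrow> chamber R y \<subseteq> B" "bounded B"
  shows "J \<subseteq> R \<Longrightarrow> aff_dim (flat J) = int k \<Longrightarrow>
    \<exists>C. finite C \<and> card C \<le> (2 * card R) ^ k \<and>
      (\<forall>y V. (y, V) \<in> C \<longrightarrow> V \<subseteq> chamber R y \<inter> vtx R \<and> finite V \<and> card V \<le> k + 1) \<and>
      (\<forall>y x. generic_in R (flat J) y \<and> y \<in> B \<and> x \<in> chamber R y \<longrightarrow>
         (\<exists>y' V. (y', V) \<in> C \<and> same_signs R y y' \<and> x \<in> convex hull V))"
proof (induction k arbitrary: J)
  case 0
  then obtain w where w: "flat J = {w}" by (auto simp: aff_dim_eq_0)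
  have ch: "chamber R w \<subseteq> {w}" using chamber_subset_flat[OF 0(1), of w] w by auto
  have "w \<in> vtx R"
  proof -
    have "x \<in> flat J" if "\<forall>h\<in>R. hval h w = 0 \<longrightarrow> hval h x = 0" for x
    proof -
      have "w \<in> flat J" using w by simp
      then show ?thesis using that 0(1) by (auto simp: flat_def)
    qed
    then show ?thesis using w by (auto simp: vtx_def)
  qed
  then show ?case
    using w ch by (intro exI[of _ "{(w, {w})}"]) (auto simp: generic_in_def same_signs_def)
next
  case (Suc k)
  note J = \<open>J \<subseteq> R\<close> and adJ = \<open>aff_dim (flat J) = int (Suc k)\<close>
  define good where "good i C \<longleftrightarrow> finite C \<and> card C \<le> (2 * card R) ^ k \<and>
      (\<forall>y V. (y, V) \<in> C \<longrightarrow> V \<subseteq> chamber R y \<inter> vtx R \<and> finite V \<and> card V \<le> k + 1) \<and>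
      (aff_dim (flat (insert i J)) = int k \<longrightarrow> (\<forall>y x. generic_in R (flat (insert i J)) y \<and> y \<in> B \<and> x \<in> chamber R y \<longrightarrow>
         (\<exists>y' V. (y', V) \<in> C \<and> same_signs R y y' \<and> x \<in> convex hull V)))" for i C
  have "\<exists>C. good i C" if "i \<in> R" for i
  proof (cases "aff_dim (flat (insert i J)) = int k")
    case True
    then show ?thesis using Suc.IH[of "insert i J"] J that unfolding good_def by simp
  next
    \<comment> \<open>The hyperplane of i contains the flat or misses it, hence carries no facet;
      the empty collection will do.\<close>
    case False
    then show ?thesis unfolding good_def by (intro exI[of _ "{}"]) auto
  qed
  then obtain C where C: "\<And>i. i \<in> R \<Longrightarrow> good i (C i)" by metis
  \<comment> \<open>\<open>Q i \<sigma> y' y\<close> says that y' marks a chamber in the hyperplane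
    of i that bounds the chamber of y, and that y is on side \<open>\<sigma>\<close>. By
    \<open>chamber_from_facet\<close> any two such y have the same signs, so the arbitrary choice
    made by Y does no harm.\<close>
  define Q where "Q i \<sigma> y' y \<longleftrightarrow> generic_in R (flat J) y \<and> y \<in> B \<and> y' \<in> chamber R y \<and>
     generic_in R (flat (insert i J)) y' \<and> \<sigma> * hval i y > 0" for i y' y and \<sigma> :: real
  define Y where "Y i \<sigma> y' = (SOME y. Q i \<sigma> y' y)" for i y' and \<sigma> :: real
  \<comment> \<open>Each facet simplex is coned from one extreme point of the chamber. The index i
    and the side \<open>\<sigma>\<close> account for the factor 2 |R| gained per dimension.\<close>
  define f where "f = (\<lambda>(i, \<sigma>::real, y', W). (Y i \<sigma> y', insert (some_extreme (chamber R (Y i \<sigma> y'))) W))"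
  define D where "D = {(i, \<sigma>, y', W). i \<in> R \<and> \<sigma> \<in> {1, -1} \<and> (y', W) \<in> C i \<and> (\<exists>y. Q i \<sigma> y' y)}"
  have Dsub: "D \<subseteq> (SIGMA i:R. {1, -1} \<times> C i)" by (auto simp: D_def)
  have finS: "finite (SIGMA i:R. ({1, -1} :: real set) \<times> C i)"
    using R C by (intro finite_SigmaI) (auto simp: good_def)
  have finD: "finite D" using Dsub finS finite_subset by blast
  have "card D \<le> card (SIGMA i:R. ({1, -1} :: real set) \<times> C i)" by (rule card_mono[OF finS Dsub])
  also have "\<dots> = (\<Sum>i\<in>R. card (({1, -1} :: real set) \<times> C i))"
    using R C by (subst card_SigmaI) (auto simp: good_def)
  also have "\<dots> \<le> (\<Sum>i\<in>R. 2 * (2 * card R) ^ k)"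
  proof (rule sum_mono)
    fix i assume "i \<in> R"
    then have "card (C i) \<le> (2 * card R) ^ k" using C unfolding good_def by blast
    then show "card (({1, -1} :: real set) \<times> C i) \<le> 2 * (2 * card R) ^ k" by (simp add: card_cartesian_product)
  qed
  also have "\<dots> = (2 * card R) ^ Suc k" by simp
  finally have cardD: "card D \<le> (2 * card R) ^ Suc k" .
  have comp: "compact (chamber R y)" if "y \<in> B" for y
  proof -
    have "bounded (chamber R y)" using B that bounded_subset by blast
    then show ?thesis using polyhedron_imp_closed[OF polyhedron_chamber[OF R]] compact_eq_bounded_closed by blast
  qed
  have ext: "some_extreme (chamber R y) extreme_point_of chamber R y" if "y \<in> B" for y
    by (rule some_extreme[OF comp[OF that] convex_chamber[OF R]]) (use chamber_refl[of y R] in blast)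
  have prop1: "V \<subseteq> chamber R y \<inter> vtx R \<and> finite V \<and> card V \<le> Suc k + 1" if yV: "(y, V) \<in> f ` D" for y V
  proof -
    obtain i \<sigma> y' W where d: "(i, \<sigma>, y', W) \<in> D" "y = Y i \<sigma> y'" "V = insert (some_extreme (chamber R y)) W"
      using yV by (auto simp: f_def)
    have Qy: "Q i \<sigma> y' y" using d(1,2) unfolding D_def Y_def by (auto intro: someI)
    have W: "W \<subseteq> chamber R y' \<inter> vtx R" "finite W" "card W \<le> k + 1"
      using d(1) C unfolding D_def good_def by blast+
    have yB: "y \<in> B" "y' \<in> chamber R y" using Qy by (auto simp: Q_def)
    have "some_extreme (chamber R y) \<in> chamber R y \<inter> vtx R"
      using ext[OF yB(1)] extreme_point_chamber_vtx[OF R] by (auto simp: extreme_point_of_def)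
    then show ?thesis using W d(3) chamber_mono[OF yB(2)] card_insert_le_m1[of "k+2" W] by (auto simp: card_insert_if)
  qed
  have prop2: "\<exists>y' V. (y', V) \<in> f ` D \<and> same_signs R y y' \<and> x \<in> convex hull V"
    if y: "generic_in R (flat J) y" "y \<in> B" and x: "x \<in> chamber R y" for x y
  proof -
    let ?v = "some_extreme (chamber R y)"
    have vP: "?v \<in> chamber R y" using ext[OF y(2)] by (simp add: extreme_point_of_def)
    have dimP: "aff_dim (chamber R y) = int (Suc k)" using aff_dim_chamber_generic[OF R J y(1)] adJ by simp
    have "chamber R y \<noteq> {?v}"
    proof
      assume "chamber R y = {?v}"
      then have "aff_dim (chamber R y) = 0" by (metis aff_dim_sing)
      then show False using dimP by simp
    qed
    then obtain x' where x': "x' \<in> chamber R y" "x' \<notin> rel_interior (chamber R y)" "x \<in> convex hull {?v, x'}"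
      using exit_point[OF comp[OF y(2)] convex_chamber[OF R] vP x] by blast
    obtain i z where iz: "i \<in> R" "hval i y \<noteq> 0" "generic_in R (flat (insert i J)) z" "z \<in> chamber R y" "x' \<in> chamber R z"
       "aff_dim (flat (insert i J)) = aff_dim (flat J) - 1"
      using facet_through_exit_point[OF R J y(1) x'(1,2)] dimP adJ by metis
    have zB: "z \<in> B" using iz(4) B(1) y(2) by blast
    obtain y' W where yW: "(y', W) \<in> C i" "same_signs R z y'" "x' \<in> convex hull W"
    proof -
      have "aff_dim (flat (insert i J)) = int k" using iz(6) adJ by simp
      then show ?thesis using C[OF iz(1)] iz(3,5) zB that unfolding good_def by blast
    qed
    define \<sigma> :: real where "\<sigma> = sgn (hval i y)"
    have sg: "\<sigma> \<in> {1, -1}" "\<sigma> * hval i y > 0" using iz(2) by (auto simp: \<sigma>_def sgn_if)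
    have y'ch: "y' \<in> chamber R y"
      using chamber_mono[OF iz(4)] chamber_same_signs[OF yW(2)] chamber_refl by blast
    have gen': "generic_in R (flat (insert i J)) y'"
      using generic_same_signs[OF iz(3) yW(2)] iz(1) J by simp
    have Qy: "Q i \<sigma> y' y" using y y'ch gen' sg by (simp add: Q_def)
    then have QY: "Q i \<sigma> y' (Y i \<sigma> y')" unfolding Y_def by (rule someI)
    have inD: "(i, \<sigma>, y', W) \<in> D" using iz(1) sg yW(1) Qy by (auto simp: D_def)
    have "hval i y * hval i (Y i \<sigma> y') > 0"
      using Qy QY sg unfolding Q_def by (auto simp: zero_less_mult_iff)
    then have ss: "same_signs R y (Y i \<sigma> y')"
      using Qy QY unfolding Q_def by (intro chamber_from_facet[OF J iz(1), of y y']) auto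
    then have "f (i, \<sigma>, y', W) = (Y i \<sigma> y', insert ?v W)"
      by (simp add: f_def chamber_same_signs[OF ss])
    moreover have "x \<in> convex hull (insert ?v W)"
    proof -
      have "convex hull {?v, x'} \<subseteq> convex hull (insert ?v W)"
        using yW(3) hull_mono[of W "insert ?v W" convex] by (intro hull_minimal) (auto simp: hull_inc)
      then show ?thesis using x'(3) by blast
    qed
    ultimately show ?thesis using inD ss by (metis image_eqI)
  qed
  have "card (f ` D) \<le> (2 * card R) ^ Suc k" using card_image_le[OF finD, of f] cardD by linarith
  then show ?case using prop1 prop2 finD by (intro exI[of _ "f ` D"]) blast
qed

section \<open>Relatively open simplices and the triangulation of a box\<close>

definition crosses :: "'b::euclidean_space \<times> real \<Rightarrow> 'b set \<Rightarrow> bool" where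
  "crosses h V \<longleftrightarrow> (\<exists>u\<in>V. hval h u > 0) \<and> (\<exists>v\<in>V. hval h v < 0)"

text \<open>For affinely independent V this is the relatively open simplex. The closed hull would
  not do: a functional that does not cross V may still vanish on part of it only.\<close>

definition poshull :: "'b::euclidean_space set \<Rightarrow> 'b set" where
  "poshull V = {\<Sum>v\<in>V. u v *\<^sub>R v |u. (\<forall>v\<in>V. u v > 0) \<and> sum u V = 1}"

lemma convex_hull_poshull:
  assumes "finite V" "x \<in> convex hull V"
  obtains U where "U \<subseteq> V" "x \<in> poshull U"
proof -
  obtain u where u: "\<forall>v\<in>V. 0 \<le> u v" "sum u V = 1" "(\<Sum>v\<in>V. u v *\<^sub>R v) = x"
    using assms by (auto simp: convex_hull_finite)
  define U where "U = {v\<in>V. u v > 0}"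
  have z: "u v = 0" if "v \<in> V - U" for v using that u(1) by (force simp: U_def)
  have UV: "U \<subseteq> V" by (auto simp: U_def)
  have "sum u U = sum u V" using z by (intro sum.mono_neutral_left assms(1) UV) blast
  then have "sum u U = 1" using u(2) by simp
  moreover have "(\<Sum>v\<in>U. u v *\<^sub>R v) = x"
    unfolding u(3)[symmetric] using z by (intro sum.mono_neutral_left assms(1) UV) simp
  ultimately have "x \<in> poshull U" unfolding poshull_def by (auto simp: U_def)
  then show ?thesis using that[of U] by (auto simp: U_def)
qed

text \<open>Strictly positive weights turn values of one weak sign on V into either a strict sign on
  all of \<open>poshull V\<close> or identical vanishing.\<close>

lemma poshull_sign:
  assumes "finite V" "\<not> crosses h V" "x \<in> poshull V"
  shows "(hval h x > 0 \<longrightarrow> (\<forall>y\<in>poshull V. hval h y > 0)) \<and> (hval h x < 0 \<longrightarrow> (\<forall>y\<in>poshull V. hval h y < 0))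
    \<and> (hval h x = 0 \<longrightarrow> (\<forall>v\<in>V. hval h v = 0))"
proof -
  have pos: "\<forall>y\<in>poshull V. hval h y > 0" if "\<forall>v\<in>V. hval h v \<ge> 0" "v \<in> V" "hval h v > 0" for v
  proof
    fix y assume "y \<in> poshull V"
    then obtain u where u: "y = (\<Sum>v\<in>V. u v *\<^sub>R v)" "\<forall>v\<in>V. u v > 0" "sum u V = 1" by (auto simp: poshull_def)
    have "hval h y = (\<Sum>v\<in>V. u v * hval h v)" using hval_sum u by blast
    also have "\<dots> > 0" using that u assms(1)
      by (intro sum_pos2[of V v]) (auto intro: mult_nonneg_nonneg less_imp_le)
    finally show "hval h y > 0" .
  qed
  have neg: "\<forall>y\<in>poshull V. hval h y < 0" if "\<forall>v\<in>V. hval h v \<le> 0" "v \<in> V" "hval h v < 0" for v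
  proof
    fix y assume "y \<in> poshull V"
    then obtain u where u: "y = (\<Sum>v\<in>V. u v *\<^sub>R v)" "\<forall>v\<in>V. u v > 0" "sum u V = 1" by (auto simp: poshull_def)
    have "0 < (\<Sum>v\<in>V. u v * - hval h v)" using that u assms(1)
      by (intro sum_pos2[of V v]) (auto simp: mult_le_0_iff mult_less_0_iff less_imp_le)
    also have "\<dots> = - hval h y" using hval_sum[OF u(3), of h] u(1) by (simp add: sum_negf)
    finally show "hval h y < 0" by simp
  qed
  have zero: "hval h y = 0" if z: "\<forall>v\<in>V. hval h v = 0" "y \<in> poshull V" for y
  proof -
    obtain u where u: "y = (\<Sum>v\<in>V. u v *\<^sub>R v)" "sum u V = 1" using z by (auto simp: poshull_def)
    then show ?thesis using hval_sum[OF u(2), of h] z by simp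
  qed
  consider "\<forall>v\<in>V. hval h v = 0" | v where "\<forall>v\<in>V. hval h v \<ge> 0" "v \<in> V" "hval h v > 0"
    | v where "\<forall>v\<in>V. hval h v \<le> 0" "v \<in> V" "hval h v < 0"
    using assms(2) unfolding crosses_def by (metis linorder_neqE not_less order_less_imp_le)
  then show ?thesis
  proof cases
    case 1 then show ?thesis using zero assms(3) by auto
  next
    case 2 then show ?thesis using pos[OF 2] assms(3) by force
  next
    case 3 then show ?thesis using neg[OF 3] assms(3) by force
  qed
qed

text \<open>The faces of a cube, added to every sample so that the cells in question are bounded and
  have extreme points.\<close>

definition box_functionals :: "real \<Rightarrow> ('b::euclidean_space \<times> real) set" where
  "box_functionals \<rho> = (\<lambda>i. (i, \<rho>)) ` Basis \<union> (\<lambda>i. (- i, \<rho>)) ` Basis"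

lemma finite_box_functionals [simp]: "finite (box_functionals \<rho>)"
  by (simp add: box_functionals_def)

lemma card_box_functionals: "card (box_functionals \<rho> :: ('b::euclidean_space \<times> real) set) \<le> 2 * DIM('b)"
proof -
  have "card (box_functionals \<rho> :: ('b \<times> real) set) \<le> card ((\<lambda>i. (i, \<rho>)) ` (Basis :: 'b set)) + card ((\<lambda>i. (- i, \<rho>)) ` (Basis :: 'b set))"
    unfolding box_functionals_def by (rule card_Un_le)
  also have "\<dots> \<le> DIM('b) + DIM('b)" by (intro add_mono card_image_le) auto
  finally show ?thesis by simp
qed

text \<open>Hyperplanes are null sets and open sets are not. The exception h = 0 is the functional
  that vanishes everywhere.\<close>

lemma exists_generic_point:
  assumes "finite (R :: ('b::euclidean_space \<times> real) set)" "open U" "U \<noteq> {}"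
  obtains g where "g \<in> U" "\<And>h. h \<in> R \<Longrightarrow> hval h g = 0 \<Longrightarrow> h = 0"
proof -
  have "negligible (\<Union>h\<in>R - {0}. {x. fst h \<bullet> x = snd h})"
    using assms(1) by (intro negligible_Union) (auto intro!: negligible_hyperplane simp: prod_eq_iff zero_prod_def)
  then have "\<not> U \<subseteq> (\<Union>h\<in>R - {0}. {x. fst h \<bullet> x = snd h})"
    using assms open_not_negligible negligible_subset by blast
  then show ?thesis using that by (auto simp: hval_def)
qed

lemma box_triangulation:
  fixes R :: "('b::euclidean_space \<times> real) set" and \<rho> :: real
  assumes "finite R" "\<rho> > 0" "box_functionals \<rho> \<subseteq> R"
  obtains \<V> where "finite \<V>" "card \<V> \<le> (2 * card R) ^ DIM('b)"
    "\<And>V. V \<in> \<V> \<Longrightarrow> V \<subseteq> vtx R \<and> finite V \<and> card V \<le> DIM('b) + 1 \<and> (\<forall>h\<in>R. \<not> crosses h V)"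
    "\<And>x. norm x \<le> \<rho> \<Longrightarrow> \<exists>V\<in>\<V>. x \<in> convex hull V"
proof -
  define B where "B = {x::'b. \<forall>h\<in>box_functionals \<rho>. hval h x \<le> 0}"
  have B_iff: "x \<in> B \<longleftrightarrow> (\<forall>i\<in>Basis. \<bar>x \<bullet> i\<bar> \<le> \<rho>)" for x
    unfolding B_def box_functionals_def
    by (auto simp: hval_def inner_commute abs_le_iff ball_Un)
  have B1: "chamber R y \<subseteq> B" if "y \<in> B" for y
    using that assms(3) by (auto simp: B_def chamber_def)
  have "norm x \<le> (\<Sum>i\<in>(Basis::'b set). \<rho>)" if "x \<in> B" for x
    using norm_le_l1[of x] sum_mono[of Basis "\<lambda>i. \<bar>x \<bullet> i\<bar>" "\<lambda>_. \<rho>"] that unfolding B_iff by (meson order_trans)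
  then have B2: "bounded B" unfolding bounded_iff by blast
  have convB: "convex B"
  proof -
    have "B = (\<Inter>h\<in>box_functionals \<rho>. {x. fst h \<bullet> x \<le> snd h})" by (auto simp: B_def hval_def)
    then show ?thesis by (auto intro: convex_Inter convex_halfspace_le)
  qed
  have "flat {} = (UNIV :: 'b set)" by (simp add: flat_def)
  then obtain C where C: "finite C" "card C \<le> (2 * card R) ^ DIM('b)"
      "\<forall>y V. (y, V) \<in> C \<longrightarrow> V \<subseteq> chamber R y \<inter> vtx R \<and> finite V \<and> card V \<le> DIM('b) + 1"
      "\<forall>y x. generic_in R UNIV y \<and> y \<in> B \<and> x \<in> chamber R y \<longrightarrow>
         (\<exists>y' V. (y', V) \<in> C \<and> same_signs R y y' \<and> x \<in> convex hull V)"
    using flat_triangulation[OF assms(1) B1 B2, of "{}" "DIM('b)"] by auto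
  show ?thesis
  proof
    show "finite (snd ` C)" "card (snd ` C) \<le> (2 * card R) ^ DIM('b)"
      using C(1,2) card_image_le[OF C(1), of snd] by auto
    fix V assume "V \<in> snd ` C"
    then obtain y where y: "(y, V) \<in> C" by auto
    have "\<not> crosses h V" if "h \<in> R" for h
    proof
      assume "crosses h V"
      then obtain u v where uv: "u \<in> V" "v \<in> V" "hval h u > 0" "hval h v < 0" by (auto simp: crosses_def)
      then have "u \<in> chamber R y" "v \<in> chamber R y" using C(3) y by blast+
      then show False using chamber_sign(1)[of u R y h] chamber_sign(2)[of v R y h] that uv by auto
    qed
    then show "V \<subseteq> vtx R \<and> finite V \<and> card V \<le> DIM('b) + 1 \<and> (\<forall>h\<in>R. \<not> crosses h V)"
      using C(3) y by blast
  next
    fix x :: 'b assume x: "norm x \<le> \<rho>"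
    have xB: "x \<in> B" using x Basis_le_norm order_trans by (fastforce simp: B_iff)
    \<comment> \<open>A generic interior point g gives a direction: slightly moved towards g, the
      point x leaves all hyperplanes of nonzero functionals, and the cell it enters still has x in
      its closure.\<close>
    obtain g where g: "g \<in> ball 0 \<rho>" "\<And>h. h \<in> R \<Longrightarrow> hval h g = 0 \<Longrightarrow> h = 0"
      using exists_generic_point[OF assms(1), of "ball 0 \<rho>"] assms(2) by auto
    have gB: "g \<in> B" using g(1) Basis_le_norm[of _ g] by (fastforce simp: B_iff)
    obtain \<delta> where \<delta>: "\<delta> > 0" "\<And>h t. \<lbrakk>h \<in> R; \<bar>t\<bar> \<le> \<delta>; hval h x > 0\<rbrakk> \<Longrightarrow> hval h (x + t *\<^sub>R (g - x)) > 0"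
    "\<And>h t. \<lbrakk>h \<in> R; \<bar>t\<bar> \<le> \<delta>; hval h x < 0\<rbrakk> \<Longrightarrow> hval h (x + t *\<^sub>R (g - x)) < 0"
      using small_step_keeps_signs[OF assms(1)] by metis
    define t where "t = min \<delta> 1"
    define y where "y = x + t *\<^sub>R (g - x)"
    have t: "t > 0" "t \<le> 1" "\<bar>t\<bar> \<le> \<delta>" using \<delta>(1) by (auto simp: t_def)
    have "y = (1 - t) *\<^sub>R x + t *\<^sub>R g" by (simp add: y_def algebra_simps)
    then have yB: "y \<in> B" using convexD_alt[OF convB xB gB, of t] t by simp
    have pos: "hval h x > 0 \<Longrightarrow> hval h y > 0" "hval h x < 0 \<Longrightarrow> hval h y < 0" if "h \<in> R" for h
      using \<delta>(2,3) that t(3) unfolding y_def by blast+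
    have "hval h y = 0 \<Longrightarrow> h = 0" if h: "h \<in> R" for h
    proof -
      assume 0: "hval h y = 0"
      then have "hval h x = 0" using pos[OF h] by fastforce
      then have "t * hval h g = 0" using 0 unfolding y_def hval_affine by simp
      then show "h = 0" using t(1) g(2)[OF h] by simp
    qed
    then have "generic_in R UNIV y" by (fastforce simp: generic_in_def hval_def)
    moreover have "x \<in> chamber R y" unfolding chamber_def using pos by fastforce
    ultimately show "\<exists>V\<in>snd ` C. x \<in> convex hull V" using C(4) yB by force
  qed
qed

section \<open>Cuttings\<close>

text \<open>The vertices that members of S can define. Their number is bounded in terms of |S|
  alone, and |S| will depend on the dimension only, so the exponential bound is harmless.\<close>

definition points_of :: "('b::euclidean_space \<times> real) set \<Rightarrow> 'b set" where
  "points_of S = {v. \<exists>T\<subseteq>S. flat T = {v}}"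

lemma points_of_bound:
  assumes "finite S"
  shows "finite (points_of S)" "card (points_of S) \<le> 2 ^ card S"
proof -
  have sub: "points_of S \<subseteq> (\<lambda>T. THE v. flat T = {v}) ` Pow S"
    unfolding points_of_def by (auto simp: image_iff Bex_def intro!: exI)
  show "finite (points_of S)" using sub assms finite_subset by blast
  have "card (points_of S) \<le> card ((\<lambda>T. THE v. flat T = {v}) ` Pow S)"
    using sub assms by (intro card_mono) auto
  also have "\<dots> \<le> card (Pow S)" using assms by (intro card_image_le) auto
  finally show "card (points_of S) \<le> 2 ^ card S" using card_Pow[OF assms] by simp
qed

lemma card_small_subsets:
  "card {J. J \<subseteq> {..<m::nat} \<and> card J \<le> k} \<le> (m + 1) ^ k"
proof -
  have "{J. J \<subseteq> {..<m} \<and> card J \<le> k} \<subseteq> (\<lambda>f. f ` {..<k} \<inter> {..<m}) ` (PiE {..<k} (\<lambda>_. {..m}))"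
  proof
    fix J assume "J \<in> {J. J \<subseteq> {..<m} \<and> card J \<le> k}"
    then have J: "J \<subseteq> {..<m}" "card J \<le> k" "finite J" by (auto intro: finite_subset)
    obtain f where f: "bij_betw f {..<card J} J"
      using J(3) ex_bij_betw_nat_finite atLeast0LessThan by metis
    \<comment> \<open>The value m lies outside \<open>{..<m}\<close> and pads the enumeration of J
      to k arguments; intersecting the image with \<open>{..<m}\<close> removes it again.\<close>
    define g where "g = (\<lambda>i\<in>{..<k}. if i < card J then f i else m)"
    have "g \<in> PiE {..<k} (\<lambda>_. {..m})"
      using f J(1) by (fastforce simp: g_def bij_betw_def)
    moreover have "g ` {..<k} \<inter> {..<m} = J"
    proof
      show "g ` {..<k} \<inter> {..<m} \<subseteq> J" using f by (auto simp: g_def bij_betw_def split: if_splits)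
      show "J \<subseteq> g ` {..<k} \<inter> {..<m}"
      proof
        fix j assume j: "j \<in> J"
        then obtain i where "i < card J" "f i = j" using f by (metis bij_betw_imp_surj_on imageE lessThan_iff)
        then show "j \<in> g ` {..<k} \<inter> {..<m}" using J j by (auto simp: g_def image_iff intro!: bexI[of _ i])
      qed
    qed
    ultimately show "J \<in> (\<lambda>f. f ` {..<k} \<inter> {..<m}) ` (PiE {..<k} (\<lambda>_. {..m}))" by blast
  qed
  then have "card {J. J \<subseteq> {..<m} \<and> card J \<le> k} \<le> card (PiE {..<k} (\<lambda>_. {..m}))"
    by (meson card_image_le card_mono finite_PiE finite_atMost finite_imageI finite_lessThan le_trans)
  then show ?thesis by (simp add: card_PiE)
qed

text \<open>Each of the n vertices needs at most d functionals. They are recorded as indices, since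
  the sample is a sequence that may repeat a functional.\<close>

lemma vertices_from_few:
  fixes V :: "'b::euclidean_space set"
  assumes "V \<subseteq> vtx (f ` I \<union> B)" "finite V" "card V \<le> n"
  obtains J where "J \<subseteq> I" "finite J" "card J \<le> n * DIM('b)" "V \<subseteq> points_of (f ` J \<union> B)"
proof -
  have "\<exists>J. J \<subseteq> I \<and> finite J \<and> card J \<le> DIM('b) \<and> v \<in> points_of (f ` J \<union> B)" if v: "v \<in> V" for v
  proof -
    obtain A where A: "A \<subseteq> f ` I \<union> B" "finite A" "card A \<le> DIM('b)" "flat A = {v}"
      using vtx_few[of v "f ` I \<union> B"] subsetD[OF assms(1) v] by metis
    have "A \<inter> f ` I \<subseteq> f ` I" by blast
    then obtain J where J: "J \<subseteq> I" "inj_on f J" "A \<inter> f ` I = f ` J" using subset_image_inj by metis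
    have fJ: "finite J" using J A(2) by (metis finite_Int finite_imageD)
    have "card J = card (A \<inter> f ` I)" using J by (simp add: card_image)
    also have "\<dots> \<le> DIM('b)" using A(2,3) card_mono[of A "A \<inter> f ` I"] by simp
    finally have "card J \<le> DIM('b)" .
    moreover have "A \<subseteq> f ` J \<union> B" using A(1) J(3) by blast
    ultimately show ?thesis using J(1) fJ A(4) unfolding points_of_def by blast
  qed
  then obtain J where J: "\<And>v. v \<in> V \<Longrightarrow> J v \<subseteq> I \<and> finite (J v) \<and> card (J v) \<le> DIM('b) \<and> v \<in> points_of (f ` J v \<union> B)"
    by metis
  have "card (\<Union>v\<in>V. J v) \<le> (\<Sum>v\<in>V. card (J v))" by (rule card_UN_le[OF assms(2)])
  also have "\<dots> \<le> (\<Sum>v\<in>V. DIM('b))" using J by (intro sum_mono) blast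
  also have "\<dots> \<le> n * DIM('b)" using assms(3) by simp
  finally have "card (\<Union>v\<in>V. J v) \<le> n * DIM('b)" .
  moreover have "V \<subseteq> points_of (f ` (\<Union>v\<in>V. J v) \<union> B)"
  proof
    fix v assume v: "v \<in> V"
    have "f ` J v \<union> B \<subseteq> f ` (\<Union>v\<in>V. J v) \<union> B" using v by (intro Un_mono image_mono) auto
    moreover have "v \<in> points_of (f ` J v \<union> B)" using J[OF v] by simp
    ultimately show "v \<in> points_of (f ` (\<Union>v\<in>V. J v) \<union> B)"
      unfolding points_of_def mem_Collect_eq using order_trans by metis
  qed
  moreover have "(\<Union>v\<in>V. J v) \<subseteq> I" "finite (\<Union>v\<in>V. J v)" using J assms(2) by blast+
  ultimately show ?thesis using that by blast
qed

definition cross_weight where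
  "cross_weight H w V = (\<Sum>h | h \<in> H \<and> crosses h V. w h :: real)"

text \<open>Random sampling with a union bound, written with unnormalised sums: draw m functionals
  independently, proportionally to w. A simplex crossed by weight above W / s is fixed by at most D0
  of the draws, and each remaining draw avoids crossing it with probability at most 1 - 1/s. The
  functionals in B belong to every sample.\<close>

lemma sample_net:
  fixes H B :: "('b::euclidean_space \<times> real) set" and w :: "'b \<times> real \<Rightarrow> real" and s :: real
  defines "D0 \<equiv> (DIM('b) + 1) * DIM('b)"
  assumes H: "finite H" and w: "\<And>h. w h \<ge> 0" and W: "sum w H > 0" and s: "s \<ge> 1" and B: "finite B"
    and m: "D0 \<le> m" "real ((m + 1) ^ D0) * 2 ^ 2 ^ (D0 + card B) * (1 - 1/s) ^ (m - D0) < 1"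
  obtains R where "R \<subseteq> H" "finite R" "card R \<le> m"
    "\<And>V. V \<subseteq> vtx (R \<union> B) \<Longrightarrow> finite V \<Longrightarrow> card V \<le> DIM('b) + 1 \<Longrightarrow> \<forall>h\<in>R. \<not> crosses h V \<Longrightarrow>
       cross_weight H w V \<le> sum w H / s"
proof -
  define W where "W = sum w H"
  have W0: "W > 0" using W by (simp add: W_def)
  define \<Omega> where "\<Omega> = PiE {..<m} (\<lambda>_. H)"
  define \<J> where "\<J> = {J. J \<subseteq> {..<m} \<and> card J \<le> D0}"
  \<comment> \<open>The bad vertex sets that the draws \<open>\<sigma>\<close> at the positions J,
    together with B, can produce.\<close>
  define X where "X J \<sigma> = {V \<in> Pow (points_of (\<sigma> ` J \<union> B)). cross_weight H w V > W / s}" for J and \<sigma> :: "nat \<Rightarrow> 'b \<times> real"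
  \<comment> \<open>The product of these factors over i is the indicator of the event that the draws
    agree with \<open>\<sigma>\<close> on J and that no draw outside J crosses V.\<close>
  define c where "c J \<sigma> V i h = (if i \<in> J then (if h = \<sigma> i then 1 else 0) else if crosses h V then 0 else (1::real))"
    for J and \<sigma> :: "nat \<Rightarrow> 'b \<times> real" and V i h
  have fin: "finite \<Omega>" "finite \<J>" using H by (auto simp: \<Omega>_def \<J>_def finite_PiE)
  have finPi: "finite (PiE J (\<lambda>_. H))" if "J \<in> \<J>" for J
    using that H by (intro finite_PiE) (auto simp: \<J>_def intro: finite_subset)
  have finJ: "finite J" "card J \<le> D0" "J \<subseteq> {..<m}" if "J \<in> \<J>" for J
    using that by (auto simp: \<J>_def intro: finite_subset)
  have finX: "finite (X J \<sigma>)" "card (X J \<sigma>) \<le> 2 ^ 2 ^ (D0 + card B)" if "J \<in> \<J>" for J \<sigma>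
  proof -
    have fS: "finite (\<sigma> ` J \<union> B)" using finJ[OF that] B by simp
    have "card (\<sigma> ` J \<union> B) \<le> D0 + card B"
      using card_Un_le[of "\<sigma> ` J" B] card_image_le[OF finJ(1)[OF that], of \<sigma>] finJ(2)[OF that] by linarith
    then have "card (points_of (\<sigma> ` J \<union> B)) \<le> 2 ^ (D0 + card B)"
      using points_of_bound(2)[OF fS] power_increasing[of "card (\<sigma> ` J \<union> B)" "D0 + card B" "2::nat"] by linarith
    moreover have fP: "finite (Pow (points_of (\<sigma> ` J \<union> B)))" using points_of_bound(1)[OF fS] by simp
    moreover have "card (X J \<sigma>) \<le> card (Pow (points_of (\<sigma> ` J \<union> B)))"
      by (rule card_mono[OF fP]) (auto simp: X_def)
    ultimately show "card (X J \<sigma>) \<le> 2 ^ 2 ^ (D0 + card B)"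
      using card_Pow[OF points_of_bound(1)[OF fS]]
        power_increasing[of "card (points_of (\<sigma> ` J \<union> B))" "2 ^ (D0 + card B)" "2::nat"]
      by linarith
    show "finite (X J \<sigma>)" by (rule finite_subset[OF _ fP]) (auto simp: X_def)
  qed
  have c0: "c J \<sigma> V i h \<ge> 0" for J \<sigma> V i h by (simp add: c_def)
  have "\<exists>\<omega>\<in>\<Omega>. \<forall>V. V \<subseteq> vtx (\<omega> ` {..<m} \<union> B) \<and> finite V \<and> card V \<le> DIM('b) + 1 \<and> (\<forall>h\<in>\<omega> ` {..<m}. \<not> crosses h V) \<longrightarrow>
       cross_weight H w V \<le> W / s"
  proof (rule ccontr)
    assume neg: "\<not> ?thesis"
    \<comment> \<open>Each sequence is assumed to admit a bad simplex and is therefore counted by at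
      least one triple (J, \<open>\<sigma>\<close>, V).\<close>
    have ge1: "1 \<le> (\<Sum>J\<in>\<J>. \<Sum>\<sigma>\<in>PiE J (\<lambda>_. H). \<Sum>V\<in>X J \<sigma>. \<Prod>i<m. c J \<sigma> V i (\<omega> i))" if \<omega>: "\<omega> \<in> \<Omega>" for \<omega>
    proof -
      obtain V where V: "V \<subseteq> vtx (\<omega> ` {..<m} \<union> B)" "finite V" "card V \<le> DIM('b) + 1"
         "\<forall>h\<in>\<omega> ` {..<m}. \<not> crosses h V" "cross_weight H w V > W / s" using neg \<omega> by force
      obtain J where J: "J \<subseteq> {..<m}" "finite J" "card J \<le> D0" "V \<subseteq> points_of (\<omega> ` J \<union> B)"
        using vertices_from_few[OF V(1-3)] unfolding D0_def by blast
      have JJ: "J \<in> \<J>" using J by (simp add: \<J>_def)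
      define \<sigma> where "\<sigma> = restrict \<omega> J"
      have \<sigma>: "\<sigma> \<in> PiE J (\<lambda>_. H)" using \<omega> J(1) by (auto simp: \<sigma>_def \<Omega>_def PiE_iff)
      have "\<sigma> ` J = \<omega> ` J" by (simp add: \<sigma>_def)
      then have VX: "V \<in> X J \<sigma>" using J(4) V(5) by (simp add: X_def)
      have "c J \<sigma> V i (\<omega> i) = 1" if "i \<in> {..<m}" for i
        using V(4) that by (auto simp: c_def \<sigma>_def)
      then have "1 = (\<Prod>i<m. c J \<sigma> V i (\<omega> i))" by simp
      also have "\<dots> \<le> (\<Sum>V\<in>X J \<sigma>. \<Prod>i<m. c J \<sigma> V i (\<omega> i))"
        by (rule member_le_sum[OF VX]) (auto intro!: prod_nonneg c0 finX JJ)
      also have "\<dots> \<le> (\<Sum>\<sigma>\<in>PiE J (\<lambda>_. H). \<Sum>V\<in>X J \<sigma>. \<Prod>i<m. c J \<sigma> V i (\<omega> i))"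
        by (rule member_le_sum[OF \<sigma>]) (auto intro!: sum_nonneg prod_nonneg c0 finPi JJ)
      also have "\<dots> \<le> (\<Sum>J\<in>\<J>. \<Sum>\<sigma>\<in>PiE J (\<lambda>_. H). \<Sum>V\<in>X J \<sigma>. \<Prod>i<m. c J \<sigma> V i (\<omega> i))"
        by (rule member_le_sum[OF JJ]) (auto intro!: sum_nonneg prod_nonneg c0 fin)
      finally show ?thesis .
    qed
    \<comment> \<open>Independence: the sum over sequences factors over the positions. A position in
      J contributes the weight of the prescribed draw, any other at most W minus the crossing weight
      of V.\<close>
    have inner: "(\<Sum>\<omega>\<in>\<Omega>. (\<Prod>i<m. w (\<omega> i)) * (\<Prod>i<m. c J \<sigma> V i (\<omega> i))) \<le> (\<Prod>i\<in>J. w (\<sigma> i)) * ((1 - 1/s) * W) ^ (m - card J)"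
      if J: "J \<in> \<J>" and \<sigma>: "\<sigma> \<in> PiE J (\<lambda>_. H)" and V: "V \<in> X J \<sigma>" for J \<sigma> V
    proof -
      have "(\<Sum>\<omega>\<in>\<Omega>. (\<Prod>i<m. w (\<omega> i)) * (\<Prod>i<m. c J \<sigma> V i (\<omega> i))) = (\<Prod>i<m. \<Sum>h\<in>H. w h * c J \<sigma> V i h)"
        unfolding \<Omega>_def prod.distrib[symmetric] using H by (subst prod_sum_PiE) auto
      also have "\<dots> \<le> (\<Prod>i<m. if i \<in> J then w (\<sigma> i) else (1 - 1/s) * W)"
      proof (rule prod_mono, intro conjI)
        fix i assume i: "i \<in> {..<m}"
        show "0 \<le> (\<Sum>h\<in>H. w h * c J \<sigma> V i h)" by (intro sum_nonneg mult_nonneg_nonneg w c0)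
        show "(\<Sum>h\<in>H. w h * c J \<sigma> V i h) \<le> (if i \<in> J then w (\<sigma> i) else (1 - 1/s) * W)"
        proof (cases "i \<in> J")
          case True
          have "(\<Sum>h\<in>H. w h * c J \<sigma> V i h) = (\<Sum>h\<in>H. if h = \<sigma> i then w h else 0)"
            using True by (intro sum.cong) (auto simp: c_def)
          also have "\<dots> = w (\<sigma> i)" using H PiE_mem[OF \<sigma> True] by simp
          finally show ?thesis using True by simp
        next
          case False
          have "(\<Sum>h\<in>H. w h * c J \<sigma> V i h) = (\<Sum>h\<in>H. w h - (if crosses h V then w h else 0))"
            using False by (intro sum.cong) (auto simp: c_def)
          also have "\<dots> = W - cross_weight H w V"
            unfolding sum_subtractf W_def cross_weight_def using H by (simp add: sum.inter_filter)
          also have "\<dots> \<le> (1 - 1/s) * W" using V by (simp add: X_def algebra_simps)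
          finally show ?thesis using False by simp
        qed
      qed
      also have "\<dots> = (\<Prod>i\<in>J. w (\<sigma> i)) * ((1 - 1/s) * W) ^ (m - card J)"
      proof -
        have split: "{..<m} \<inter> J = J" "card ({..<m} \<inter> - J) = m - card J"
          using finJ[OF J] card_Diff_subset[of J "{..<m}"] by (auto simp: Diff_eq[symmetric])
        show ?thesis by (subst prod.If_cases) (simp_all add: split Collect_mem_eq)
      qed
      finally show ?thesis .
    qed
    \<comment> \<open>The total weight of all sequences is W^m; the union bound makes it smaller
      than itself.\<close>
    have "W ^ m = (\<Sum>\<omega>\<in>\<Omega>. \<Prod>i<m. w (\<omega> i))"
      unfolding \<Omega>_def W_def using H by (subst prod_sum_PiE[symmetric]) auto
    also have "\<dots> \<le> (\<Sum>\<omega>\<in>\<Omega>. (\<Prod>i<m. w (\<omega> i)) * (\<Sum>J\<in>\<J>. \<Sum>\<sigma>\<in>PiE J (\<lambda>_. H). \<Sum>V\<in>X J \<sigma>. \<Prod>i<m. c J \<sigma> V i (\<omega> i)))"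
    proof (rule sum_mono)
      fix \<omega> assume "\<omega> \<in> \<Omega>"
      from mult_left_mono[OF ge1[OF this], of "\<Prod>i<m. w (\<omega> i)"]
      show "(\<Prod>i<m. w (\<omega> i)) \<le> (\<Prod>i<m. w (\<omega> i)) * (\<Sum>J\<in>\<J>. \<Sum>\<sigma>\<in>PiE J (\<lambda>_. H). \<Sum>V\<in>X J \<sigma>. \<Prod>i<m. c J \<sigma> V i (\<omega> i))"
        by (simp add: prod_nonneg w)
    qed
    also have "\<dots> = (\<Sum>\<omega>\<in>\<Omega>. \<Sum>J\<in>\<J>. \<Sum>\<sigma>\<in>PiE J (\<lambda>_. H). \<Sum>V\<in>X J \<sigma>. (\<Prod>i<m. w (\<omega> i)) * (\<Prod>i<m. c J \<sigma> V i (\<omega> i)))"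
      by (simp only: sum_distrib_left)
    also have "\<dots> = (\<Sum>J\<in>\<J>. \<Sum>\<omega>\<in>\<Omega>. \<Sum>\<sigma>\<in>PiE J (\<lambda>_. H). \<Sum>V\<in>X J \<sigma>. (\<Prod>i<m. w (\<omega> i)) * (\<Prod>i<m. c J \<sigma> V i (\<omega> i)))"
      by (rule sum.swap)
    also have "\<dots> \<le> (\<Sum>J\<in>\<J>. 2 ^ 2 ^ (D0 + card B) * (1 - 1/s) ^ (m - D0) * W ^ m)"
    proof (rule sum_mono)
      fix J assume J: "J \<in> \<J>"
      have q: "0 \<le> 1 - 1/s" "1 - 1/s \<le> 1" using s by auto
      have "(\<Sum>\<omega>\<in>\<Omega>. \<Sum>\<sigma>\<in>PiE J (\<lambda>_. H). \<Sum>V\<in>X J \<sigma>. (\<Prod>i<m. w (\<omega> i)) * (\<Prod>i<m. c J \<sigma> V i (\<omega> i)))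
         = (\<Sum>\<sigma>\<in>PiE J (\<lambda>_. H). \<Sum>\<omega>\<in>\<Omega>. \<Sum>V\<in>X J \<sigma>. (\<Prod>i<m. w (\<omega> i)) * (\<Prod>i<m. c J \<sigma> V i (\<omega> i)))"
        by (rule sum.swap)
      also have "\<dots> = (\<Sum>\<sigma>\<in>PiE J (\<lambda>_. H). \<Sum>V\<in>X J \<sigma>. \<Sum>\<omega>\<in>\<Omega>. (\<Prod>i<m. w (\<omega> i)) * (\<Prod>i<m. c J \<sigma> V i (\<omega> i)))"
        by (intro sum.cong refl sum.swap)
      also have "\<dots> \<le> (\<Sum>\<sigma>\<in>PiE J (\<lambda>_. H). \<Sum>V\<in>X J \<sigma>. (\<Prod>i\<in>J. w (\<sigma> i)) * ((1 - 1/s) * W) ^ (m - card J))"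
        by (intro sum_mono inner J)
      also have "\<dots> \<le> (\<Sum>\<sigma>\<in>PiE J (\<lambda>_. H). 2 ^ 2 ^ (D0 + card B) * ((\<Prod>i\<in>J. w (\<sigma> i)) * ((1 - 1/s) * W) ^ (m - card J)))"
      proof (rule sum_mono)
        fix \<sigma>
        have "real (card (X J \<sigma>)) \<le> 2 ^ 2 ^ (D0 + card B)"
          using finX(2)[OF J, of \<sigma>] by (metis of_nat_le_iff of_nat_numeral of_nat_power)
        then show "(\<Sum>V\<in>X J \<sigma>. (\<Prod>i\<in>J. w (\<sigma> i)) * ((1 - 1/s) * W) ^ (m - card J))
          \<le> 2 ^ 2 ^ (D0 + card B) * ((\<Prod>i\<in>J. w (\<sigma> i)) * ((1 - 1/s) * W) ^ (m - card J))"
          unfolding sum_constant using q W0 w by (intro mult_right_mono mult_nonneg_nonneg prod_nonneg zero_le_power) auto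
      qed
      also have "\<dots> = 2 ^ 2 ^ (D0 + card B) * ((1 - 1/s) * W) ^ (m - card J) * (\<Sum>\<sigma>\<in>PiE J (\<lambda>_. H). \<Prod>i\<in>J. w (\<sigma> i))"
        unfolding sum_distrib_left by (intro sum.cong refl) (simp only: mult_ac)
      also have "(\<Sum>\<sigma>\<in>PiE J (\<lambda>_. H). \<Prod>i\<in>J. w (\<sigma> i)) = W ^ card J"
        unfolding W_def using H finJ[OF J] by (subst prod_sum_PiE[symmetric]) auto
      also have "2 ^ 2 ^ (D0 + card B) * ((1 - 1/s) * W) ^ (m - card J) * W ^ card J
          = 2 ^ 2 ^ (D0 + card B) * (1 - 1/s) ^ (m - card J) * (W ^ (m - card J) * W ^ card J)"
        by (simp add: power_mult_distrib)
      also have "W ^ (m - card J) * W ^ card J = W ^ m"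
        using finJ[OF J] m(1) by (simp add: power_add[symmetric])
      also have "2 ^ 2 ^ (D0 + card B) * (1 - 1/s) ^ (m - card J) * W ^ m \<le> 2 ^ 2 ^ (D0 + card B) * (1 - 1/s) ^ (m - D0) * W ^ m"
        using q W0 finJ(2)[OF J] by (intro mult_right_mono mult_left_mono power_decreasing) auto
      finally show "(\<Sum>\<omega>\<in>\<Omega>. \<Sum>\<sigma>\<in>PiE J (\<lambda>_. H). \<Sum>V\<in>X J \<sigma>. (\<Prod>i<m. w (\<omega> i)) * (\<Prod>i<m. c J \<sigma> V i (\<omega> i)))
        \<le> 2 ^ 2 ^ (D0 + card B) * (1 - 1/s) ^ (m - D0) * W ^ m" .
    qed
    also have "\<dots> = (real (card \<J>) * 2 ^ 2 ^ (D0 + card B) * (1 - 1/s) ^ (m - D0)) * W ^ m" by simp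
    also have "\<dots> \<le> (real ((m + 1) ^ D0) * 2 ^ 2 ^ (D0 + card B) * (1 - 1/s) ^ (m - D0)) * W ^ m"
      using card_small_subsets[of m D0] s W0 unfolding \<J>_def
      by (intro mult_right_mono zero_le_power) (auto simp del: of_nat_power of_nat_add)
    also have "\<dots> < 1 * W ^ m" using m(2) W0 by (intro mult_strict_right_mono) auto
    finally show False by simp
  qed
  then obtain \<omega> where \<omega>: "\<omega> \<in> \<Omega>" "\<And>V. V \<subseteq> vtx (\<omega> ` {..<m} \<union> B) \<and> finite V \<and> card V \<le> DIM('b) + 1 \<and> (\<forall>h\<in>\<omega> ` {..<m}. \<not> crosses h V) \<Longrightarrow>
       cross_weight H w V \<le> W / s" by blast
  show ?thesis
  proof
    show "\<omega> ` {..<m} \<subseteq> H" using PiE_mem[of \<omega> "{..<m}" "\<lambda>_. H"] \<omega>(1) unfolding \<Omega>_def by blast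
    show "card (\<omega> ` {..<m}) \<le> m" using card_image_le[of "{..<m}" \<omega>] by simp
    show "finite (\<omega> ` {..<m})" by simp
    show "cross_weight H w V \<le> sum w H / s" if "V \<subseteq> vtx (\<omega> ` {..<m} \<union> B)" "finite V" "card V \<le> DIM('b) + 1"
        "\<forall>h\<in>\<omega> ` {..<m}. \<not> crosses h V" for V
      unfolding W_def[symmetric] by (rule \<omega>(2)) (intro conjI that)
  qed
qed

lemma sample_size_bound:
  fixes \<eta> :: real and D D0 :: nat and N0 c :: real
  assumes "\<eta> > 0" "N0 > 0" "c \<ge> 0" "D \<ge> 1"
  shows "\<exists>s0\<ge>1. \<forall>s\<ge>s0. \<exists>m::nat. D0 \<le> m \<and> real ((m + 1) ^ D0) * N0 * (1 - 1/s) ^ (m - D0) < 1 \<and>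
     2 ^ (D + 1) * (2 * (real m + c)) ^ D \<le> s powr (real D + \<eta>)"
proof -
  \<comment> \<open>With m about s^(1+\<theta>) the failure bound exp(-s^\<theta>) beats every
    polynomial, while m^D is about s^(D + \<eta>/2), which leaves s^(\<eta>/2) for the
    constants.\<close>
  define \<theta> where "\<theta> = \<eta> / (2 * real D)"
  have \<theta>: "\<theta> > 0" using assms by (simp add: \<theta>_def)
  have "\<forall>\<^sub>F x::real in at_top. (x powr (1 + \<theta>) + 2 + real D0) ^ D0 * N0 * exp (- (x powr \<theta>)) < 1"
    using \<theta> assms(2) by real_asymp
  moreover have "\<forall>\<^sub>F x::real in at_top. 2 ^ (D + 1) * (2 * (x powr (1 + \<theta>) + 1 + real D0 + c)) ^ D \<le> x powr (real D + \<eta>)"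
  proof -
    have "\<forall>\<^sub>F x::real in at_top. 2 * (x powr (1 + \<theta>) + 1 + real D0 + c) \<le> 3 * x powr (1 + \<theta>)"
      using \<theta> by real_asymp
    moreover have "\<forall>\<^sub>F x::real in at_top. 2 ^ (D + 1) * 3 ^ D * x powr (real D + \<eta> / 2) \<le> x powr (real D + \<eta>)"
      using assms(1) by real_asymp
    moreover have "\<forall>\<^sub>F x::real in at_top. x > 0" by (rule eventually_gt_at_top)
    ultimately show ?thesis
    proof eventually_elim
      case (elim x)
      have "2 ^ (D + 1) * (2 * (x powr (1 + \<theta>) + 1 + real D0 + c)) ^ D \<le> 2 ^ (D + 1) * (3 * x powr (1 + \<theta>)) ^ D"
        using elim assms by (intro mult_left_mono power_mono) auto
      also have "\<dots> = 2 ^ (D + 1) * 3 ^ D * x powr (real D + \<eta> / 2)"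
      proof -
        have "(1 + \<theta>) * real D = real D + \<eta> / 2" using assms(4) by (simp add: \<theta>_def field_simps)
        moreover have "(x powr (1 + \<theta>)) ^ D = x powr ((1 + \<theta>) * real D)"
          using elim(3) by (simp add: powr_powr[symmetric] powr_realpow)
        ultimately show ?thesis by (simp add: power_mult_distrib)
      qed
      finally show ?case using elim by linarith
    qed
  qed
  moreover have "\<forall>\<^sub>F x::real in at_top. x \<ge> 1" by (rule eventually_ge_at_top)
  ultimately have "\<forall>\<^sub>F x::real in at_top. \<exists>m::nat. D0 \<le> m \<and> real ((m + 1) ^ D0) * N0 * (1 - 1/x) ^ (m - D0) < 1 \<and>
     2 ^ (D + 1) * (2 * (real m + c)) ^ D \<le> x powr (real D + \<eta>)"
  proof eventually_elim
    case (elim x)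
    define k where "k = nat \<lceil>x powr (1 + \<theta>)\<rceil>"
    define m where "m = D0 + k"
    have k: "x powr (1 + \<theta>) \<le> real k" "real k \<le> x powr (1 + \<theta>) + 1"
      using real_nat_ceiling_ge[of "x powr (1 + \<theta>)"] of_nat_nat[of "\<lceil>x powr (1 + \<theta>)\<rceil>"]
        of_int_ceiling_le_add_one[of "x powr (1 + \<theta>)"] powr_ge_zero[of x "1 + \<theta>"]
      unfolding k_def by linarith+
    have "(1 - 1/x) ^ k \<le> exp (- (x powr \<theta>))"
    proof -
      have "(1 - 1/x) ^ k \<le> exp (- (1/x)) ^ k"
        using elim(3) exp_ge_add_one_self[of "- (1/x)"] by (intro power_mono) auto
      also have "\<dots> = exp (- (real k / x))" by (simp add: exp_of_nat_mult[symmetric] field_simps)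
      also have "real k / x \<ge> x powr \<theta>"
        using k(1) elim(3) by (simp add: field_simps powr_add)
      then have "exp (- (real k / x)) \<le> exp (- (x powr \<theta>))" by simp
      finally show ?thesis .
    qed
    moreover have "real ((m + 1) ^ D0) \<le> (x powr (1 + \<theta>) + 2 + real D0) ^ D0"
      unfolding of_nat_power using k(2) by (intro power_mono) (auto simp: m_def)
    ultimately have "real ((m + 1) ^ D0) * N0 * (1 - 1/x) ^ (m - D0) \<le> (x powr (1 + \<theta>) + 2 + real D0) ^ D0 * N0 * exp (- (x powr \<theta>))"
      using assms(2) elim(3) by (intro mult_mono) (auto simp: m_def)
    moreover have "2 ^ (D + 1) * (2 * (real m + c)) ^ D \<le> 2 ^ (D + 1) * (2 * (x powr (1 + \<theta>) + 1 + real D0 + c)) ^ D"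
      using k(2) assms(3) by (intro mult_left_mono power_mono) (auto simp: m_def)
    moreover have "D0 \<le> m" by (simp add: m_def)
    ultimately show ?case using elim by (intro exI[of _ m] conjI) (assumption | linarith)+
  qed
  then obtain s0 where "\<forall>s\<ge>s0. \<exists>m::nat. D0 \<le> m \<and> real ((m + 1) ^ D0) * N0 * (1 - 1/s) ^ (m - D0) < 1 \<and>
     2 ^ (D + 1) * (2 * (real m + c)) ^ D \<le> s powr (real D + \<eta>)" by (auto simp: eventually_at_top_linorder)
  then show ?thesis by (intro exI[of _ "max 1 s0"]) auto
qed

lemma cross_weight_mono:
  assumes "finite H" "\<And>h. w h \<ge> 0" "U \<subseteq> V"
  shows "cross_weight H w U \<le> cross_weight H w V"
  unfolding cross_weight_def using assms by (intro sum_mono2) (auto simp: crosses_def)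

lemma cross_weight_le_sum:
  assumes "finite H" "\<And>h. w h \<ge> 0"
  shows "cross_weight H w V \<le> sum w H"
  unfolding cross_weight_def using assms by (intro sum_mono2) auto

text \<open>The cells come from triangulating the arrangement of a random sample. They are
  relatively open, so that an uncrossed cell has constant sign, boundary points included.\<close>

theorem cutting:
  fixes \<eta> :: real
  assumes "\<eta> > 0"
  shows "\<exists>s0\<ge>1. \<forall>s\<ge>s0. \<forall>(H :: ('b::euclidean_space \<times> real) set) w \<rho>. finite H \<and> (\<forall>h. w h \<ge> 0) \<and> \<rho> > 0 \<longrightarrow>
     (\<exists>\<V>. finite \<V> \<and> real (card \<V>) \<le> s powr (DIM('b) + \<eta>) \<and>
       (\<forall>V\<in>\<V>. finite V \<and> card V \<le> DIM('b) + 1 \<and> cross_weight H w V \<le> sum w H / s) \<and>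
       (\<forall>x. norm x \<le> \<rho> \<longrightarrow> (\<exists>V\<in>\<V>. x \<in> poshull V)))"
proof -
  let ?D = "DIM('b)"
  define D0 where "D0 = (?D + 1) * ?D"
  obtain s0 where s0: "s0 \<ge> 1" "\<And>s. s \<ge> s0 \<Longrightarrow> \<exists>m::nat. D0 \<le> m \<and> real ((m + 1) ^ D0) * 2 ^ 2 ^ (D0 + 2 * ?D) * (1 - 1/s) ^ (m - D0) < 1 \<and>
     2 ^ (?D + 1) * (2 * (real m + real (2 * ?D))) ^ ?D \<le> s powr (real ?D + \<eta>)"
    using sample_size_bound[OF assms, of "2 ^ 2 ^ (D0 + 2 * ?D)" "real (2 * ?D)" ?D D0] by auto
  have "\<exists>\<V>. finite \<V> \<and> real (card \<V>) \<le> s powr (?D + \<eta>) \<and>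
       (\<forall>V\<in>\<V>. finite V \<and> card V \<le> ?D + 1 \<and> cross_weight H w V \<le> sum w H / s) \<and>
       (\<forall>x. norm x \<le> \<rho> \<longrightarrow> (\<exists>V\<in>\<V>. x \<in> poshull V))"
    if s: "s \<ge> s0" and H: "finite H" and w: "\<And>h. w h \<ge> 0" and \<rho>: "\<rho> > 0" for s \<rho> and H :: "('b \<times> real) set" and w
  proof -
    let ?B = "box_functionals \<rho> :: ('b \<times> real) set"
    obtain m where m: "D0 \<le> m" "real ((m + 1) ^ D0) * 2 ^ 2 ^ (D0 + 2 * ?D) * (1 - 1/s) ^ (m - D0) < 1"
       "2 ^ (?D + 1) * (2 * (real m + real (2 * ?D))) ^ ?D \<le> s powr (real ?D + \<eta>)"
      using s0(2)[OF s] by blast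
    have s1: "s \<ge> 1" using s s0(1) by simp
    have "\<exists>R. R \<subseteq> H \<and> finite R \<and> card R \<le> m \<and> (\<forall>V. V \<subseteq> vtx (R \<union> ?B) \<and> finite V \<and> card V \<le> ?D + 1 \<and> (\<forall>h\<in>R. \<not> crosses h V) \<longrightarrow>
       cross_weight H w V \<le> sum w H / s)"
    proof (cases "sum w H > 0")
      case True
      have "(2::real) ^ 2 ^ (D0 + card ?B) \<le> 2 ^ 2 ^ (D0 + 2 * ?D)"
        using card_box_functionals[where 'b = 'b and \<rho> = \<rho>] by (intro power_increasing) auto
      then have "real ((m + 1) ^ D0) * 2 ^ 2 ^ (D0 + card ?B) * (1 - 1/s) ^ (m - D0) \<le>
          real ((m + 1) ^ D0) * 2 ^ 2 ^ (D0 + 2 * ?D) * (1 - 1/s) ^ (m - D0)"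
        using s1 by (intro mult_right_mono mult_left_mono zero_le_power) auto
      then have m2: "real ((m + 1) ^ D0) * 2 ^ 2 ^ (D0 + card ?B) * (1 - 1/s) ^ (m - D0) < 1" using m(2) by linarith
      obtain R where "R \<subseteq> H" "finite R" "card R \<le> m"
        "\<And>V. V \<subseteq> vtx (R \<union> ?B) \<Longrightarrow> finite V \<Longrightarrow> card V \<le> DIM('b) + 1 \<Longrightarrow> \<forall>h\<in>R. \<not> crosses h V \<Longrightarrow>
           cross_weight H w V \<le> sum w H / s"
        using sample_net[OF H w True s1 finite_box_functionals, of m \<rho>] m(1) m2 unfolding D0_def by metis
      then show ?thesis by (intro exI[of _ R]) blast
    next
      case False
      \<comment> \<open>With zero total weight there is nothing to sample from, but then no cell has
        positive crossing weight either.\<close>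
      then have z: "sum w H = 0" using sum_nonneg[of H w] w by fastforce
      then have "cross_weight H w V \<le> sum w H / s" for V
        using cross_weight_le_sum[OF H, of w V] w by simp
      then show ?thesis by (intro exI[of _ "{}"]) auto
    qed
    then obtain R where R: "R \<subseteq> H" "finite R" "card R \<le> m"
        "\<And>V. V \<subseteq> vtx (R \<union> ?B) \<Longrightarrow> finite V \<Longrightarrow> card V \<le> ?D + 1 \<Longrightarrow> \<forall>h\<in>R. \<not> crosses h V \<Longrightarrow>
       cross_weight H w V \<le> sum w H / s" by blast
    obtain \<V> where V: "finite \<V>" "card \<V> \<le> (2 * card (R \<union> ?B)) ^ ?D"
      "\<And>V. V \<in> \<V> \<Longrightarrow> V \<subseteq> vtx (R \<union> ?B) \<and> finite V \<and> card V \<le> ?D + 1 \<and> (\<forall>h\<in>R \<union> ?B. \<not> crosses h V)"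
      "\<And>x. norm x \<le> \<rho> \<Longrightarrow> \<exists>V\<in>\<V>. x \<in> convex hull V"
    proof -
      have "finite (R \<union> ?B)" "?B \<subseteq> R \<union> ?B" using R(2) by simp_all
      from box_triangulation[OF this(1) \<rho> this(2)] show ?thesis using that by blast
    qed
    \<comment> \<open>A point of a closed simplex lies in the open simplex of some face, so all
      faces are taken; this explains the factor 2^(d+1) in \<open>sample_size_bound\<close>.\<close>
    define \<U> where "\<U> = (\<Union>V\<in>\<V>. Pow V)"
    have "card \<U> \<le> (\<Sum>V\<in>\<V>. card (Pow V))" unfolding \<U>_def by (rule card_UN_le[OF V(1)])
    also have "\<dots> \<le> (\<Sum>V\<in>\<V>. 2 ^ (?D + 1))"
    proof (rule sum_mono)
      fix V assume "V \<in> \<V>"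
      then have "finite V" "card V \<le> ?D + 1" using V(3) by blast+
      then show "card (Pow V) \<le> 2 ^ (?D + 1)"
        using power_increasing[of "card V" "?D + 1" "2::nat"] by (simp add: card_Pow del: power_Suc)
    qed
    also have "\<dots> = 2 ^ (?D + 1) * card \<V>" by simp
    also have "\<dots> \<le> 2 ^ (?D + 1) * (2 * (m + 2 * ?D)) ^ ?D"
    proof -
      have "card (R \<union> ?B) \<le> m + 2 * ?D"
        using card_Un_le[of R ?B] R(3) card_box_functionals[where 'b = 'b and \<rho> = \<rho>] by linarith
      then have "(2 * card (R \<union> ?B)) ^ ?D \<le> (2 * (m + 2 * ?D)) ^ ?D" by (intro power_mono) auto
      then show ?thesis using V(2) by (intro mult_left_mono) linarith+
    qed
    finally have "real (card \<U>) \<le> real (2 ^ (?D + 1) * (2 * (m + 2 * ?D)) ^ ?D)" by (simp only: of_nat_le_iff)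
    also have "\<dots> \<le> s powr (real ?D + \<eta>)" using m(3) by simp
    finally have card: "real (card \<U>) \<le> s powr (real ?D + \<eta>)" .
    have "finite \<U>" using V(1,3) unfolding \<U>_def by (intro finite_UN_I) auto
    moreover have "finite U \<and> card U \<le> ?D + 1 \<and> cross_weight H w U \<le> sum w H / s" if U: "U \<in> \<U>" for U
    proof -
      obtain V where UV: "V \<in> \<V>" "U \<subseteq> V" using U by (auto simp: \<U>_def)
      have V': "V \<subseteq> vtx (R \<union> ?B)" "finite V" "card V \<le> ?D + 1" "\<forall>h\<in>R. \<not> crosses h V" using V(3)[OF UV(1)] by blast+
      have "finite U" "card U \<le> card V" using UV(2) V'(2) by (auto intro: finite_subset card_mono)
      moreover have "cross_weight H w U \<le> sum w H / s"
        using order_trans[OF cross_weight_mono[OF H w UV(2)] R(4)[OF V']] .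
      ultimately show ?thesis using V'(3) by linarith
    qed
    moreover have "\<exists>U\<in>\<U>. x \<in> poshull U" if x: "norm x \<le> \<rho>" for x
    proof -
      obtain V where V': "V \<in> \<V>" "x \<in> convex hull V" using V(4)[OF x] by blast
      moreover have "finite V" using V(3) V'(1) by blast
      ultimately obtain U where "U \<subseteq> V" "x \<in> poshull U" using convex_hull_poshull by blast
      then show ?thesis using V'(1) by (auto simp: \<U>_def)
    qed
    ultimately show ?thesis using card by blast
  qed
  note claim = this
  show ?thesis
    by (intro exI[of _ s0] conjI allI impI s0(1)) (elim conjE, rule claim; (assumption | erule spec))
qed

section \<open>Low-crossing partitions\<close>

text \<open>Point-hyperplane duality: p acts on functionals by evaluation, so cuttings can be
  applied in the (d+1)-dimensional space of functionals. The action is linear, so that rescaling a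
  functional is harmless.\<close>

definition dual_functional :: "'a::euclidean_space \<Rightarrow> ('a \<times> real) \<times> real" where
  "dual_functional p = ((p, -1), 0)"

lemma hval_dual_functional: "hval (dual_functional p) h = hval h p"
  by (simp add: hval_def dual_functional_def inner_prod_def inner_commute)

lemma hval_scale: "hval (c *\<^sub>R h) p = c * hval h p"
  by (simp add: hval_def algebra_simps)

text \<open>When all terms have the same weak sign, the sign of a positive combination depends only
  on the signs of its terms.\<close>

lemma sgn_weighted_sum:
  fixes f g u :: "'b \<Rightarrow> real"
  assumes "finite V" "\<And>q. q \<in> V \<Longrightarrow> u q > 0" "\<And>q. q \<in> V \<Longrightarrow> sgn (f q) = sgn (g q)"
    "(\<forall>q\<in>V. f q \<ge> 0) \<or> (\<forall>q\<in>V. f q \<le> 0)"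
  shows "sgn (\<Sum>q\<in>V. u q * f q) = sgn (\<Sum>q\<in>V. u q * g q)"
proof -
  have pos: "sgn (\<Sum>q\<in>V. u q * f q) = sgn (\<Sum>q\<in>V. u q * g q)"
    if fg: "\<And>q. q \<in> V \<Longrightarrow> sgn (f q) = sgn (g q)" "\<forall>q\<in>V. f q \<ge> 0" for f g :: "'b \<Rightarrow> real"
  proof (cases "\<forall>q\<in>V. f q = 0")
    case True
    then have "\<forall>q\<in>V. g q = 0" using fg(1) by (metis sgn_0_0)
    then show ?thesis using True by simp
  next
    case False
    then obtain q where q: "q \<in> V" "f q > 0" using fg(2) by (metis less_eq_real_def)
    then have "g q > 0" using fg(1)[OF q(1)] by (simp add: sgn_if split: if_splits)
    have g0: "\<forall>q\<in>V. g q \<ge> 0"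
    proof
      fix q assume "q \<in> V"
      then have "f q \<ge> 0" "sgn (f q) = sgn (g q)" using fg by blast+
      then show "g q \<ge> 0" by (cases "g q < 0") (auto simp: sgn_if split: if_splits)
    qed
    have "(\<Sum>q\<in>V. u q * f q) > 0" "(\<Sum>q\<in>V. u q * g q) > 0"
      using q \<open>g q > 0\<close> g0 fg(2) assms(1,2)
      by (auto intro!: sum_pos2[of V q] intro: mult_nonneg_nonneg[OF less_imp_le])
    then show ?thesis by simp
  qed
  show ?thesis
  proof (cases "\<forall>q\<in>V. f q \<ge> 0")
    case True then show ?thesis using pos[of f g] assms(3) by blast
  next
    case False
    have "sgn (\<Sum>q\<in>V. u q * - f q) = sgn (\<Sum>q\<in>V. u q * - g q)"
      by (rule pos) (use False assms(3,4) in \<open>auto simp: sgn_minus\<close>)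
    then show ?thesis by (simp add: sum_negf sgn_minus)
  qed
qed

text \<open>Classes are sets of indices because points may coincide. The sign has three values, so a
  class touched by the hyperplane counts as crossed unless it lies on it entirely.\<close>

definition sign_constant :: "(nat \<Rightarrow> 'a::euclidean_space) \<Rightarrow> 'a \<times> real \<Rightarrow> nat set \<Rightarrow> bool" where
  "sign_constant x h S \<longleftrightarrow> (\<forall>i\<in>S. \<forall>j\<in>S. sgn (hval h (x i)) = sgn (hval h (x j)))"

lemma uncrossed_cell_sign_constant:
  assumes "finite U" "\<not> crosses q U" "x ` S \<subseteq> poshull U"
  shows "sign_constant x q S"
  unfolding sign_constant_def
proof (intro ballI)
  fix i j assume ij: "i \<in> S" "j \<in> S"
  have *: "x i \<in> poshull U" "x j \<in> poshull U" using ij assms(3) by auto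
  note s = poshull_sign[OF assms(1,2) *(1)] poshull_sign[OF assms(1,2) *(2)]
  consider "hval q (x i) > 0" | "hval q (x i) < 0" | "hval q (x j) > 0" | "hval q (x j) < 0"
    | "hval q (x i) = 0 \<and> hval q (x j) = 0" by linarith
  then show "sgn (hval q (x i)) = sgn (hval q (x j))"
  proof cases
    case 1
    then have "hval q (x j) > 0" using s(1) *(2) by blast
    then show ?thesis using 1 by simp
  next
    case 2
    then have "hval q (x j) < 0" using s(1) *(2) by blast
    then show ?thesis using 2 by simp
  next
    case 3
    then have "hval q (x i) > 0" using s(2) *(1) by blast
    then show ?thesis using 3 by simp
  next
    case 4
    then have "hval q (x i) < 0" using s(2) *(1) by blast
    then show ?thesis using 4 by simp
  qed simp
qed

text \<open>Up to scaling, h is a positive combination of the test functionals in V. On S each of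
  them has constant sign, and at \<open>x i0\<close> their values all have the same weak sign; both
  facts together fix the sign of h on S.\<close>

lemma sign_constant_from_test:
  assumes V: "finite V" and c: "c > 0" and h: "c *\<^sub>R h \<in> poshull V"
    and i0: "i0 \<in> S" "\<not> crosses (dual_functional (x i0)) V"
    and S: "\<And>q. q \<in> V \<Longrightarrow> sign_constant x q S"
  shows "sign_constant x h S"
proof -
  obtain u where u: "c *\<^sub>R h = (\<Sum>q\<in>V. u q *\<^sub>R q)" "\<forall>q\<in>V. u q > 0" "sum u V = 1"
    using h by (auto simp: poshull_def)
  have val: "c * hval h p = (\<Sum>q\<in>V. u q * hval q p)" for p
    using hval_sum[OF u(3), of "dual_functional p"] unfolding u(1)[symmetric]
    by (simp add: hval_dual_functional hval_scale)
  have one: "(\<forall>q\<in>V. hval q (x i0) \<ge> 0) \<or> (\<forall>q\<in>V. hval q (x i0) \<le> 0)"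
    using i0(2) unfolding crosses_def hval_dual_functional by (meson not_less)
  have "sgn (hval h (x i0)) = sgn (hval h (x i))" if i: "i \<in> S" for i
  proof -
    have "sgn (\<Sum>q\<in>V. u q * hval q (x i0)) = sgn (\<Sum>q\<in>V. u q * hval q (x i))"
    proof (rule sgn_weighted_sum[OF V _ _ one])
      fix q assume q: "q \<in> V"
      show "0 < u q" using u(2) q by blast
      show "sgn (hval q (x i0)) = sgn (hval q (x i))" using S[OF q] i i0(1) unfolding sign_constant_def by blast
    qed
    then show ?thesis unfolding val[symmetric] using c by (simp add: sgn_mult)
  qed
  then show ?thesis unfolding sign_constant_def by metis
qed

text \<open>Q collects the vertices of a cutting in the dual space. A functional h lies, after
  scaling, in one dual cell, and only few points have a dual hyperplane crossing that cell. The
  crude exponent d + 2 is the dual dimension plus \<eta> = 1; it is harmless because only the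
  logarithm of |Q| enters later.\<close>

theorem test_set:
  "\<exists>s0\<ge>1. \<forall>s\<ge>s0. \<forall>N (x :: nat \<Rightarrow> 'a::euclidean_space). finite N \<longrightarrow>
    (\<exists>Q. finite Q \<and> real (card Q) \<le> (real DIM('a) + 2) * s powr (real DIM('a) + 2) \<and>
      (\<forall>h. \<exists>V c. V \<subseteq> Q \<and> finite V \<and> card V \<le> DIM('a) + 2 \<and> c > 0 \<and> c *\<^sub>R h \<in> poshull V \<and>
         real (card {i\<in>N. crosses (dual_functional (x i)) V}) \<le> card N / s))"
proof -
  let ?d = "DIM('a)"
  obtain s0 where s0: "s0 \<ge> 1" "\<And>s (H :: (('a \<times> real) \<times> real) set) w \<rho>. s \<ge> s0 \<Longrightarrow> finite H \<Longrightarrow> \<forall>h. w h \<ge> 0 \<Longrightarrow> \<rho> > 0 \<Longrightarrow>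
     (\<exists>\<V>. finite \<V> \<and> real (card \<V>) \<le> s powr (DIM('a \<times> real) + 1) \<and>
       (\<forall>V\<in>\<V>. finite V \<and> card V \<le> DIM('a \<times> real) + 1 \<and> cross_weight H w V \<le> sum w H / s) \<and>
       (\<forall>x. norm x \<le> \<rho> \<longrightarrow> (\<exists>V\<in>\<V>. x \<in> poshull V)))"
    using cutting[where 'b = "'a \<times> real", of 1] by force
  have "\<exists>Q. finite Q \<and> real (card Q) \<le> (real ?d + 2) * s powr (real ?d + 2) \<and>
      (\<forall>h. \<exists>V c. V \<subseteq> Q \<and> finite V \<and> card V \<le> ?d + 2 \<and> c > 0 \<and> c *\<^sub>R h \<in> poshull V \<and>
         real (card {i\<in>N. crosses (dual_functional (x i)) V}) \<le> card N / s)"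
    if s: "s \<ge> s0" and N: "finite N" for s N and x :: "nat \<Rightarrow> 'a"
  proof -
    define f where "f = (\<lambda>i. dual_functional (x i))"
    define H where "H = f ` N"
    \<comment> \<open>Several indices may give the same functional, so multiplicities become
      weights.\<close>
    define w where "w h = real (card {i\<in>N. f i = h})" for h
    have fH: "finite H" using N by (simp add: H_def)
    have cw: "cross_weight H w V = real (card {i\<in>N. crosses (f i) V})" for V
    proof -
      have "real (card {i\<in>N. crosses (f i) V}) = (\<Sum>i | i \<in> N \<and> crosses (f i) V. 1)" by simp
      also have "\<dots> = (\<Sum>h | h \<in> H \<and> crosses h V. \<Sum>i | i \<in> {i \<in> N. crosses (f i) V} \<and> f i = h. 1)"
        by (rule sum.group[symmetric]) (use N fH in \<open>auto simp: H_def\<close>)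
      also have "\<dots> = cross_weight H w V"
        unfolding cross_weight_def w_def
        by (intro sum.cong refl) (auto intro!: arg_cong[where f = card])
      finally show ?thesis by simp
    qed
    have sw: "sum w H = card N"
      unfolding H_def w_def using sum.group[of N "f ` N" f "\<lambda>_. 1::real"] N by simp
    obtain \<V> where V: "finite \<V>" "real (card \<V>) \<le> s powr (DIM('a \<times> real) + 1)"
       "\<forall>V\<in>\<V>. finite V \<and> card V \<le> DIM('a \<times> real) + 1 \<and> cross_weight H w V \<le> sum w H / s"
       "\<forall>h. norm h \<le> 1 \<longrightarrow> (\<exists>V\<in>\<V>. h \<in> poshull V)"
      using s0(2)[OF s fH, of w 1] by (auto simp: w_def)
    define Q where "Q = \<Union>\<V>"
    have "card Q \<le> (\<Sum>V\<in>\<V>. card V)" unfolding Q_def by (rule card_Union_le_sum_card)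
    also have "\<dots> \<le> (\<Sum>V\<in>\<V>. ?d + 2)" using V(3) by (intro sum_mono) auto
    finally have "real (card Q) \<le> real ((?d + 2) * card \<V>)" by (simp only: of_nat_le_iff) (simp add: mult.commute)
    also have "\<dots> = (real ?d + 2) * real (card \<V>)" by (simp add: algebra_simps)
    also have "\<dots> \<le> (real ?d + 2) * s powr (real ?d + 2)" using V(2) by (intro mult_left_mono) (auto simp: add.commute)
    finally have cQ: "real (card Q) \<le> (real ?d + 2) * s powr (real ?d + 2)" .
    have "\<exists>V c. V \<subseteq> Q \<and> finite V \<and> card V \<le> ?d + 2 \<and> c > 0 \<and> c *\<^sub>R h \<in> poshull V \<and>
         real (card {i\<in>N. crosses (dual_functional (x i)) V}) \<le> card N / s" for h
    proof -
      \<comment> \<open>Moves h into the unit ball, the region that the dual cutting covers.\<close>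
      define c where "c = 1 / (1 + norm h)"
      have c0: "c > 0" by (simp add: c_def add_pos_nonneg)
      have pos: "1 + norm h > 0" by (simp add: add_pos_nonneg)
      have "norm (c *\<^sub>R h) = norm h / (1 + norm h)" using pos by (simp add: c_def)
      also have "\<dots> \<le> 1" using pos by (simp add: divide_le_eq)
      finally have "norm (c *\<^sub>R h) \<le> 1" .
      then obtain V' where "V' \<in> \<V>" "c *\<^sub>R h \<in> poshull V'" using V(4) by blast
      then show ?thesis using V(3) c0 cw sw unfolding Q_def f_def
        by (intro exI[of _ V'] exI[of _ c]) auto
    qed
    then show ?thesis using cQ V(1,3) by (intro exI[of _ Q]) (auto simp: Q_def)
  qed
  note claim = this
  show ?thesis by (intro exI[of _ s0] conjI allI impI s0(1)) (rule claim)
qed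

section \<open>Greedy partitions by reweighting\<close>

lemma sum_powr_bound:
  assumes "0 < \<alpha>" "\<alpha> \<le> 1/2"
  shows "(\<Sum>i<L. real (L - i) powr (-\<alpha>)) \<le> 2 * real L powr (1 - \<alpha>)"
proof -
  have "(\<Sum>i<L. real (L - i) powr (-\<alpha>)) = (\<Sum>i<L. real (Suc (L - Suc i)) powr (-\<alpha>))"
    by (intro sum.cong) (auto simp: Suc_diff_Suc)
  also have "\<dots> = (\<Sum>i<L. real (Suc i) powr (-\<alpha>))"
    by (rule sum.nat_diff_reindex[of "\<lambda>i. real (Suc i) powr (-\<alpha>)"])
  also have "\<dots> \<le> 2 * real L powr (1 - \<alpha>)"
  proof (induction L)
    case (Suc L)
    show ?case
    proof (cases "L = 0")
      case True then show ?thesis by simp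
    next
      case False
      define l where "l = real L"
      have l: "l \<ge> 1" using False by (simp add: l_def)
      \<comment> \<open>The assumption \<open>\<alpha> \<le> 1/2\<close> enters here; it lets the
        constant 2 replace 1 / (1 - \<open>\<alpha>\<close>).\<close>
      have "(1 + 1/l) powr \<alpha> \<le> (1 + 1/l) powr (1/2)" using l assms by (intro powr_mono) auto
      also have "\<dots> = sqrt (1 + 1/l)" using l by (simp add: powr_half_sqrt)
      also have "\<dots> \<le> 1 + 1 / (2 * l)"
        by (rule real_le_lsqrt) (use l in \<open>auto simp: power2_eq_square field_simps\<close>)
      finally have a: "(1 + 1/l) powr \<alpha> \<le> 1 + 1 / (2 * l)" .
      have "(l + 1) powr \<alpha> = l powr \<alpha> * (1 + 1/l) powr \<alpha>"
      proof -
        have "l + 1 = l * (1 + 1/l)" using l by (simp add: distrib_left)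
        then show ?thesis using l by (simp only: powr_mult)
      qed
      also have "\<dots> \<le> l powr \<alpha> * (1 + 1 / (2 * l))" using a by (intro mult_left_mono) auto
      finally have b: "(l + 1) powr \<alpha> * l \<le> l powr \<alpha> * (l + 1/2)"
        using l by (simp add: field_simps)
      have "2 * l powr (1 - \<alpha>) + (l + 1) powr (-\<alpha>) \<le> 2 * (l + 1) powr (1 - \<alpha>)"
      proof -
        have "l / l powr \<alpha> \<le> (l + 1/2) / (l + 1) powr \<alpha>"
          using b l by (simp add: divide_simps mult.commute)
        moreover have "2 * l powr (1 - \<alpha>) = 2 * (l / l powr \<alpha>)" "(l + 1) powr (-\<alpha>) = 1 / (l + 1) powr \<alpha>"
          "2 * (l + 1) powr (1 - \<alpha>) = 2 * ((l + 1/2) / (l + 1) powr \<alpha>) + 1 / (l + 1) powr \<alpha>"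
          using l by (simp_all add: powr_diff powr_minus_divide add_divide_distrib)
        ultimately show ?thesis by linarith
      qed
      then show ?thesis using Suc by (simp add: l_def algebra_simps)
    qed
  qed simp
  finally show ?thesis .
qed

lemma split_small_sets:
  assumes "finite A" "card A \<le> m * k" "k \<ge> 1"
  shows "\<exists>\<P>. finite \<P> \<and> \<Union>\<P> = A \<and> card \<P> \<le> m \<and> (\<forall>P\<in>\<P>. P \<noteq> {} \<and> card P \<le> k)"
  using assms(1,2)
proof (induction m arbitrary: A)
  case 0
  then show ?case by (intro exI[of _ "{}"]) auto
next
  case (Suc m)
  show ?case
  proof (cases "card A \<le> k")
    case True
    show ?thesis
      by (rule exI[of _ "if A = {} then {} else {A}"]) (use True Suc.prems(1) in simp)
  next
    case False
    then obtain P where P: "P \<subseteq> A" "card P = k" "finite P"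
      using obtain_subset_with_card_n[of k A] by auto
    have "card (A - P) \<le> m * k" using Suc.prems P by (simp add: card_Diff_subset)
    then obtain \<P> where \<P>: "finite \<P>" "\<Union>\<P> = A - P" "card \<P> \<le> m" "\<forall>P\<in>\<P>. P \<noteq> {} \<and> card P \<le> k"
      using Suc.IH[of "A - P"] Suc.prems(1) by auto
    have "card (insert P \<P>) \<le> Suc m" using \<P>(1,3) by (simp add: card_insert_if)
    moreover have "P \<noteq> {}" using P(2) assms(3) by auto
    ultimately show ?thesis using \<P> P by (intro exI[of _ "insert P \<P>"]) auto
  qed
qed

text \<open>Multiplicative weights: a test functional doubles its weight whenever it crosses a
  chosen cell, and each new class is taken from a cell of small crossing weight. The total weight
  then grows slowly, which bounds the number of doublings for each functional. The
  \<open>room\<close> assumption keeps enough points for a cutting with parameter at least s0 in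
  every round.\<close>

lemma greedy_classes:
  fixes x :: "nat \<Rightarrow> 'a::euclidean_space" and Q :: "('a \<times> real) set"
  assumes cut: "\<forall>s w \<rho>. s \<ge> s0 \<and> (\<forall>h. w h \<ge> 0) \<and> \<rho> > 0 \<longrightarrow>
     (\<exists>\<V>. finite \<V> \<and> real (card \<V>) \<le> s powr E \<and>
       (\<forall>V\<in>\<V>. finite V \<and> card V \<le> DIM('a) + 1 \<and> cross_weight Q w V \<le> sum w Q / s) \<and>
       (\<forall>x. norm x \<le> \<rho> \<longrightarrow> (\<exists>V\<in>\<V>. x \<in> poshull V)))"
    and s0: "s0 \<ge> 1" and E: "E > 0" and N: "finite N" and Q: "finite Q" and k: "k \<ge> 1"
    and room: "(real L + s0 powr E) * real k \<le> real (card N)"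
  shows "j \<le> L \<Longrightarrow> \<exists>\<T> U. finite \<T> \<and> card \<T> = j \<and> disjoint \<T> \<and>
     (\<forall>S\<in>\<T>. S \<subseteq> N \<and> card S = k \<and> finite (U S) \<and> x ` S \<subseteq> poshull (U S)) \<and>
     (\<Sum>h\<in>Q. 2 ^ card {S\<in>\<T>. crosses h (U S)}) \<le> real (card Q) * exp (\<Sum>i<j. real (L - i) powr (-1/E))"
proof (induction j)
  case 0
  then show ?case by (intro exI[of _ "{}"]) (auto simp: disjoint_def)
next
  case (Suc j)
  then have "j \<le> L" by simp
  from Suc.IH[OF this] obtain \<T> U where T: "finite \<T>" "card \<T> = j" "disjoint \<T>"
     "\<forall>S\<in>\<T>. S \<subseteq> N \<and> card S = k \<and> finite (U S) \<and> x ` S \<subseteq> poshull (U S)"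
     "(\<Sum>h\<in>Q. 2 ^ card {S\<in>\<T>. crosses h (U S)}) \<le> real (card Q) * exp (\<Sum>i<j. real (L - i) powr (-1/E))" by (elim exE conjE)
  define N' where "N' = N - \<Union>\<T>"
  have finS: "finite S" if "S \<in> \<T>" for S
    using bspec[OF T(4) that] N by (meson finite_subset)
  have "card (\<Union>\<T>) = (\<Sum>S\<in>\<T>. card S)"
    using T(3) finS by (intro card_Union_disjoint) auto
  also have "\<dots> = j * k" using T(2,4) by simp
  finally have cU: "card (\<Union>\<T>) = j * k" .
  have subN: "\<Union>\<T> \<subseteq> N" by (rule Union_least) (use T(4) in simp)
  have cN': "card N' = card N - j * k" "j * k \<le> card N" unfolding N'_def
    using subN N cU card_mono[OF N subN] by (auto simp: card_Diff_subset finite_subset)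
  define M where "M = real (card N') / real k"
  have Lj: "real (L - j) + s0 powr E \<le> M"
  proof -
    have "real (card N') = real (card N) - real j * real k" using cN' by (simp add: of_nat_diff)
    moreover have "real (L - j) = real L - real j" using Suc.prems by (simp add: of_nat_diff)
    ultimately show ?thesis using room k unfolding M_def by (simp add: field_simps)
  qed
  have Ljpos: "real (L - j) \<ge> 1" using Suc.prems by simp
  have M0: "M > 0" "M \<ge> s0 powr E" "M \<ge> real (L - j)" using Lj Ljpos powr_ge_zero[of s0 E] by linarith+
  \<comment> \<open>The largest parameter for which the cutting has at most M = |N'| / k cells, so
    that by pigeonhole some cell contains k of the remaining points.\<close>
  define s where "s = M powr (1/E)"
  have sE: "s powr E = M" using M0(1) E by (simp add: s_def powr_powr)
  have "s \<ge> (s0 powr E) powr (1/E)" unfolding s_def using M0(2) E by (intro powr_mono2) auto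
  then have ss0: "s \<ge> s0" using E s0 by (simp add: powr_powr)
  then have s1: "s \<ge> 1" using s0 by simp
  define w where "w h = (2::real) ^ card {S\<in>\<T>. crosses h (U S)}" for h
  define \<rho> where "\<rho> = 1 + (\<Sum>i\<in>N. norm (x i))"
  have \<rho>: "\<rho> > 0" unfolding \<rho>_def by (intro add_pos_nonneg sum_nonneg) auto
  have x\<rho>: "norm (x i) \<le> \<rho>" if "i \<in> N" for i
    using member_le_sum[OF that, of "\<lambda>i. norm (x i)"] N by (simp add: \<rho>_def)
  obtain \<V> where V: "finite \<V>" "real (card \<V>) \<le> M"
       "\<forall>V\<in>\<V>. finite V \<and> card V \<le> DIM('a) + 1 \<and> cross_weight Q w V \<le> sum w Q / s"
       "\<forall>x. norm x \<le> \<rho> \<longrightarrow> (\<exists>V\<in>\<V>. x \<in> poshull V)"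
    using cut[rule_format, of s w \<rho>] ss0 \<rho> sE by (auto simp: w_def)
  have fN': "finite N'" using N by (simp add: N'_def)
  have "\<exists>V\<in>\<V>. card {i\<in>N'. x i \<in> poshull V} \<ge> k"
  proof (rule ccontr)
    assume "\<not> ?thesis"
    then have less: "card {i\<in>N'. x i \<in> poshull V} \<le> k - 1" if "V \<in> \<V>" for V using that k by force
    have "N' \<subseteq> (\<Union>V\<in>\<V>. {i\<in>N'. x i \<in> poshull V})" using V(4) x\<rho> by (auto simp: N'_def)
    then have "card N' \<le> card (\<Union>V\<in>\<V>. {i\<in>N'. x i \<in> poshull V})" using V(1) fN' by (intro card_mono) auto
    also have "\<dots> \<le> (\<Sum>V\<in>\<V>. card {i\<in>N'. x i \<in> poshull V})" by (rule card_UN_le[OF V(1)])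
    also have "\<dots> \<le> (\<Sum>V\<in>\<V>. k - 1)" by (intro sum_mono less)
    finally have "real (card N') \<le> real (card \<V> * (k - 1))" by (simp only: of_nat_le_iff) simp
    also have "\<dots> \<le> M * real (k - 1)" using V(2) by (simp add: mult_right_mono)
    also have "\<dots> < M * real k" using M0(1) k by (intro mult_strict_left_mono) auto
    also have "\<dots> = real (card N')" using k by (simp add: M_def)
    finally show False by simp
  qed
  then obtain V where VV: "V \<in> \<V>" "card {i\<in>N'. x i \<in> poshull V} \<ge> k" by blast
  then obtain S where S: "S \<subseteq> {i\<in>N'. x i \<in> poshull V}" "card S = k"
    using obtain_subset_with_card_n by blast
  have Sne: "S \<noteq> {}" using S(2) k by auto
  have SN: "S \<subseteq> N'" using S(1) by auto
  have disjS: "S \<inter> S' = {}" if "S' \<in> \<T>" for S' using SN that by (auto simp: N'_def)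
  have ST: "S \<notin> \<T>" using disjS Sne by blast
  define \<T>' where "\<T>' = insert S \<T>"
  define U' where "U' = U(S := V)"
  have U'eq: "U' S' = U S'" if "S' \<in> \<T>" for S' using that ST by (auto simp: U'_def)
  have cnt: "card {S'\<in>\<T>'. crosses h (U' S')} = card {S'\<in>\<T>. crosses h (U S')} + (if crosses h V then 1 else 0)" for h
  proof -
    have "{S'\<in>\<T>'. crosses h (U' S')} = {S'\<in>\<T>. crosses h (U S')} \<union> (if crosses h V then {S} else {})"
      using U'eq ST by (auto simp: \<T>'_def U'_def)
    then show ?thesis using ST T(1) by (simp add: card_insert_if)
  qed
  have "(\<Sum>h\<in>Q. 2 ^ card {S'\<in>\<T>'. crosses h (U' S')}) = (\<Sum>h\<in>Q. w h + (if crosses h V then w h else 0))"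
    unfolding cnt w_def by (intro sum.cong refl) (simp add: power_add)
  also have "\<dots> = sum w Q + cross_weight Q w V"
    unfolding sum.distrib cross_weight_def using Q by (simp add: sum.inter_filter)
  also have "\<dots> \<le> sum w Q + sum w Q / s" using V(3) VV(1) by auto
  also have "\<dots> = sum w Q * (1 + 1/s)" by (simp add: algebra_simps)
  also have "\<dots> \<le> (real (card Q) * exp (\<Sum>i<j. real (L - i) powr (-1/E))) * exp (real (L - j) powr (-1/E))"
  proof (rule mult_mono)
    show "sum w Q \<le> real (card Q) * exp (\<Sum>i<j. real (L - i) powr (-1/E))" using T(5) by (simp add: w_def)
    have "1 / s = M powr (-1/E)" by (simp add: s_def powr_minus_divide)
    also have "\<dots> \<le> real (L - j) powr (-1/E)" using M0(3) Ljpos E by (intro powr_mono2') auto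
    finally show "1 + 1 / s \<le> exp (real (L - j) powr (-1/E))"
      using exp_ge_add_one_self[of "real (L - j) powr (-1/E)"] by linarith
  qed (use s1 in auto)
  also have "\<dots> = real (card Q) * exp (\<Sum>i<Suc j. real (L - i) powr (-1/E))" by (simp add: exp_add)
  finally have main: "(\<Sum>h\<in>Q. 2 ^ card {S'\<in>\<T>'. crosses h (U' S')}) \<le> real (card Q) * exp (\<Sum>i<Suc j. real (L - i) powr (-1/E))" .
  have "disjoint \<T>'" using T(3) disjS unfolding \<T>'_def disjoint_def by (metis Int_commute insert_iff)
  moreover have "\<forall>S'\<in>\<T>'. S' \<subseteq> N \<and> card S' = k \<and> finite (U' S') \<and> x ` S' \<subseteq> poshull (U' S')"
  proof
    fix S' assume "S' \<in> \<T>'"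
    then consider "S' \<in> \<T>" | "S' = S" by (auto simp: \<T>'_def)
    then show "S' \<subseteq> N \<and> card S' = k \<and> finite (U' S') \<and> x ` S' \<subseteq> poshull (U' S')"
    proof cases
      case 1 then show ?thesis using T(4) U'eq by simp
    next
      case 2 then show ?thesis using S VV(1) V(3) by (auto simp: U'_def N'_def)
    qed
  qed
  moreover have "finite \<T>'" "card \<T>' = Suc j" using T(1,2) ST by (auto simp: \<T>'_def)
  ultimately show ?case using main by (intro exI[of _ \<T>'] exI[of _ U']) blast
qed

text \<open>Controlling the crossings of the test functionals is enough: by
  \<open>sign_constant_from_test\<close>, another functional h splits a class only if a test
  functional crosses its cell or the whole class lies in the zone where h is poorly
  approximated.\<close>

theorem low_crossing_partition:
  fixes \<eta> :: real
  assumes \<eta>: "\<eta> > 0" and d2: "DIM('a::euclidean_space) \<ge> 2"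
  shows "\<exists>C>0. \<exists>r0. \<forall>r\<ge>r0. \<forall>N (x :: nat \<Rightarrow> 'a). finite N \<and> r \<le> card N \<longrightarrow>
    (\<exists>\<S>. finite \<S> \<and> \<Union>\<S> = N \<and> card \<S> \<le> 3 * r \<and> (\<forall>S\<in>\<S>. S \<noteq> {} \<and> r * card S \<le> card N) \<and>
      (\<forall>h. real (card {S\<in>\<S>. \<not> sign_constant x h S}) \<le> C * real r powr (1 - 1 / (real DIM('a) + \<eta>))))"
proof -
  let ?d = "DIM('a)"
  define E where "E = real ?d + \<eta>"
  define \<alpha> where "\<alpha> = 1 / E"
  have E: "E > 0" "E \<ge> 2" using \<eta> d2 by (auto simp: E_def)
  have \<alpha>: "\<alpha> > 0" "\<alpha> \<le> 1/2" using E by (auto simp: \<alpha>_def field_simps)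
  obtain s0 where s0: "s0 \<ge> 1" and cut: "\<forall>s\<ge>s0. \<forall>(H :: ('a \<times> real) set) w \<rho>. finite H \<and> (\<forall>h. w h \<ge> 0) \<and> \<rho> > 0 \<longrightarrow>
     (\<exists>\<V>. finite \<V> \<and> real (card \<V>) \<le> s powr E \<and>
       (\<forall>V\<in>\<V>. finite V \<and> card V \<le> ?d + 1 \<and> cross_weight H w V \<le> sum w H / s) \<and>
       (\<forall>x. norm x \<le> \<rho> \<longrightarrow> (\<exists>V\<in>\<V>. x \<in> poshull V)))"
    using cutting[where 'b = 'a, OF \<eta>] unfolding E_def[symmetric] by (elim exE conjE)
  obtain s1 where s1: "s1 \<ge> 1" and test: "\<forall>s\<ge>s1. \<forall>N (x :: nat \<Rightarrow> 'a). finite N \<longrightarrow>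
    (\<exists>Q. finite Q \<and> real (card Q) \<le> (real ?d + 2) * s powr (real ?d + 2) \<and>
      (\<forall>h. \<exists>V c. V \<subseteq> Q \<and> finite V \<and> card V \<le> ?d + 2 \<and> c > 0 \<and> c *\<^sub>R h \<in> poshull V \<and>
         real (card {i\<in>N. crosses (dual_functional (x i)) V}) \<le> card N / s))"
    using test_set[where 'a = 'a] by (elim exE conjE)
  define K0 where "K0 = nat \<lceil>s0 powr E\<rceil>"
  define C where "C = (real ?d + 2) * 10 + 3"
  have K0: "s0 powr E \<le> real K0" unfolding K0_def by (rule real_nat_ceiling_ge)
  have "\<forall>\<^sub>F r::nat in at_top. real r powr \<alpha> \<ge> s1 \<and> real K0 + 1 \<le> real r powr (1 - \<alpha>) \<and>
     2 * ln ((real ?d + 2) * (real r powr \<alpha>) powr (real ?d + 2)) \<le> 2 * real r powr (1 - \<alpha>) \<and> r \<ge> K0 \<and> r \<ge> 1"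
  proof (intro eventually_conj)
    show "\<forall>\<^sub>F r::nat in at_top. real r powr \<alpha> \<ge> s1" using \<alpha> by real_asymp
    show "\<forall>\<^sub>F r::nat in at_top. real K0 + 1 \<le> real r powr (1 - \<alpha>)" using \<alpha> by real_asymp
    show "\<forall>\<^sub>F r::nat in at_top. 2 * ln ((real ?d + 2) * (real r powr \<alpha>) powr (real ?d + 2)) \<le> 2 * real r powr (1 - \<alpha>)"
    proof -
      define D where "D = real ?d + 2"
      have "D > 0" by (simp add: D_def)
      then have "\<forall>\<^sub>F r::nat in at_top. 2 * ln (D * (real r powr \<alpha>) powr D) \<le> 2 * real r powr (1 - \<alpha>)"
        using \<alpha> by real_asymp
      then show ?thesis by (simp add: D_def)
    qed
    show "\<forall>\<^sub>F r::nat in at_top. r \<ge> K0" by (rule eventually_ge_at_top)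
    show "\<forall>\<^sub>F r::nat in at_top. r \<ge> 1" by (rule eventually_ge_at_top)
  qed
  then obtain r0 where r0: "\<And>r. r \<ge> r0 \<Longrightarrow> real r powr \<alpha> \<ge> s1 \<and> real K0 + 1 \<le> real r powr (1 - \<alpha>) \<and>
     2 * ln ((real ?d + 2) * (real r powr \<alpha>) powr (real ?d + 2)) \<le> 2 * real r powr (1 - \<alpha>) \<and> r \<ge> K0 \<and> r \<ge> 1"
    unfolding eventually_at_top_linorder by blast
  have main: "\<exists>\<S>. finite \<S> \<and> \<Union>\<S> = N \<and> card \<S> \<le> 3 * r \<and> (\<forall>S\<in>\<S>. S \<noteq> {} \<and> r * card S \<le> card N) \<and>
      (\<forall>h. real (card {S\<in>\<S>. \<not> sign_constant x h S}) \<le> C * real r powr (1 - \<alpha>))"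
    if r: "r \<ge> r0" and N: "finite N" and n: "r \<le> card N" for r N and x :: "nat \<Rightarrow> 'a"
  proof -
    note R = r0[OF r]
    have r1: "r \<ge> 1" using R by simp
    define n where "n = card N"
    define k where "k = n div r"
    have k1: "k \<ge> 1" using n r1 by (simp add: k_def n_def div_greater_zero_iff Suc_leI)
    have kr: "k * r \<le> n" by (simp add: k_def)
    have nk: "n < 2 * k * r"
    proof -
      have "n < (k + 1) * r" using r1 dividend_less_times_div[of r n] by (simp add: k_def algebra_simps)
      also have "\<dots> \<le> 2 * k * r" using k1 by (intro mult_right_mono) auto
      finally show ?thesis .
    qed
    \<comment> \<open>The number of classes of size k that fit into N; it lies between r and 2
      r.\<close>
    define T0 where "T0 = n div k"
    have T0: "r \<le> T0" "T0 < 2 * r" "T0 * k \<le> n" "n < (T0 + 1) * k"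
      using kr nk k1 dividend_less_times_div[of k n] unfolding T0_def
      by (auto simp: less_eq_div_iff_mult_less_eq div_less_iff_less_mult mult_ac)
    \<comment> \<open>The greedy choice stops K0 classes early, since a cutting needs s \<ge> s0;
      the leftover points form at most K0 + 1 further classes without any structure.\<close>
    define L where "L = T0 - K0"
    have L: "L + K0 = T0" using T0(1) R by (simp add: L_def)
    obtain Q where Q: "finite Q" "real (card Q) \<le> (real ?d + 2) * (real r powr \<alpha>) powr (real ?d + 2)"
      "\<forall>h. \<exists>V c. V \<subseteq> Q \<and> finite V \<and> card V \<le> ?d + 2 \<and> c > 0 \<and> c *\<^sub>R h \<in> poshull V \<and>
         real (card {i\<in>N. crosses (dual_functional (x i)) V}) \<le> card N / (real r powr \<alpha>)"
      using test[rule_format, OF conjunct1[OF R] N, of x] by (elim exE conjE)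
    have room: "(real L + s0 powr E) * real k \<le> real (card N)"
    proof -
      have "(real L + s0 powr E) * real k \<le> real T0 * real k"
        using K0 L by (intro mult_right_mono) auto
      also have "\<dots> = real (T0 * k)" by simp
      also have "\<dots> \<le> real n" using T0(3) by (simp only: of_nat_le_iff)
      finally show ?thesis by (simp add: n_def)
    qed
    have cut': "\<forall>s w \<rho>. s \<ge> s0 \<and> (\<forall>h. w h \<ge> 0) \<and> \<rho> > 0 \<longrightarrow> (\<exists>\<V>. finite \<V> \<and> real (card \<V>) \<le> s powr E \<and>
       (\<forall>V\<in>\<V>. finite V \<and> card V \<le> ?d + 1 \<and> cross_weight Q w V \<le> sum w Q / s) \<and>
       (\<forall>x. norm x \<le> \<rho> \<longrightarrow> (\<exists>V\<in>\<V>. x \<in> poshull V)))"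
      by (intro allI impI, elim conjE, rule cut[rule_format]) (intro conjI Q(1) | assumption)+
    obtain \<T> U where T: "finite \<T>" "card \<T> = L" "disjoint \<T>"
     "\<forall>S\<in>\<T>. S \<subseteq> N \<and> card S = k \<and> finite (U S) \<and> x ` S \<subseteq> poshull (U S)"
     "(\<Sum>h\<in>Q. 2 ^ card {S\<in>\<T>. crosses h (U S)}) \<le> real (card Q) * exp (\<Sum>i<L. real (L - i) powr (-1/E))"
      using greedy_classes[OF cut' s0 E(1) N Q(1) k1 room order_refl, of x] by (elim exE conjE)
    have finS: "finite S" if "S \<in> \<T>" for S using bspec[OF T(4) that] N by (meson finite_subset)
    have "card (\<Union>\<T>) = (\<Sum>S\<in>\<T>. card S)" using T(3) finS by (intro card_Union_disjoint) auto
    also have "\<dots> = L * k" using T(2,4) by simp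
    finally have cU: "card (\<Union>\<T>) = L * k" .
    have subN: "\<Union>\<T> \<subseteq> N" by (rule Union_least) (use T(4) in simp)
    have "card (N - \<Union>\<T>) = n - L * k"
      using subN N cU by (simp add: card_Diff_subset finite_subset n_def)
    also have "\<dots> \<le> (K0 + 1) * k"
    proof -
      have "n \<le> (L + K0 + 1) * k" using T0(4) L by simp
      then show ?thesis by (simp add: algebra_simps)
    qed
    finally obtain \<P> where P: "finite \<P>" "\<Union>\<P> = N - \<Union>\<T>" "card \<P> \<le> K0 + 1" "\<forall>P\<in>\<P>. P \<noteq> {} \<and> card P \<le> k"
      using split_small_sets[of "N - \<Union>\<T>" "K0 + 1" k] N k1 by auto
    define \<S> where "\<S> = \<T> \<union> \<P>"
    have "card \<S> \<le> L + (K0 + 1)" unfolding \<S>_def using card_Un_le[of \<T> \<P>] T(2) P(3) by linarith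
    then have cS: "card \<S> \<le> 3 * r" using L T0(2) r1 by linarith
    have sizes: "S \<noteq> {} \<and> r * card S \<le> card N" if "S \<in> \<S>" for S
    proof -
      have S: "card S \<le> k \<and> S \<noteq> {}"
      proof (cases "S \<in> \<T>")
        case True
        then have "card S = k" using T(4) by simp
        then show ?thesis using k1 by auto
      next
        case False
        then show ?thesis using that P(4) by (simp add: \<S>_def)
      qed
      then have "r * card S \<le> r * k" by (intro mult_le_mono2) simp
      also have "\<dots> \<le> card N" using kr by (simp add: n_def mult.commute)
      finally show ?thesis using S by simp
    qed
    \<comment> \<open>The constant 10: half the count is at most ln |Q| plus the sum of the growth
      rates, that is at most r^(1-\<alpha>) + 4 r^(1-\<alpha>).\<close>
    have kappa: "real (card {S\<in>\<T>. crosses q (U S)}) \<le> 10 * real r powr (1 - \<alpha>)" if q: "q \<in> Q" for q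
    proof -
      define \<kappa> where "\<kappa> = card {S\<in>\<T>. crosses q (U S)}"
      have cQ: "real (card Q) > 0" using q Q(1) card_gt_0_iff[of Q] by simp blast
      have "(2::real) ^ \<kappa> \<le> (\<Sum>h\<in>Q. 2 ^ card {S\<in>\<T>. crosses h (U S)})"
        unfolding \<kappa>_def by (rule member_le_sum[OF q]) (use Q(1) in auto)
      also have "\<dots> \<le> real (card Q) * exp (\<Sum>i<L. real (L - i) powr (-\<alpha>))" using T(5) by (simp add: \<alpha>_def)
      finally have "ln ((2::real) ^ \<kappa>) \<le> ln (real (card Q) * exp (\<Sum>i<L. real (L - i) powr (-\<alpha>)))"
        using cQ by (subst ln_le_cancel_iff) auto
      then have "real \<kappa> * ln 2 \<le> ln (real (card Q)) + (\<Sum>i<L. real (L - i) powr (-\<alpha>))"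
        using cQ by (simp add: ln_mult ln_realpow)
      moreover have "real \<kappa> * (1/2) \<le> real \<kappa> * ln 2" using ln2_ge_two_thirds by (intro mult_left_mono) auto
      moreover have "ln (real (card Q)) \<le> ln ((real ?d + 2) * (real r powr \<alpha>) powr (real ?d + 2))"
        using order_less_le_trans[OF cQ Q(2)] Q(2) cQ by (subst ln_le_cancel_iff) assumption+
      moreover have "(\<Sum>i<L. real (L - i) powr (-\<alpha>)) \<le> 4 * real r powr (1 - \<alpha>)"
      proof -
        have "(\<Sum>i<L. real (L - i) powr (-\<alpha>)) \<le> 2 * real L powr (1 - \<alpha>)" by (rule sum_powr_bound[OF \<alpha>])
        also have "real L powr (1 - \<alpha>) \<le> (2 * real r) powr (1 - \<alpha>)"
          using L T0(2) \<alpha> by (intro powr_mono2) auto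
        also have "(2 * real r) powr (1 - \<alpha>) = 2 powr (1 - \<alpha>) * real r powr (1 - \<alpha>)" by (simp add: powr_mult)
        also have "\<dots> \<le> 2 * real r powr (1 - \<alpha>)"
          using powr_mono[of "1 - \<alpha>" 1 2] \<alpha> by (intro mult_right_mono) auto
        finally show ?thesis by simp
      qed
      ultimately show ?thesis using R unfolding \<kappa>_def by linarith
    qed
    have crossing: "real (card {S\<in>\<S>. \<not> sign_constant x h S}) \<le> C * real r powr (1 - \<alpha>)" for h
    proof -
      obtain V c where V: "V \<subseteq> Q" "finite V" "card V \<le> ?d + 2" "c > 0" "c *\<^sub>R h \<in> poshull V"
         "real (card {i\<in>N. crosses (dual_functional (x i)) V}) \<le> card N / (real r powr \<alpha>)"
        using spec[OF Q(3), of h] by (elim exE conjE)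
      \<comment> \<open>A split class lies in A (a test functional crosses its cell), in B (all its
        points lie in the zone Z of h), or among the leftovers. They contribute 10 (d + 2), 2 and 1
        to the constant C.\<close>
      define Z where "Z = {i\<in>N. crosses (dual_functional (x i)) V}"
      define A where "A = (\<Union>q\<in>V. {S\<in>\<T>. crosses q (U S)})"
      define B where "B = {S\<in>\<T>. S \<subseteq> Z}"
      have "S \<in> A \<or> S \<in> B" if S: "S \<in> \<T>" "\<not> sign_constant x h S" for S
      proof (rule ccontr)
        assume no: "\<not> (S \<in> A \<or> S \<in> B)"
        then obtain i0 where i0: "i0 \<in> S" "i0 \<notin> Z" using S(1) by (auto simp: B_def)
        have S': "S \<subseteq> N" "finite (U S)" "x ` S \<subseteq> poshull (U S)" using bspec[OF T(4) S(1)] by simp_all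
        have nc: "\<not> crosses (dual_functional (x i0)) V" using i0 S'(1) by (auto simp: Z_def)
        have "sign_constant x q S" if "q \<in> V" for q
        proof (rule uncrossed_cell_sign_constant[OF S'(2) _ S'(3)])
          show "\<not> crosses q (U S)" using no S(1) that by (simp add: A_def)
        qed
        then have "sign_constant x h S" by (rule sign_constant_from_test[where x = x, OF V(2,4,5) i0(1) nc])
        then show False using S(2) by simp
      qed
      then have sub: "{S\<in>\<S>. \<not> sign_constant x h S} \<subseteq> A \<union> B \<union> \<P>" unfolding \<S>_def by blast
      have fin: "finite A" "finite B" using T(1) V(2) by (auto simp: A_def B_def)
      have "card {S\<in>\<S>. \<not> sign_constant x h S} \<le> card (A \<union> B \<union> \<P>)" using sub fin P(1) by (intro card_mono) auto
      also have "\<dots> \<le> card A + card B + card \<P>" using card_Un_le[of "A \<union> B" \<P>] card_Un_le[of A B] by linarith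
      finally have c1: "real (card {S\<in>\<S>. \<not> sign_constant x h S}) \<le> real (card A) + real (card B) + real (card \<P>)"
        by (simp only: of_nat_add[symmetric] of_nat_le_iff)
      have "real (card A) \<le> real (\<Sum>q\<in>V. card {S\<in>\<T>. crosses q (U S)})"
        unfolding A_def of_nat_le_iff by (rule card_UN_le[OF V(2)])
      also have "\<dots> \<le> (\<Sum>q\<in>V. 10 * real r powr (1 - \<alpha>))"
        unfolding of_nat_sum using kappa V(1) by (intro sum_mono) blast
      also have "\<dots> = real (card V) * (10 * real r powr (1 - \<alpha>))" by simp
      also have "\<dots> \<le> (real ?d + 2) * (10 * real r powr (1 - \<alpha>))" using V(3) by (intro mult_right_mono) auto
      finally have c2: "real (card A) \<le> (real ?d + 2) * (10 * real r powr (1 - \<alpha>))" .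
      have c3: "real (card B) \<le> 2 * real r powr (1 - \<alpha>)"
      proof -
        have "card (\<Union>B) = (\<Sum>S\<in>B. card S)"
          using T(3) finS by (intro card_Union_disjoint) (auto simp: B_def disjoint_def pairwise_def disjnt_def)
        also have "\<dots> = card B * k" using T(4) by (simp add: B_def)
        finally have "real (card B) * real k = real (card (\<Union>B))" by simp
        also have "\<dots> \<le> real (card Z)" using N by (intro of_nat_mono card_mono) (auto simp: B_def Z_def)
        also have "\<dots> \<le> real n / (real r powr \<alpha>)" using V(6) by (simp add: Z_def n_def)
        also have "\<dots> \<le> real (2 * k * r) / (real r powr \<alpha>)" using nk by (intro divide_right_mono of_nat_mono) auto
        also have "\<dots> = 2 * real r powr (1 - \<alpha>) * real k" using r1 by (simp add: powr_diff)
        finally show ?thesis using k1 by simp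
      qed
      have "real (card \<P>) \<le> real r powr (1 - \<alpha>)" using P(3) R by linarith
      then have "real (card {S\<in>\<S>. \<not> sign_constant x h S}) \<le> (real ?d + 2) * (10 * real r powr (1 - \<alpha>)) + 2 * real r powr (1 - \<alpha>) + real r powr (1 - \<alpha>)"
        using c1 c2 c3 by linarith
      also have "\<dots> = C * real r powr (1 - \<alpha>)" by (simp add: C_def algebra_simps)
      finally show ?thesis .
    qed
    have "\<Union>\<S> = N" using P(2) subN unfolding \<S>_def by blast
    then show ?thesis using cS sizes crossing T(1) P(1) by (intro exI[of _ \<S>] conjI) (simp_all add: \<S>_def)
  qed
  show ?thesis
  proof (intro exI[of _ C] exI[of _ r0] conjI allI impI)
    show "C > 0" by (simp add: C_def)
  qed (elim conjE, rule main[unfolded \<alpha>_def E_def])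
qed

section \<open>Weak nets\<close>

lemma Helly_finite:
  fixes \<F> :: "'a::euclidean_space set set"
  assumes "finite \<F>" "\<And>A. A \<in> \<F> \<Longrightarrow> convex A"
    and "\<And>\<G>. \<G> \<subseteq> \<F> \<Longrightarrow> card \<G> \<le> DIM('a) + 1 \<Longrightarrow> \<Inter>\<G> \<noteq> {}"
  shows "\<Inter>\<F> \<noteq> {}"
proof (cases "card \<F> \<ge> DIM('a) + 1")
  case True
  show ?thesis
  proof (rule Helly[OF True])
    show "\<forall>s\<in>\<F>. convex s" using assms(2) by blast
    show "\<Inter>t \<noteq> {}" if "t \<subseteq> \<F>" "card t = DIM('a) + 1" for t using assms(3)[OF that(1)] that(2) by simp
  qed
next
  case False
  then show ?thesis using assms(3)[of \<F>] by simp
qed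

text \<open>Helly's theorem for the hulls of all subfamilies with more than d/(d+1) of the indices:
  any d + 1 of these share an index. Counting indices instead of points allows repeated
  points.\<close>

lemma centerpoint:
  fixes c :: "'i \<Rightarrow> 'a::euclidean_space"
  assumes I: "finite I" "I \<noteq> {}"
  obtains z where "\<And>h. hval h z \<le> 0 \<Longrightarrow> card I \<le> (DIM('a) + 1) * card {i\<in>I. hval h (c i) \<le> 0}"
proof -
  let ?d = "DIM('a)"
  define \<J> where "\<J> = {J. J \<subseteq> I \<and> ?d * card I < (?d + 1) * card J}"
  define \<F> where "\<F> = (\<lambda>J. convex hull (c ` J)) ` \<J>"
  have fJ: "finite \<J>" using I by (auto simp: \<J>_def)
  have "\<Inter>\<F> \<noteq> {}"
  proof (rule Helly_finite)
    show "finite \<F>" using fJ by (simp add: \<F>_def)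
    show "convex A" if "A \<in> \<F>" for A using that by (auto simp: \<F>_def)
    fix \<G> assume G: "\<G> \<subseteq> \<F>" "card \<G> \<le> ?d + 1"
    obtain \<K> where K: "\<K> \<subseteq> \<J>" "inj_on (\<lambda>J. convex hull (c ` J)) \<K>" "\<G> = (\<lambda>J. convex hull (c ` J)) ` \<K>"
      using G(1) unfolding \<F>_def using subset_image_inj by metis
    have fK: "finite \<K>" using K(1) fJ finite_subset by blast
    have cK: "card \<K> \<le> ?d + 1" using K G(2) by (simp add: card_image)
    have "\<exists>i\<in>I. \<forall>J\<in>\<K>. i \<in> J"
    proof (rule ccontr)
      assume "\<not> ?thesis"
      then have "I \<subseteq> (\<Union>J\<in>\<K>. I - J)" by blast
      then have "card I \<le> card (\<Union>J\<in>\<K>. I - J)" using I(1) fK by (intro card_mono) auto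
      also have "\<dots> \<le> (\<Sum>J\<in>\<K>. card (I - J))" by (rule card_UN_le[OF fK])
      finally have le: "card I \<le> (\<Sum>J\<in>\<K>. card (I - J))" .
      have lt: "(?d + 1) * card (I - J) < card I" if "J \<in> \<K>" for J
      proof -
        have J: "J \<subseteq> I" "?d * card I < (?d + 1) * card J" using that K(1) by (auto simp: \<J>_def)
        have "card (I - J) + card J = card I" using J(1) I(1) by (metis card_Diff_subset card_mono finite_subset le_add_diff_inverse2)
        then have "(?d + 1) * card (I - J) + (?d + 1) * card J = (?d + 1) * card I" by (metis distrib_left)
        then show ?thesis using J(2) by simp
      qed
      have Kne: "\<K> \<noteq> {}" using le I by (auto simp: card_gt_0_iff)
      have "(?d + 1) * card I \<le> (\<Sum>J\<in>\<K>. (?d + 1) * card (I - J))" using le by (metis mult_le_mono2 sum_distrib_left)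
      also have "\<dots> < (\<Sum>J\<in>\<K>. card I)" using fK Kne lt by (intro sum_strict_mono) auto
      also have "\<dots> = card \<K> * card I" by simp
      also have "\<dots> \<le> (?d + 1) * card I" using cK by (intro mult_right_mono) auto
      finally show False by simp
    qed
    then obtain i where i: "i \<in> I" "\<forall>J\<in>\<K>. i \<in> J" by blast
    have "c i \<in> \<Inter>\<G>" unfolding K(3) using i(2) by (auto intro: hull_inc)
    then show "\<Inter>\<G> \<noteq> {}" by blast
  qed
  then obtain z where z: "z \<in> \<Inter>\<F>" by blast
  show ?thesis
  proof (rule that, rule ccontr)
    fix h assume h: "hval h z \<le> 0" and "\<not> card I \<le> (?d + 1) * card {i\<in>I. hval h (c i) \<le> 0}"
    then have lt: "(?d + 1) * card {i\<in>I. hval h (c i) \<le> 0} < card I" by simp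
    define J where "J = {i\<in>I. hval h (c i) > 0}"
    have "I = {i\<in>I. hval h (c i) \<le> 0} \<union> J" by (auto simp: J_def)
    moreover have "card ({i\<in>I. hval h (c i) \<le> 0} \<union> J) = card {i\<in>I. hval h (c i) \<le> 0} + card J"
      using I(1) by (intro card_Un_disjoint) (auto simp: J_def)
    ultimately have "card I = card {i\<in>I. hval h (c i) \<le> 0} + card J" by simp
    then have "(?d + 1) * card I = (?d + 1) * card {i\<in>I. hval h (c i) \<le> 0} + (?d + 1) * card J" by (metis distrib_left)
    then have "?d * card I < (?d + 1) * card J" using lt by simp
    then have "J \<in> \<J>" by (simp add: \<J>_def J_def)
    then have "z \<in> convex hull (c ` J)" using z by (auto simp: \<F>_def)
    moreover have "convex hull (c ` J) \<subseteq> {p. fst h \<bullet> p > snd h}"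
      by (rule hull_minimal) (auto simp: J_def hval_def convex_halfspace_gt)
    ultimately show False using h by (auto simp: hval_def)
  qed
qed

text \<open>Take a centerpoint z of representatives. If K meets every class but z is outside the
  hull of the meeting points, a separating hyperplane has at least a 1/(d+1) fraction of the
  representatives on the side of z, and it splits each of their classes, more than
  \<open>cross\<close> allows.\<close>

lemma center_of_classes:
  fixes x :: "nat \<Rightarrow> 'a::euclidean_space"
  assumes I: "finite I" "I \<noteq> {}" "\<And>S. S \<in> I \<Longrightarrow> S \<noteq> {}"
    and cross: "\<And>h. (DIM('a) + 1) * card {S\<in>I. \<not> sign_constant x h S} < card I"
  obtains z where "\<And>K. convex K \<Longrightarrow> \<forall>S\<in>I. \<exists>i\<in>S. x i \<in> K \<Longrightarrow> z \<in> K"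
proof -
  define rep where "rep S = (SOME i. i \<in> S)" for S :: "nat set"
  have rep: "rep S \<in> S" if "S \<in> I" for S using I(3)[OF that] unfolding rep_def by (simp add: some_in_eq)
  obtain z where z: "\<And>h. hval h z \<le> 0 \<Longrightarrow> card I \<le> (DIM('a) + 1) * card {S\<in>I. hval h (x (rep S)) \<le> 0}"
    using centerpoint[OF I(1,2), of "\<lambda>S. x (rep S)"] by blast
  show ?thesis
  proof (rule that)
    fix K :: "'a set" assume K: "convex K" "\<forall>S\<in>I. \<exists>i\<in>S. x i \<in> K"
    then obtain f where f: "\<And>S. S \<in> I \<Longrightarrow> f S \<in> S \<and> x (f S) \<in> K" by metis
    define T where "T = convex hull ((\<lambda>S. x (f S)) ` I)"
    have TK: "T \<subseteq> K" unfolding T_def using f K(1) by (intro hull_minimal) auto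
    have "compact T" unfolding T_def using I(1) by (intro compact_convex_hull finite_imp_compact) auto
    then have T: "convex T" "closed T" by (auto simp: T_def compact_imp_closed)
    have "z \<in> T"
    proof (rule ccontr)
      assume "z \<notin> T"
      then obtain a b where ab: "a \<bullet> z < b" "\<forall>p\<in>T. b < a \<bullet> p"
        using separating_hyperplane_closed_point[OF T] by blast
      have "hval (a, b) z \<le> 0" using ab(1) by (simp add: hval_def)
      then have "card I \<le> (DIM('a) + 1) * card {S\<in>I. hval (a, b) (x (rep S)) \<le> 0}" by (rule z)
      also have "\<dots> \<le> (DIM('a) + 1) * card {S\<in>I. \<not> sign_constant x (a, b) S}"
      proof (intro mult_left_mono card_mono)
        show "{S\<in>I. hval (a, b) (x (rep S)) \<le> 0} \<subseteq> {S\<in>I. \<not> sign_constant x (a, b) S}"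
        proof safe
          fix S assume S: "S \<in> I" "hval (a, b) (x (rep S)) \<le> 0" "sign_constant x (a, b) S"
          have "x (f S) \<in> T" unfolding T_def using S(1) by (intro hull_inc) auto
          then have "hval (a, b) (x (f S)) > 0" using ab(2) by (simp add: hval_def)
          moreover have "sgn (hval (a, b) (x (f S))) = sgn (hval (a, b) (x (rep S)))"
            using S(3) f[OF S(1)] rep[OF S(1)] unfolding sign_constant_def by blast
          ultimately show False using S(2) by (auto simp: sgn_if split: if_splits)
        qed
      qed (use I(1) in auto)
      finally show False using cross[of "(a, b)"] by simp
    qed
    then show "z \<in> K" using TK by blast
  qed
qed

text \<open>The net consists of a center for every large subfamily of classes and of nets for the
  classes themselves. A convex set that meets at least t classes contains their center; one that
  meets fewer is denser in some class by a factor r / t, so the required density drops geometrically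
  with the depth j.\<close>

lemma weak_net_levels:
  fixes r :: nat and t :: real
  assumes part: "\<forall>N (x :: nat \<Rightarrow> 'a::euclidean_space). finite N \<and> r \<le> card N \<longrightarrow>
    (\<exists>\<S>. finite \<S> \<and> \<Union>\<S> = N \<and> card \<S> \<le> 3 * r \<and> (\<forall>S\<in>\<S>. S \<noteq> {} \<and> r * card S \<le> card N) \<and>
      (\<forall>h. real (DIM('a) + 1) * real (card {S\<in>\<S>. \<not> sign_constant x h S}) < t))"
    and r: "r \<ge> 1" and t: "t > 0"
  shows "finite N \<Longrightarrow> \<exists>Z. finite Z \<and> card Z \<le> (2 ^ (3 * r) + r) * (3 * r + 1) ^ j \<and>
     (\<forall>K. convex K \<and> real (card {i\<in>N. (x :: nat \<Rightarrow> 'a) i \<in> K}) > (t / r) ^ j * real (card N) \<longrightarrow> K \<inter> Z \<noteq> {})"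
proof (induction j arbitrary: N)
  case 0
  have "card {i\<in>N. x i \<in> K} \<le> card N" for K using 0 by (intro card_mono) auto
  then show ?case by (intro exI[of _ "{}"]) (auto simp: not_less)
next
  case (Suc j)
  let ?g = "2 ^ (3 * r) + r" and ?b = "3 * r + 1"
  have b1: "1 \<le> ?b ^ j" by (rule one_le_power) simp
  show ?case
  proof (cases "r \<le> card N")
    \<comment> \<open>Fewer than r points cannot be partitioned, but then all of them go into the
      net; this is the summand r in the bound.\<close>
    case False
    have "card (x ` N) \<le> card N" using Suc.prems by (rule card_image_le)
    also have "\<dots> \<le> ?g * 1" using False by simp
    also have "\<dots> \<le> ?g * ?b ^ Suc j" by (intro mult_le_mono2 one_le_power) simp
    finally have "card (x ` N) \<le> ?g * ?b ^ Suc j" .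
    moreover have "K \<inter> x ` N \<noteq> {}" if "real (card {i\<in>N. x i \<in> K}) > (t / r) ^ Suc j * real (card N)" for K
    proof -
      have "0 \<le> (t / r) ^ Suc j * real (card N)" using t by (intro mult_nonneg_nonneg zero_le_power) auto
      then have "card {i\<in>N. x i \<in> K} > 0" using that by linarith
      then show ?thesis by (auto simp: card_gt_0_iff)
    qed
    ultimately show ?thesis using Suc.prems by (intro exI[of _ "x ` N"]) auto
  next
    case True
    obtain \<S> where S: "finite \<S>" "\<Union>\<S> = N" "card \<S> \<le> 3 * r" "\<forall>S\<in>\<S>. S \<noteq> {} \<and> r * card S \<le> card N"
      "\<forall>h. real (DIM('a) + 1) * real (card {S\<in>\<S>. \<not> sign_constant x h S}) < t"
      using part[rule_format, of N x] True Suc.prems by auto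
    define P where "P I z \<longleftrightarrow> (\<forall>K. convex K \<and> (\<forall>S\<in>I. \<exists>i\<in>S. x i \<in> K) \<longrightarrow> z \<in> K)" for I z
    define ctr where "ctr I = (SOME z. P I z)" for I
    have ctr: "P I (ctr I)" if I: "I \<subseteq> \<S>" "real (card I) \<ge> t" for I
    proof -
      have fI: "finite I" using I(1) S(1) finite_subset by blast
      have "I \<noteq> {}" using I(2) t by auto
      moreover have "(DIM('a) + 1) * card {S\<in>I. \<not> sign_constant x h S} < card I" for h
      proof -
        have "card {S\<in>I. \<not> sign_constant x h S} \<le> card {S\<in>\<S>. \<not> sign_constant x h S}"
          using I(1) S(1) by (intro card_mono) auto
        then have "real (DIM('a) + 1) * real (card {S\<in>I. \<not> sign_constant x h S}) \<le> real (DIM('a) + 1) * real (card {S\<in>\<S>. \<not> sign_constant x h S})"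
          by (intro mult_left_mono) auto
        also have "\<dots> < t" using spec[OF S(5), of h] .
        also have "\<dots> \<le> real (card I)" by (rule I(2))
        finally show ?thesis by (simp only: of_nat_mult[symmetric] of_nat_less_iff)
      qed
      ultimately obtain z where "\<And>K. convex K \<Longrightarrow> \<forall>S\<in>I. \<exists>i\<in>S. x i \<in> K \<Longrightarrow> z \<in> K"
        using center_of_classes[OF fI, of x] I(1) S(4) by (metis subsetD)
      then have "P I z" by (simp add: P_def)
      then show ?thesis unfolding ctr_def by (rule someI)
    qed
    have finS: "finite S" if "S \<in> \<S>" for S using that S(2) Suc.prems by (metis Union_upper finite_subset)
    have "\<forall>S\<in>\<S>. \<exists>Z. finite Z \<and> card Z \<le> ?g * ?b ^ j \<and>
       (\<forall>K. convex K \<and> real (card {i\<in>S. x i \<in> K}) > (t / r) ^ j * real (card S) \<longrightarrow> K \<inter> Z \<noteq> {})"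
      using Suc.IH finS by blast
    then obtain Zf where Zf: "\<forall>S\<in>\<S>. finite (Zf S) \<and> card (Zf S) \<le> ?g * ?b ^ j \<and>
       (\<forall>K. convex K \<and> real (card {i\<in>S. x i \<in> K}) > (t / r) ^ j * real (card S) \<longrightarrow> K \<inter> Zf S \<noteq> {})"
      by (rule bchoice[THEN exE])
    define Z where "Z = ctr ` Pow \<S> \<union> (\<Union>S\<in>\<S>. Zf S)"
    have fZ: "finite Z" using S(1) Zf by (auto simp: Z_def)
    have "card Z \<le> card (ctr ` Pow \<S>) + card (\<Union>S\<in>\<S>. Zf S)" unfolding Z_def by (rule card_Un_le)
    also have "card (ctr ` Pow \<S>) \<le> 2 ^ (3 * r)"
    proof -
      have "card (ctr ` Pow \<S>) \<le> card (Pow \<S>)" using S(1) by (intro card_image_le) auto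
      also have "\<dots> = 2 ^ card \<S>" using S(1) by (rule card_Pow)
      also have "\<dots> \<le> 2 ^ (3 * r)" using S(3) by (intro power_increasing) auto
      finally show ?thesis .
    qed
    also have "card (\<Union>S\<in>\<S>. Zf S) \<le> 3 * r * (?g * ?b ^ j)"
    proof -
      have "card (\<Union>S\<in>\<S>. Zf S) \<le> (\<Sum>S\<in>\<S>. card (Zf S))" by (rule card_UN_le[OF S(1)])
      also have "\<dots> \<le> (\<Sum>S\<in>\<S>. ?g * ?b ^ j)" using Zf by (intro sum_mono) blast
      also have "\<dots> = card \<S> * (?g * ?b ^ j)" by simp
      also have "\<dots> \<le> 3 * r * (?g * ?b ^ j)" using S(3) by (intro mult_right_mono) auto
      finally show ?thesis .
    qed
    also have "2 ^ (3 * r) + 3 * r * (?g * ?b ^ j) \<le> ?g * ?b ^ j + 3 * r * (?g * ?b ^ j)"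
    proof -
      have "2 ^ (3 * r) \<le> ?g * 1" by simp
      also have "\<dots> \<le> ?g * ?b ^ j" by (intro mult_left_mono b1) auto
      finally show ?thesis by (rule add_right_mono)
    qed
    also have "\<dots> = ?g * ?b ^ Suc j" by (simp add: algebra_simps)
    finally have cZ: "card Z \<le> ?g * ?b ^ Suc j" by simp
    have "K \<inter> Z \<noteq> {}" if K: "convex K" "real (card {i\<in>N. x i \<in> K}) > (t / r) ^ Suc j * real (card N)" for K
    proof -
      define I where "I = {S\<in>\<S>. \<exists>i\<in>S. x i \<in> K}"
      have IS: "I \<subseteq> \<S>" by (auto simp: I_def)
      show ?thesis
      proof (cases "real (card I) \<ge> t")
        case True
        have "ctr I \<in> K" using ctr[OF IS True] K(1) by (auto simp: P_def I_def)
        moreover have "ctr I \<in> Z" using IS by (auto simp: Z_def)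
        ultimately show ?thesis by blast
      next
        case False
        \<comment> \<open>Each class has at most |N| / r points and fewer than t classes are met, so
          otherwise K would contain too few points of N.\<close>
        have "\<exists>S\<in>I. real (card {i\<in>S. x i \<in> K}) > (t / r) ^ j * real (card S)"
        proof (rule ccontr)
          assume "\<not> ?thesis"
          then have le: "real (card {i\<in>S. x i \<in> K}) \<le> (t / r) ^ j * real (card S)" if "S \<in> I" for S using that by (simp add: not_less)
          have fI: "finite I" using IS S(1) finite_subset by blast
          have "{i\<in>N. x i \<in> K} \<subseteq> (\<Union>S\<in>I. {i\<in>S. x i \<in> K})" using S(2) by (auto simp: I_def)
          then have "card {i\<in>N. x i \<in> K} \<le> card (\<Union>S\<in>I. {i\<in>S. x i \<in> K})" using fI finS IS by (intro card_mono) auto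
          also have "\<dots> \<le> (\<Sum>S\<in>I. card {i\<in>S. x i \<in> K})" by (rule card_UN_le[OF fI])
          finally have "real (card {i\<in>N. x i \<in> K}) \<le> (\<Sum>S\<in>I. real (card {i\<in>S. x i \<in> K}))"
            by (simp only: of_nat_sum[symmetric] of_nat_le_iff)
          also have "\<dots> \<le> (\<Sum>S\<in>I. (t / r) ^ j * (real (card N) / r))"
          proof (rule sum_mono)
            fix S assume S': "S \<in> I"
            have "r * card S \<le> card N" using S(4) S' IS by blast
            then have "real r * real (card S) \<le> real (card N)" by (simp only: of_nat_mult[symmetric] of_nat_le_iff)
            then have "real (card S) \<le> real (card N) / r" using r by (simp add: field_simps)
            then have "(t / r) ^ j * real (card S) \<le> (t / r) ^ j * (real (card N) / r)" using t by (intro mult_left_mono) auto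
            then show "real (card {i\<in>S. x i \<in> K}) \<le> (t / r) ^ j * (real (card N) / r)" using le[OF S'] by linarith
          qed
          also have "\<dots> = real (card I) * ((t / r) ^ j * (real (card N) / r))" by simp
          also have "\<dots> \<le> t * ((t / r) ^ j * (real (card N) / r))" using False t by (intro mult_right_mono) auto
          also have "\<dots> = (t / r) ^ Suc j * real (card N)" by simp
          finally show False using K(2) by simp
        qed
        then obtain S where S': "S \<in> I" "real (card {i\<in>S. x i \<in> K}) > (t / r) ^ j * real (card S)" by blast
        then have "S \<in> \<S>" using IS by blast
        moreover from this have "K \<inter> Zf S \<noteq> {}" using Zf K(1) S'(2) by blast
        ultimately show ?thesis by (auto simp: Z_def)
      qed
    qed
    then show ?thesis using fZ cZ by blast
  qed
qed

text \<open>The branching r is a constant depending on d and \<eta>. A level multiplies the net by 3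
  r + 1 and the density by \<Lambda> = r^\<alpha> / c1; for large r the first is at most \<Lambda>^D
  because \<alpha> D > 1.\<close>

theorem weak_net:
  fixes \<eta> :: real
  assumes \<eta>: "\<eta> > 0" and d2: "DIM('a::euclidean_space) \<ge> 2"
  shows "\<exists>C>0. \<forall>\<epsilon> N (x :: nat \<Rightarrow> 'a). 0 < \<epsilon> \<and> \<epsilon> \<le> 1 \<and> finite N \<and> N \<noteq> {} \<longrightarrow>
     (\<exists>Z. finite Z \<and> real (card Z) \<le> C * (1 / \<epsilon>) powr (real DIM('a) + \<eta>) \<and>
       (\<forall>K. convex K \<and> real (card {i\<in>N. x i \<in> K}) \<ge> \<epsilon> * real (card N) \<longrightarrow> K \<inter> Z \<noteq> {}))"
proof -
  let ?d = "DIM('a)"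
  \<comment> \<open>Partitions are used with \<eta>/2; the other half makes
    \<open>\<alpha> * D > 1\<close> strict and so absorbs the constants.\<close>
  define \<alpha> where "\<alpha> = 1 / (real ?d + \<eta> / 2)"
  have \<alpha>: "\<alpha> > 0" "\<alpha> < 1" using \<eta> d2 by (auto simp: \<alpha>_def field_simps)
  obtain C0 r0 where C0: "C0 > 0" and part: "\<forall>r\<ge>r0. \<forall>N (x :: nat \<Rightarrow> 'a). finite N \<and> r \<le> card N \<longrightarrow>
    (\<exists>\<S>. finite \<S> \<and> \<Union>\<S> = N \<and> card \<S> \<le> 3 * r \<and> (\<forall>S\<in>\<S>. S \<noteq> {} \<and> r * card S \<le> card N) \<and>
      (\<forall>h. real (card {S\<in>\<S>. \<not> sign_constant x h S}) \<le> C0 * real r powr (1 - \<alpha>)))"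
    using low_crossing_partition[where 'a = 'a, of "\<eta> / 2"] \<eta> d2 unfolding \<alpha>_def by auto
  define c1 where "c1 = (real ?d + 1) * C0 + 1"
  have c1: "c1 > 0" using C0 by (simp add: c1_def add_pos_pos)
  define D where "D = real ?d + \<eta>"
  have aD: "\<alpha> * D > 1" using \<eta> d2 by (simp add: \<alpha>_def D_def field_simps)
  have "\<forall>\<^sub>F r::nat in at_top. ln (3 * real r + 1) \<le> D * (\<alpha> * ln (real r) - ln c1) \<and> \<alpha> * ln (real r) - ln c1 > 0 \<and> r \<ge> r0 \<and> r \<ge> 1"
  proof (intro eventually_conj)
    define \<beta> where "\<beta> = D * \<alpha>"
    have b: "\<beta> > 1" using aD by (simp add: \<beta>_def mult.commute)
    have "\<forall>\<^sub>F r::nat in at_top. ln (3 * real r + 1) \<le> \<beta> * ln (real r) - D * ln c1" using b by real_asymp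
    then show "\<forall>\<^sub>F r::nat in at_top. ln (3 * real r + 1) \<le> D * (\<alpha> * ln (real r) - ln c1)"
      by eventually_elim (simp add: \<beta>_def algebra_simps)
    show "\<forall>\<^sub>F r::nat in at_top. \<alpha> * ln (real r) - ln c1 > 0" using \<alpha>(1) by real_asymp
  qed (rule eventually_ge_at_top)+
  then obtain r where r: "ln (3 * real r + 1) \<le> D * (\<alpha> * ln (real r) - ln c1)" "\<alpha> * ln (real r) - ln c1 > 0" "r \<ge> r0" "r \<ge> 1"
    unfolding eventually_at_top_linorder by blast
  define t where "t = c1 * real r powr (1 - \<alpha>)"
  have t0: "t > 0" using c1 r(4) by (simp add: t_def)
  have part': "\<forall>N (x :: nat \<Rightarrow> 'a). finite N \<and> r \<le> card N \<longrightarrow>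
    (\<exists>\<S>. finite \<S> \<and> \<Union>\<S> = N \<and> card \<S> \<le> 3 * r \<and> (\<forall>S\<in>\<S>. S \<noteq> {} \<and> r * card S \<le> card N) \<and>
      (\<forall>h. real (?d + 1) * real (card {S\<in>\<S>. \<not> sign_constant x h S}) < t))"
  proof (intro allI impI)
    fix N :: "nat set" and x :: "nat \<Rightarrow> 'a" assume N: "finite N \<and> r \<le> card N"
    obtain \<S> where S: "finite \<S>" "\<Union>\<S> = N" "card \<S> \<le> 3 * r" "\<forall>S\<in>\<S>. S \<noteq> {} \<and> r * card S \<le> card N"
      "\<forall>h. real (card {S\<in>\<S>. \<not> sign_constant x h S}) \<le> C0 * real r powr (1 - \<alpha>)"
      using part[rule_format, OF r(3) N, of x] by (elim exE conjE)
    have "real (?d + 1) * real (card {S\<in>\<S>. \<not> sign_constant x h S}) < t" for h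
    proof -
      have "real (?d + 1) * real (card {S\<in>\<S>. \<not> sign_constant x h S}) \<le> real (?d + 1) * (C0 * real r powr (1 - \<alpha>))"
        using spec[OF S(5), of h] by (intro mult_left_mono) auto
      also have "\<dots> < t" using r(4) by (simp add: t_def c1_def algebra_simps)
      finally show ?thesis .
    qed
    then show "\<exists>\<S>. finite \<S> \<and> \<Union>\<S> = N \<and> card \<S> \<le> 3 * r \<and> (\<forall>S\<in>\<S>. S \<noteq> {} \<and> r * card S \<le> card N) \<and>
      (\<forall>h. real (?d + 1) * real (card {S\<in>\<S>. \<not> sign_constant x h S}) < t)"
      using S(1-4) by (intro exI[of _ \<S>] conjI allI) assumption+
  qed
  define \<Lambda> where "\<Lambda> = real r / t"
  have lnl: "ln \<Lambda> = \<alpha> * ln (real r) - ln c1"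
    using t0 r(4) c1 by (simp add: \<Lambda>_def t_def ln_div ln_mult ln_powr algebra_simps)
  have l0: "\<Lambda> > 0" using t0 r(4) by (simp add: \<Lambda>_def)
  have l1: "\<Lambda> > 1" using r(2) lnl l0 by (metis ln_gt_zero_iff)
  define g where "g = real (2 ^ (3 * r) + r)"
  define b where "b = real (3 * r + 1)"
  have b: "b \<le> \<Lambda> powr D"
  proof -
    have "ln b \<le> D * ln \<Lambda>" using r(1) lnl by (simp add: b_def add.commute)
    then have "ln b \<le> ln (\<Lambda> powr D)" using l0 by (simp add: ln_powr)
    then show ?thesis using l0 by (subst (asm) ln_le_cancel_iff) (auto simp: b_def)
  qed
  have b1: "b \<ge> 1" by (simp add: b_def)
  have g0: "g > 0" using r(4) by (simp add: g_def add_pos_nonneg)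
  have "\<exists>Z. finite Z \<and> real (card Z) \<le> (g * b) * (1 / \<epsilon>) powr D \<and>
       (\<forall>K. convex K \<and> real (card {i\<in>N. x i \<in> K}) \<ge> \<epsilon> * real (card N) \<longrightarrow> K \<inter> Z \<noteq> {})"
    if e: "0 < \<epsilon>" "\<epsilon> \<le> 1" and N: "finite N" "N \<noteq> {}" for \<epsilon> N and x :: "nat \<Rightarrow> 'a"
  proof -
    define u where "u = log \<Lambda> (1 / \<epsilon>)"
    have u0: "u \<ge> 0" using e l1 by (simp add: u_def)
    \<comment> \<open>The extra 1 makes \<Lambda>^j strictly larger than 1/\<epsilon>, as the strict
      inequality in \<open>weak_net_levels\<close> demands; it costs only the constant factor
      b.\<close>
    define j where "j = nat \<lfloor>u\<rfloor> + 1"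
    have fl: "real (nat \<lfloor>u\<rfloor>) = of_int \<lfloor>u\<rfloor>" using u0 by simp
    have j: "real j > u" "real (j - 1) \<le> u" unfolding j_def using fl by simp_all linarith
    have lu: "\<Lambda> powr u = 1 / \<epsilon>" using l1 e by (simp add: u_def)
    have "1 / \<epsilon> < \<Lambda> ^ j" using j(1) l1 lu by (metis l0 powr_less_mono powr_realpow)
    then have "(t / r) ^ j < \<epsilon>" using e l0 t0 r(4)
      by (simp add: \<Lambda>_def power_divide field_simps)
    moreover have cN: "real (card N) > 0" using N by (simp add: card_gt_0_iff)
    ultimately have small: "(t / r) ^ j * real (card N) < \<epsilon> * real (card N)" by (rule mult_strict_right_mono)
    obtain Z where Z: "finite Z" "card Z \<le> (2 ^ (3 * r) + r) * (3 * r + 1) ^ j"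
       "\<forall>K. convex K \<and> real (card {i\<in>N. x i \<in> K}) > (t / r) ^ j * real (card N) \<longrightarrow> K \<inter> Z \<noteq> {}"
      using weak_net_levels[OF part' r(4) t0 N(1), of j x] by (elim exE conjE)
    have "real (card Z) \<le> real ((2 ^ (3 * r) + r) * (3 * r + 1) ^ j)" using Z(2) by (simp only: of_nat_le_iff)
    also have "\<dots> = g * b ^ j" by (simp only: g_def b_def of_nat_mult of_nat_power)
    also have "\<dots> = (g * b) * b powr real (j - 1)" using b1 by (simp add: j_def powr_realpow)
    also have "\<dots> \<le> (g * b) * b powr u" using j(2) b1 g0 by (intro mult_left_mono powr_mono) auto
    also have "\<dots> \<le> (g * b) * (\<Lambda> powr D) powr u" using b b1 u0 g0 by (intro mult_left_mono powr_mono2) auto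
    also have "(\<Lambda> powr D) powr u = (1 / \<epsilon>) powr D" unfolding lu[symmetric] by (simp add: powr_powr mult.commute)
    finally have "real (card Z) \<le> (g * b) * (1 / \<epsilon>) powr D" .
    moreover have "K \<inter> Z \<noteq> {}" if "convex K" "real (card {i\<in>N. x i \<in> K}) \<ge> \<epsilon> * real (card N)" for K
      using Z(3) that small by force
    ultimately show ?thesis using Z(1) by blast
  qed
  then show ?thesis using g0 b1 unfolding D_def by (intro exI[of _ "g * b"] conjI allI impI) (auto intro!: mult_pos_pos)
qed

section \<open>The Hadwiger-Debrunner theorem\<close>

text \<open>The point of a compact convex set that is closest to the origin plays the role of a lexicographic minimum.\<close>

lemma closest_unique:
  fixes A :: "'a::euclidean_space set"
  assumes "compact A" "convex A" "A \<noteq> {}" "v \<in> A" "norm v \<le> norm (closest_point A 0)"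
  shows "v = closest_point A 0"
proof (rule closest_point_unique[OF assms(2) compact_imp_closed[OF assms(1)] assms(4)])
  show "\<forall>z\<in>A. dist 0 v \<le> dist 0 z"
    using assms(5) closest_point_le[OF compact_imp_closed[OF assms(1)], of _ 0] by (auto intro: order_trans)
qed

lemma closest_norm_le:
  fixes A :: "'a::euclidean_space set"
  assumes "compact A" "v \<in> A"
  shows "norm (closest_point A 0) \<le> norm v"
  using closest_point_le[OF compact_imp_closed[OF assms(1)] assms(2), of 0] by simp

lemma compact_Inter_family:
  fixes \<G> :: "'a::euclidean_space set set"
  assumes "\<forall>A\<in>\<G>. compact A \<and> convex A" "\<G> \<noteq> {}"
  shows "compact (\<Inter>\<G>)" "convex (\<Inter>\<G>)"
  using assms by (auto intro!: compact_Inter convex_Inter)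

text \<open>Add to the family the open ball B around 0 that reaches up to v. The enlarged family has
  empty intersection, so by Helly at most d + 1 of its sets do; B is among them, since the family
  itself intersects, and the other at most d sets already keep their intersection outside B.\<close>

lemma closest_point_Inter_determined:
  fixes \<G> :: "'a::euclidean_space set set"
  assumes G: "finite \<G>" "\<forall>A\<in>\<G>. compact A \<and> convex A" "\<Inter>\<G> \<noteq> {}" "DIM('a) \<le> card \<G>"
  obtains \<D> where "\<D> \<subseteq> \<G>" "card \<D> = DIM('a)" "closest_point (\<Inter>\<D>) 0 = closest_point (\<Inter>\<G>) 0"
proof -
  let ?d = "DIM('a)" and ?v = "closest_point (\<Inter>\<G>) 0"
  have Gne: "\<G> \<noteq> {}" using G(4) DIM_positive[where 'a = 'a] by auto
  note cG = compact_Inter_family[OF G(2) Gne]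
  have v: "?v \<in> \<Inter>\<G>" using closest_point_in_set[OF compact_imp_closed[OF cG(1)] G(3)] .
  define B where "B = ball (0::'a) (norm ?v)"
  have empty: "\<Inter>\<G> \<inter> B = {}"
    using closest_norm_le[OF cG(1)] by (force simp: B_def)
  have "\<exists>\<H>\<subseteq>\<G>. card \<H> \<le> ?d \<and> \<Inter>\<H> \<inter> B = {}"
  proof (rule ccontr)
    assume no: "\<not> ?thesis"
    have "\<Inter>(insert B \<G>) \<noteq> {}"
    proof (rule Helly_finite)
      show "finite (insert B \<G>)" using G(1) by simp
      show "convex A" if "A \<in> insert B \<G>" for A using that G(2) by (auto simp: B_def)
      fix \<H> assume H: "\<H> \<subseteq> insert B \<G>" "card \<H> \<le> ?d + 1"
      show "\<Inter>\<H> \<noteq> {}"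
      proof (cases "B \<in> \<H>")
        case False
        then have "\<H> \<subseteq> \<G>" using H(1) by blast
        then show ?thesis using G(3) by blast
      next
        case True
        have fH: "finite \<H>" using H(1) G(1) finite_subset by blast
        have "card (\<H> - {B}) \<le> ?d" using True H(2) fH by simp
        moreover have "\<H> - {B} \<subseteq> \<G>" using H(1) by blast
        ultimately have "\<Inter>(\<H> - {B}) \<inter> B \<noteq> {}" using no by blast
        then show ?thesis using True by blast
      qed
    qed
    then show False using empty by auto
  qed
  then obtain \<H> where H: "\<H> \<subseteq> \<G>" "card \<H> \<le> ?d" "\<Inter>\<H> \<inter> B = {}" by blast
  obtain \<D> where D: "\<H> \<subseteq> \<D>" "\<D> \<subseteq> \<G>" "card \<D> = ?d"
    using exists_subset_between[OF H(2) G(4) H(1) G(1)] by blast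
  have Dne: "\<D> \<noteq> {}" using D(3) DIM_positive[where 'a = 'a] by auto
  have D2: "\<forall>A\<in>\<D>. compact A \<and> convex A" using D(2) G(2) by blast
  note cD = compact_Inter_family[OF D2 Dne]
  have vD: "?v \<in> \<Inter>\<D>" using v D(2) by blast
  have "closest_point (\<Inter>\<D>) 0 \<in> \<Inter>\<D>"
    using closest_point_in_set[OF compact_imp_closed[OF cD(1)]] vD by blast
  then have "closest_point (\<Inter>\<D>) 0 \<notin> B" using D(1) H(3) by blast
  then have "norm ?v \<le> norm (closest_point (\<Inter>\<D>) 0)" by (simp add: B_def)
  then have "?v = closest_point (\<Inter>\<D>) 0" using closest_unique[OF cD _ vD] vD by blast
  then show ?thesis using that D by simp
qed

text \<open>In contrast to \<open>pq_property\<close> it requires neither p members nor nonempty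
  ones, so that it passes to subfamilies.\<close>

definition has_pq :: "nat \<Rightarrow> nat \<Rightarrow> 'a set set \<Rightarrow> bool" where
  "has_pq p q F \<longleftrightarrow> (\<forall>G\<subseteq>F. card G = p \<longrightarrow> (\<exists>H\<subseteq>G. card H = q \<and> \<Inter>H \<noteq> {}))"

definition pierced :: "nat \<Rightarrow> 'a set set \<Rightarrow> bool" where
  "pierced s F \<longleftrightarrow> (\<exists>T. finite T \<and> card T \<le> s \<and> transversal T F)"

lemma pierced_mono: "pierced s F \<Longrightarrow> s \<le> t \<Longrightarrow> G \<subseteq> F \<Longrightarrow> pierced t G"
  unfolding pierced_def transversal_def by (meson le_trans subsetD)

lemma pierced_Un:
  assumes "pierced s F" "pierced t G" shows "pierced (s + t) (F \<union> G)"
proof -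
  obtain S T where "finite S" "card S \<le> s" "transversal S F" "finite T" "card T \<le> t" "transversal T G"
    using assms by (auto simp: pierced_def)
  then show ?thesis unfolding pierced_def
    by (intro exI[of _ "S \<union> T"]) (use card_Un_le[of S T] in \<open>auto simp: transversal_def\<close>)
qed

lemma pierced_by_points:
  assumes "finite F" "\<forall>A\<in>F. A \<noteq> {}" "H \<subseteq> F" "\<Inter>H \<noteq> {}"
  shows "pierced (card F - card H + 1) F"
proof -
  obtain v where v: "v \<in> \<Inter>H" using assms(4) by blast
  define f where "f A = (SOME a. a \<in> A)" for A :: "'a set"
  have f: "f A \<in> A" if "A \<in> F" for A using assms(2) that unfolding f_def by (simp add: some_in_eq)
  have "card (insert v (f ` (F - H))) \<le> card (f ` (F - H)) + 1"
    using card_insert_le_m1[of "card (f ` (F - H)) + 1" "f ` (F - H)" v] by simp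
  also have "card (f ` (F - H)) \<le> card (F - H)" using assms(1) by (intro card_image_le) auto
  also have "card (F - H) = card F - card H" using assms(1,3) by (simp add: card_Diff_subset finite_subset)
  finally have "card (insert v (f ` (F - H))) \<le> card F - card H + 1" by simp
  moreover have "transversal (insert v (f ` (F - H))) F" unfolding transversal_def using v f by blast
  moreover have "finite (insert v (f ` (F - H)))" using assms(1) by simp
  ultimately show ?thesis unfolding pierced_def by blast
qed

text \<open>Induction on p - q. One point v disposes of d members \<D> and of all members meeting
  their intersection. A common point of the remaining family and some of \<D> thus misses a member
  of \<D>, so the rest has the (p - d, q - d + 1)-property, and p - q has dropped by one.\<close>

theorem Hadwiger_Debrunner:
  fixes F :: "'a::euclidean_space set set"
  assumes "finite F" "\<forall>A\<in>F. compact A \<and> convex A \<and> A \<noteq> {}" "p \<le> card F" "has_pq p q F"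
    "q \<le> p" "q \<ge> DIM('a) + 1" "(DIM('a) - 1) * p < DIM('a) * (q - 1)"
  shows "pierced (p - q + 1) F"
  using assms
proof (induction "p - q" arbitrary: p q F)
  case 0
  note prems = 0(2-8)
  let ?d = "DIM('a)"
  have pq: "p = q" using 0 by simp
  have "\<Inter>F \<noteq> {}"
  proof (rule Helly_finite)
    fix \<G> assume G: "\<G> \<subseteq> F" "card \<G> \<le> ?d + 1"
    have "card \<G> \<le> p" using G(2) prems(6) pq by simp
    then obtain G' where G': "\<G> \<subseteq> G'" "G' \<subseteq> F" "card G' = p"
      using exists_subset_between[OF _ prems(3) G(1) prems(1)] by blast
    then obtain H where H: "H \<subseteq> G'" "card H = q" "\<Inter>H \<noteq> {}" using prems(4) unfolding has_pq_def by blast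
    have "H = G'" using H G' pq prems(1) by (metis card_subset_eq finite_subset)
    then show "\<Inter>\<G> \<noteq> {}" using H(3) G'(1) by blast
  qed (use prems in auto)
  then have "pierced (card F - card F + 1) F" using prems by (intro pierced_by_points) auto
  then show ?case using pq by simp
next
  case (Suc m)
  note prems = Suc(3-9)
  let ?d = "DIM('a)"
  have d1: "?d \<ge> 1" using DIM_positive[where 'a = 'a] by simp
  have cc: "\<forall>A\<in>F. compact A \<and> convex A" using prems(2) by blast
  define vp where "vp \<D> = closest_point (\<Inter>\<D>) (0::'a)" for \<D>
  define \<Delta> where "\<Delta> = {\<D>. \<D> \<subseteq> F \<and> card \<D> = ?d \<and> \<Inter>\<D> \<noteq> {}}"
  have fD: "finite \<Delta>" using prems(1) by (auto simp: \<Delta>_def)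
  have "\<Delta> \<noteq> {}"
  proof -
    obtain G where "G \<subseteq> F" "card G = p" using obtain_subset_with_card_n[OF prems(3)] by blast
    then obtain H where H: "H \<subseteq> G" "card H = q" "\<Inter>H \<noteq> {}" "G \<subseteq> F" using prems(4) unfolding has_pq_def by blast
    have "?d \<le> card H" using H(2) prems(6) by simp
    then obtain \<D> where DH: "\<D> \<subseteq> H" "card \<D> = ?d" by (meson obtain_subset_with_card_n)
    have "\<Inter>H \<subseteq> \<Inter>\<D>" using DH(1) by (rule Inter_anti_mono)
    then have "\<Inter>\<D> \<noteq> {}" using H(3) by (metis subset_empty)
    moreover have "\<D> \<subseteq> F" using DH(1) H(1,4) by (meson order_trans)
    ultimately have "\<D> \<in> \<Delta>" using DH(2) by (simp add: \<Delta>_def)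
    then show ?thesis by blast
  qed
  \<comment> \<open>The extremal choice: among intersecting d-tuples, the one whose closest point is
    farthest from the origin.\<close>
  then obtain \<D> where D: "\<D> \<in> \<Delta>" "\<And>\<D>'. \<D>' \<in> \<Delta> \<Longrightarrow> norm (vp \<D>') \<le> norm (vp \<D>)"
  proof -
    let ?N = "(\<lambda>\<D>. norm (vp \<D>)) ` \<Delta>"
    have "Max ?N \<in> ?N" using fD \<open>\<Delta> \<noteq> {}\<close> by (intro Max_in) auto
    then obtain \<D> where "\<D> \<in> \<Delta>" "norm (vp \<D>) = Max ?N" by auto
    then show ?thesis using that[of \<D>] fD by simp
  qed
  have D': "\<D> \<subseteq> F" "card \<D> = ?d" "\<Inter>\<D> \<noteq> {}" using D(1) by (auto simp: \<Delta>_def)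
  have finD: "finite \<D>" using D'(1) prems(1) finite_subset by blast
  have Dne: "\<D> \<noteq> {}" using D'(2) d1 by auto
  have ccD: "\<forall>A\<in>\<D>. compact A \<and> convex A" using cc D'(1) by blast
  note cD = compact_Inter_family[OF ccD Dne]
  let ?v = "vp \<D>"
  have vD: "?v \<in> \<Inter>\<D>" unfolding vp_def using closest_point_in_set[OF compact_imp_closed[OF cD(1)] D'(3)] .
  \<comment> \<open>The closest point after adding A is determined by d of the sets, hence by
    maximality no farther out than v; as it lies in the intersection of \<D>, uniqueness makes it
    equal to v.\<close>
  have key: "?v \<in> A" if A: "A \<in> F" "\<Inter>\<D> \<inter> A \<noteq> {}" for A
  proof -
    have ins: "finite (insert A \<D>)" "\<forall>B\<in>insert A \<D>. compact B \<and> convex B" "\<Inter>(insert A \<D>) \<noteq> {}" "?d \<le> card (insert A \<D>)"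
      using finD cc A D' ccD card_insert_le[of \<D> A] by auto
    obtain \<E> where E: "\<E> \<subseteq> insert A \<D>" "card \<E> = ?d" "vp \<E> = vp (insert A \<D>)"
      using closest_point_Inter_determined[OF ins] unfolding vp_def by blast
    have "\<Inter>\<E> \<noteq> {}" using ins(3) E(1) by blast
    then have "\<E> \<in> \<Delta>" using E A(1) D'(1) by (auto simp: \<Delta>_def)
    then have le: "norm (vp (insert A \<D>)) \<le> norm ?v" using D(2) E(3) by metis
    have "compact (\<Inter>(insert A \<D>))" by (rule compact_Inter_family(1)[OF ins(2)]) simp
    then have w: "vp (insert A \<D>) \<in> \<Inter>(insert A \<D>)"
      unfolding vp_def using closest_point_in_set[OF compact_imp_closed ins(3)] by blast
    then have "vp (insert A \<D>) \<in> \<Inter>\<D>" by blast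
    then have "vp (insert A \<D>) = ?v" using closest_unique[OF cD D'(3)] le unfolding vp_def by blast
    then show ?thesis using w by auto
  qed
  define F' where "F' = {A \<in> F - \<D>. ?v \<notin> A}"
  have finF': "finite F'" using prems(1) by (simp add: F'_def)
  have hit: "pierced 1 (F - F')"
    unfolding pierced_def
    by (rule exI[of _ "{?v}"]) (use vD in \<open>auto simp: F'_def transversal_def\<close>)
  have F'F: "F' \<subseteq> F" by (auto simp: F'_def)
  \<comment> \<open>Stated for all G of at most p - d sets, because the remaining family itself may
    be that small. The alternative \<open>card G \<le> p - q\<close> arises when the q intersecting
    sets avoid G.\<close>
  have rest: "\<exists>H\<subseteq>G. card H + p \<ge> q + card G + 1 \<and> \<Inter>H \<noteq> {} \<or> card G \<le> p - q" if G: "G \<subseteq> F'" "card G \<le> p - ?d" for G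
  proof -
    have finG: "finite G" using G(1) finF' finite_subset by blast
    have dpq: "?d < p" using prems(5,6) by simp
    have "G \<inter> \<D> = {}" using G(1) by (auto simp: F'_def)
    then have cGD: "card (G \<union> \<D>) = card G + ?d" using finG finD D'(2) by (simp add: card_Un_disjoint)
    then have "card (G \<union> \<D>) \<le> p" using G(2) dpq by simp
    moreover have "G \<union> \<D> \<subseteq> F" using G(1) F'F D'(1) by blast
    ultimately obtain P where P: "G \<union> \<D> \<subseteq> P" "P \<subseteq> F" "card P = p"
      using exists_subset_between[of "G \<union> \<D>" p F] prems(1,3) by blast
    obtain H where H: "H \<subseteq> P" "card H = q" "\<Inter>H \<noteq> {}" using prems(4) P unfolding has_pq_def by blast
    have finP: "finite P" using P(2) prems(1) finite_subset by blast
    have finH: "finite H" using H(1) finP finite_subset by blast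
    show ?thesis
    proof (cases "H \<inter> G = {}")
      case True
      then have "H \<union> G \<subseteq> P" "card (H \<union> G) = card H + card G" using H(1) P(1) finH finG by (auto simp: card_Un_disjoint)
      then have "q + card G \<le> p" using H(2) P(3) card_mono[OF finP, of "H \<union> G"] by simp
      then show ?thesis by auto
    next
      case False
      then obtain A where A: "A \<in> H" "A \<in> G" by blast
      have "\<not> \<D> \<subseteq> H"
      proof
        assume "\<D> \<subseteq> H"
        then have "\<Inter>\<D> \<inter> A \<noteq> {}" using A(1) H(3) by blast
        then have "?v \<in> A" using key A(2) G(1) F'F by blast
        then show False using A(2) G(1) by (auto simp: F'_def)
      qed
      then have "H \<inter> \<D> \<subset> \<D>" by blast
      then have hd: "card (H \<inter> \<D>) < ?d" using finD D'(2) psubset_card_mono by metis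
      have "H \<subseteq> (H \<inter> G) \<union> (H \<inter> \<D>) \<union> (P - (G \<union> \<D>))" using H(1) by blast
      then have "card H \<le> card ((H \<inter> G) \<union> (H \<inter> \<D>) \<union> (P - (G \<union> \<D>)))" using finH finP by (intro card_mono) auto
      also have "\<dots> \<le> card (H \<inter> G) + card (H \<inter> \<D>) + card (P - (G \<union> \<D>))"
        using card_Un_le[of "(H \<inter> G) \<union> (H \<inter> \<D>)" "P - (G \<union> \<D>)"] card_Un_le[of "H \<inter> G" "H \<inter> \<D>"] by linarith
      also have "card (P - (G \<union> \<D>)) = p - (card G + ?d)" using P cGD finG finD by (simp add: card_Diff_subset)
      finally have "q + card G + 1 \<le> card (H \<inter> G) + p" using hd H(2) G(2) dpq by linarith
      moreover have "\<Inter>(H \<inter> G) \<noteq> {}" using H(3) by blast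
      ultimately show ?thesis by (intro exI[of _ "H \<inter> G"]) auto
    qed
  qed
  have m: "p - q = Suc m" "p > q" using Suc(2) by auto
  have "pierced (m + 1) F'"
  proof (cases "card F' < p - ?d")
    case True
    obtain H where H: "H \<subseteq> F'" "card H + p \<ge> q + card F' + 1 \<and> \<Inter>H \<noteq> {} \<or> card F' \<le> p - q"
      using rest[of F'] True by auto
    show ?thesis
    proof (cases "card F' \<le> p - q")
      case le: True
      show ?thesis
      proof (cases "F' = {}")
        case True then show ?thesis unfolding pierced_def transversal_def by (intro exI[of _ "{}"]) auto
      next
        case False
        then obtain A where "A \<in> F'" by blast
        then have "pierced (card F' - card {A} + 1) F'"
          using finF' prems(2) F'F by (intro pierced_by_points) auto
        then show ?thesis by (rule pierced_mono) (use le m in auto)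
      qed
    next
      case False
      then have "pierced (card F' - card H + 1) F'"
        using H finF' prems(2) F'F by (intro pierced_by_points) auto
      then show ?thesis by (rule pierced_mono) (use H False m in auto)
    qed
  next
    case False
    \<comment> \<open>Both sides of the numerical hypothesis drop by d (d - 1), so it carries
      over.\<close>
    define p' q' where "p' = p - ?d" and "q' = q - ?d + 1"
    have big: "p - q < p - ?d" using prems(5,6) by linarith
    have ineq: "(?d - 1) * p < ?d * (q - 1)" by (rule prems(7))
    have pq: "has_pq p' q' F'"
      unfolding has_pq_def
    proof (intro allI impI)
      fix G assume G: "G \<subseteq> F'" "card G = p'"
      then obtain H where "H \<subseteq> G" "card H + p \<ge> q + card G + 1 \<and> \<Inter>H \<noteq> {} \<or> card G \<le> p - q"
        using rest[of G] by (auto simp: p'_def)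
      then have H: "H \<subseteq> G" "card H + p \<ge> q + card G + 1" "\<Inter>H \<noteq> {}" using G(2) big by (auto simp: p'_def)
      have "q' \<le> card H" using H(2) G(2) prems(5,6) by (simp add: p'_def q'_def)
      then obtain H' where H': "H' \<subseteq> H" "card H' = q'" by (meson obtain_subset_with_card_n)
      have "\<Inter>H' \<noteq> {}" using H(3) Inter_anti_mono[OF H'(1)] by (metis subset_empty)
      then show "\<exists>H\<subseteq>G. card H = q' \<and> \<Inter>H \<noteq> {}" using H(1) H' by (intro exI[of _ H']) simp
    qed
    have ineq': "(?d - 1) * p' < ?d * (q' - 1)"
    proof -
      have "(?d - 1) * p = (?d - 1) * p' + (?d - 1) * ?d" using prems(5,6) by (simp add: p'_def flip: distrib_left)
      moreover have "?d * (q - 1) = ?d * (q' - 1) + ?d * (?d - 1)"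
      proof -
        have "q - 1 = (q' - 1) + (?d - 1)" using prems(6) d1 by (simp add: q'_def)
        then show ?thesis by (metis distrib_left)
      qed
      ultimately show ?thesis using ineq by (simp add: mult.commute)
    qed
    have le: "q' \<le> p'" using m prems(6) by (simp add: p'_def q'_def)
    \<comment> \<open>From (d - 1) q' \<le> (d - 1) p' < d (q' - 1) one gets q' > d.\<close>
    have "q' \<ge> ?d + 1"
    proof (rule ccontr)
      assume "\<not> ?thesis"
      then have "q' \<le> ?d" by simp
      have "(?d - 1) * q' \<le> (?d - 1) * p'" using le by simp
      then have a: "(?d - 1) * q' < ?d * (q' - 1)" using ineq' by linarith
      have "q' \<ge> 1" by (simp add: q'_def)
      then have "int ((?d - 1) * q') = (int ?d - 1) * int q'" "int (?d * (q' - 1)) = int ?d * (int q' - 1)"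
        using d1 by (simp_all add: of_nat_diff)
      then have "(int ?d - 1) * int q' < int ?d * (int q' - 1)" using a by linarith
      then have "int q' > int ?d" by (simp add: algebra_simps)
      then show False using \<open>q' \<le> ?d\<close> by simp
    qed
    moreover have m': "p' - q' = m" using m prems(6) by (simp add: p'_def q'_def)
    moreover have "\<forall>A\<in>F'. compact A \<and> convex A \<and> A \<noteq> {}" using prems(2) F'F by (meson subsetD)
    moreover have "p' \<le> card F'" using False by (simp add: p'_def)
    ultimately have "pierced (p' - q' + 1) F'" using finF' pq le ineq' by (intro Suc.hyps(1)) simp_all
    then show ?thesis using m' by simp
  qed
  then have "pierced (m + 1 + 1) (F' \<union> (F - F'))" using hit by (rule pierced_Un)
  moreover have "F' \<union> (F - F') = F" using F'F by blast
  ultimately show ?case using m by simp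
qed

section \<open>Weighted fractional Helly theorem\<close>

text \<open>The elementary symmetric polynomial of degree i in the weights.\<close>

definition esym :: "'i set \<Rightarrow> ('i \<Rightarrow> real) \<Rightarrow> nat \<Rightarrow> real" where
  "esym F w i = (\<Sum>B | B \<subseteq> F \<and> card B = i. \<Prod>A\<in>B. w A)"

lemma esym_nonneg: "(\<And>A. w A \<ge> 0) \<Longrightarrow> esym F w i \<ge> 0"
  unfolding esym_def by (intro sum_nonneg prod_nonneg) auto

lemma esym_0: "finite F \<Longrightarrow> esym F w 0 = 1"
proof -
  assume F: "finite F"
  have "{B. B \<subseteq> F \<and> card B = 0} = {{}}" using finite_subset[OF _ F] by (auto simp: card_eq_0_iff)
  then show ?thesis by (simp add: esym_def)
qed

text \<open>Double counting of pairs (C, A) with A in C and B = C - {A}.\<close>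

lemma esym_Suc:
  assumes F: "finite F"
  shows "real (Suc i) * esym F w (Suc i) = (\<Sum>B | B \<subseteq> F \<and> card B = i. (\<Prod>A\<in>B. w A) * (\<Sum>A\<in>F - B. w A))"
proof -
  have "(\<Sum>B | B \<subseteq> F \<and> card B = i. (\<Prod>A\<in>B. w A) * (\<Sum>A\<in>F - B. w A))
      = (\<Sum>B | B \<subseteq> F \<and> card B = i. \<Sum>A\<in>F - B. \<Prod>A'\<in>insert A B. w A')"
  proof (rule sum.cong[OF refl])
    fix B assume "B \<in> {B. B \<subseteq> F \<and> card B = i}"
    then have "finite B" using F finite_subset by auto
    then show "(\<Prod>A\<in>B. w A) * (\<Sum>A\<in>F - B. w A) = (\<Sum>A\<in>F - B. \<Prod>A'\<in>insert A B. w A')"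
      unfolding sum_distrib_left by (intro sum.cong refl) (simp add: mult.commute)
  qed
  also have "\<dots> = (\<Sum>(B, A)\<in>(SIGMA B:{B. B \<subseteq> F \<and> card B = i}. F - B). \<Prod>A'\<in>insert A B. w A')"
    using F by (intro sum.Sigma) auto
  also have "\<dots> = (\<Sum>(C, A)\<in>(SIGMA C:{C. C \<subseteq> F \<and> card C = Suc i}. C). \<Prod>A'\<in>C. w A')"
  proof (rule sum.reindex_bij_witness[where i = "\<lambda>(C, A). (C - {A}, A)" and j = "\<lambda>(B, A). (insert A B, A)"], goal_cases)
    case (1 a) then show ?case by auto
  next
    case (2 a) then show ?case using F finite_subset[of _ F] by (auto simp: card_insert_if)
  next
    case (3 a) then show ?case by auto
  next
    case (4 a) then show ?case using F finite_subset[of _ F] by (auto simp: card_Diff_singleton)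
  next
    case (5 a) then show ?case by auto
  qed
  also have "\<dots> = (\<Sum>C | C \<subseteq> F \<and> card C = Suc i. \<Sum>A\<in>C. \<Prod>A'\<in>C. w A')"
    using F finite_subset by (intro sum.Sigma[symmetric]) auto
  also have "\<dots> = (\<Sum>C | C \<subseteq> F \<and> card C = Suc i. real (Suc i) * (\<Prod>A'\<in>C. w A'))"
    by (intro sum.cong refl) auto
  also have "\<dots> = real (Suc i) * esym F w (Suc i)" by (simp only: esym_def sum_distrib_left)
  finally show ?thesis by simp
qed

lemma esym_le_power:
  assumes F: "finite F" and w: "\<And>A. w A \<ge> 0"
  shows "esym F w i \<le> (sum w F) ^ i"
proof (induction i)
  case 0 then show ?case using esym_0[OF F] by simp
next
  case (Suc i)
  have "esym F w (Suc i) \<le> real (Suc i) * esym F w (Suc i)"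
    using esym_nonneg[of w F "Suc i", OF w] by (simp add: algebra_simps)
  also have "\<dots> = (\<Sum>B | B \<subseteq> F \<and> card B = i. (\<Prod>A\<in>B. w A) * (\<Sum>A\<in>F - B. w A))" by (rule esym_Suc[OF F])
  also have "\<dots> \<le> (\<Sum>B | B \<subseteq> F \<and> card B = i. (\<Prod>A\<in>B. w A) * sum w F)"
    using F w by (intro sum_mono mult_left_mono sum_mono2 prod_nonneg) auto
  also have "\<dots> = esym F w i * sum w F" by (simp add: esym_def sum_distrib_right)
  also have "\<dots> \<le> sum w F ^ i * sum w F" using Suc w by (intro mult_right_mono sum_nonneg) auto
  finally show ?case by (simp add: mult.commute)
qed

text \<open>Weights are at most 1, so removing i < k members from F costs at most half of the total
  weight.\<close>

lemma esym_ratio: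
  assumes F: "finite F" and w: "\<And>A. w A \<ge> 0" "\<And>A. w A \<le> 1" and W: "sum w F \<ge> 2 * real k" and i: "i < k"
  shows "esym F w (Suc i) \<ge> sum w F / (2 * real k) * esym F w i"
proof -
  have "(sum w F - real i) * esym F w i \<le> real (Suc i) * esym F w (Suc i)"
  proof -
    have "(sum w F - real i) * esym F w i = (\<Sum>B | B \<subseteq> F \<and> card B = i. (\<Prod>A\<in>B. w A) * (sum w F - real i))"
      by (simp add: esym_def sum_distrib_left mult.commute)
    also have "\<dots> \<le> (\<Sum>B | B \<subseteq> F \<and> card B = i. (\<Prod>A\<in>B. w A) * (\<Sum>A\<in>F - B. w A))"
    proof (intro sum_mono mult_left_mono prod_nonneg)
      fix B assume B: "B \<in> {B. B \<subseteq> F \<and> card B = i}"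
      have "sum w B \<le> (\<Sum>A\<in>B. 1)" by (intro sum_mono w)
      then have "sum w B \<le> real i" using B by simp
      moreover have "sum w (F - B) = sum w F - sum w B" using B F by (intro sum_diff) auto
      ultimately show "sum w F - real i \<le> (\<Sum>A\<in>F - B. w A)" by simp
    qed (use w in auto)
    finally show ?thesis using esym_Suc[OF F, of i w] by simp
  qed
  moreover have "sum w F / 2 \<le> sum w F - real i" using W i by simp
  ultimately have "sum w F / 2 * esym F w i \<le> real (Suc i) * esym F w (Suc i)"
    using mult_right_mono[OF _ esym_nonneg[of w F i, OF w(1)]] by (meson order_trans)
  also have "\<dots> \<le> real k * esym F w (Suc i)" using i esym_nonneg[of w F "Suc i", OF w(1)] by (intro mult_right_mono) auto
  finally show ?thesis using i by (simp add: field_simps)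
qed

lemma esym_ratio_power:
  assumes F: "finite F" and w: "\<And>A. w A \<ge> 0" "\<And>A. w A \<le> 1" and W: "sum w F \<ge> 2 * real k"
  shows "i + j \<le> k \<Longrightarrow> esym F w (i + j) \<ge> (sum w F / (2 * real k)) ^ j * esym F w i"
proof (induction j)
  case (Suc j)
  have W0: "sum w F / (2 * real k) \<ge> 0" using w by (simp add: sum_nonneg)
  have "(sum w F / (2 * real k)) ^ Suc j * esym F w i = sum w F / (2 * real k) * ((sum w F / (2 * real k)) ^ j * esym F w i)" by simp
  also have "\<dots> \<le> sum w F / (2 * real k) * esym F w (i + j)" using Suc W0 by (intro mult_left_mono) auto
  also have "\<dots> \<le> esym F w (Suc (i + j))" using Suc.prems by (intro esym_ratio[OF F w W]) auto
  finally show ?case by simp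
qed simp

definition isum :: "'a set set \<Rightarrow> ('a set \<Rightarrow> real) \<Rightarrow> nat \<Rightarrow> real" where
  "isum F w j = (\<Sum>J | J \<subseteq> F \<and> card J = j \<and> \<Inter>J \<noteq> {}. \<Prod>A\<in>J. w A)"

text \<open>Double counting of pairs J \<subseteq> B with |B| = k: each B contains r sets with a
  common point, hence r choose j intersecting j-sets.\<close>

lemma isum_lower:
  assumes F: "finite F" and w: "\<And>A. w A \<ge> 0" and pq: "has_pq k r F" and j: "j \<le> k"
  shows "real (r choose j) * esym F w k \<le> isum F w j * esym F w (k - j)"
proof -
  let ?Bs = "{B. B \<subseteq> F \<and> card B = k}" and ?Js = "{J. J \<subseteq> F \<and> card J = j \<and> \<Inter>J \<noteq> {}}"
  have fin: "finite ?Bs" "finite ?Js" using F by auto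
  have "real (r choose j) * esym F w k = (\<Sum>B\<in>?Bs. real (r choose j) * (\<Prod>A\<in>B. w A))"
    by (simp add: esym_def sum_distrib_left)
  also have "\<dots> \<le> (\<Sum>B\<in>?Bs. \<Sum>J\<in>?Js. if J \<subseteq> B then \<Prod>A\<in>B. w A else 0)"
  proof (rule sum_mono)
    fix B assume B: "B \<in> ?Bs"
    then obtain H where H: "H \<subseteq> B" "card H = r" "\<Inter>H \<noteq> {}" using pq unfolding has_pq_def by blast
    have fB: "finite B" using B F finite_subset by auto
    then have fH: "finite H" using H(1) finite_subset by blast
    have "{J. J \<subseteq> H \<and> card J = j} \<subseteq> {J\<in>?Js. J \<subseteq> B}"
    proof safe
      fix J assume J: "J \<subseteq> H" "j = card J"
      show "x \<in> F" if "x \<in> J" for x using that J(1) H(1) B by blast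
      show "x \<in> B" if "x \<in> J" for x using that J(1) H(1) by blast
      assume "\<Inter>J = {}"
      then show False using H(3) Inter_anti_mono[OF J(1)] by (metis subset_empty)
    qed
    then have "card {J. J \<subseteq> H \<and> card J = j} \<le> card {J\<in>?Js. J \<subseteq> B}"
      by (intro card_mono finite_subset[OF _ fin(2)]) auto
    then have "real (r choose j) \<le> real (card {J\<in>?Js. J \<subseteq> B})" using n_subsets[OF fH, of j] H(2) by simp
    then have "real (r choose j) * (\<Prod>A\<in>B. w A) \<le> real (card {J\<in>?Js. J \<subseteq> B}) * (\<Prod>A\<in>B. w A)"
      using w by (intro mult_right_mono prod_nonneg) auto
    also have "\<dots> = (\<Sum>J | J \<in> ?Js \<and> J \<subseteq> B. \<Prod>A\<in>B. w A)" by simp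
    also have "\<dots> = (\<Sum>J\<in>?Js. if J \<subseteq> B then \<Prod>A\<in>B. w A else 0)" by (rule sum.inter_filter[OF fin(2)])
    finally show "real (r choose j) * (\<Prod>A\<in>B. w A) \<le> (\<Sum>J\<in>?Js. if J \<subseteq> B then \<Prod>A\<in>B. w A else 0)" .
  qed
  also have "\<dots> = (\<Sum>J\<in>?Js. \<Sum>B\<in>?Bs. if J \<subseteq> B then \<Prod>A\<in>B. w A else 0)" by (rule sum.swap)
  also have "\<dots> \<le> (\<Sum>J\<in>?Js. (\<Prod>A\<in>J. w A) * esym F w (k - j))"
  proof (rule sum_mono)
    fix J assume J: "J \<in> ?Js"
    have fJ: "finite J" using J F finite_subset by auto
    let ?S = "{B. B \<in> ?Bs \<and> J \<subseteq> B}"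
    have "(\<Sum>B\<in>?Bs. if J \<subseteq> B then \<Prod>A\<in>B. w A else 0) = (\<Sum>B\<in>?S. \<Prod>A\<in>B. w A)"
      by (rule sum.inter_filter[OF fin(1), symmetric])
    also have "\<dots> = (\<Sum>B\<in>?S. (\<Prod>A\<in>J. w A) * (\<Prod>A\<in>B - J. w A))"
    proof (rule sum.cong[OF refl])
      fix B assume "B \<in> ?S"
      then have "J \<subseteq> B" "finite B" using F finite_subset by auto
      then show "(\<Prod>A\<in>B. w A) = (\<Prod>A\<in>J. w A) * (\<Prod>A\<in>B - J. w A)"
        by (metis prod.subset_diff mult.commute)
    qed
    also have "\<dots> = (\<Prod>A\<in>J. w A) * (\<Sum>B\<in>?S. \<Prod>A\<in>B - J. w A)" by (simp add: sum_distrib_left)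
    also have "\<dots> \<le> (\<Prod>A\<in>J. w A) * esym F w (k - j)"
    proof (intro mult_left_mono prod_nonneg)
      have inj: "inj_on (\<lambda>B. B - J) ?S" by (auto simp: inj_on_def)
      have "(\<Sum>B\<in>?S. \<Prod>A\<in>B - J. w A) = (\<Sum>B\<in>(\<lambda>B. B - J) ` ?S. \<Prod>A\<in>B. w A)"
        unfolding sum.reindex[OF inj] o_def ..
      also have "\<dots> \<le> esym F w (k - j)" unfolding esym_def
      proof (rule sum_mono2)
        show "(\<lambda>B. B - J) ` ?S \<subseteq> {B. B \<subseteq> F \<and> card B = k - j}"
          using J fJ by (auto simp: card_Diff_subset)
      qed (use F w in \<open>auto intro: prod_nonneg\<close>)
      finally show "(\<Sum>B\<in>?S. \<Prod>A\<in>B - J. w A) \<le> esym F w (k - j)" .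
    qed (use w in auto)
    finally show "(\<Sum>B\<in>?Bs. if J \<subseteq> B then \<Prod>A\<in>B. w A else 0) \<le> (\<Prod>A\<in>J. w A) * esym F w (k - j)" .
  qed
  also have "\<dots> = isum F w j * esym F w (k - j)" by (simp add: isum_def sum_distrib_right)
  finally show ?thesis .
qed

text \<open>An intersecting j-set contains d members whose closest point v lies in all the others.
  Recording these d members and the other j - d is injective; the former contribute at most W^d, and
  the latter are chosen among sets containing v, whose weight is at most \<mu>.\<close>

lemma isum_upper:
  fixes F :: "'a::euclidean_space set set"
  assumes F: "finite F" "\<forall>A\<in>F. compact A \<and> convex A" and w: "\<And>A. w A \<ge> 0" and j: "DIM('a) \<le> j"
    and \<mu>: "\<And>x. (\<Sum>A | A \<in> F \<and> x \<in> A. w A) \<le> \<mu>"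
  shows "isum F w j \<le> sum w F ^ DIM('a) * \<mu> ^ (j - DIM('a))"
proof -
  let ?d = "DIM('a)"
  let ?Js = "{J. J \<subseteq> F \<and> card J = j \<and> \<Inter>J \<noteq> {}}"
  have finJ: "finite ?Js" using F(1) by simp
  define v where "v \<D> = closest_point (\<Inter>\<D>) (0::'a)" for \<D>
  have d1: "?d \<ge> 1" using DIM_positive[where 'a = 'a] by simp
  have "\<exists>\<D>\<subseteq>J. card \<D> = ?d \<and> (\<forall>A\<in>J. v \<D> \<in> A)" if J: "J \<in> ?Js" for J
  proof -
    have fJ: "finite J" "J \<subseteq> F" "card J = j" "\<Inter>J \<noteq> {}" using J F(1) finite_subset by auto
    have cJ: "\<forall>A\<in>J. compact A \<and> convex A" using F(2) fJ(2) by blast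
    have Jne: "J \<noteq> {}" using fJ(3) j d1 by auto
    have dJ: "?d \<le> card J" using fJ(3) j by simp
    obtain \<D> where D: "\<D> \<subseteq> J" "card \<D> = ?d" "v \<D> = v J"
      using closest_point_Inter_determined[OF fJ(1) cJ fJ(4) dJ] unfolding v_def by blast
    have "v J \<in> \<Inter>J" unfolding v_def
      using closest_point_in_set[OF compact_imp_closed[OF compact_Inter_family(1)[OF cJ Jne]] fJ(4)] .
    then show ?thesis using D by auto
  qed
  then have "\<forall>J\<in>?Js. \<exists>\<D>. \<D> \<subseteq> J \<and> card \<D> = ?d \<and> (\<forall>A\<in>J. v \<D> \<in> A)" by blast
  then obtain \<delta> where \<delta>: "\<forall>J\<in>?Js. \<delta> J \<subseteq> J \<and> card (\<delta> J) = ?d \<and> (\<forall>A\<in>J. v (\<delta> J) \<in> A)"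
    by (rule bchoice[THEN exE])
  define f where "f J = (\<delta> J, J - \<delta> J)" for J
  define Sg where "Sg = (SIGMA \<D>:{\<D>. \<D> \<subseteq> F \<and> card \<D> = ?d}. {E. E \<subseteq> {A \<in> F. v \<D> \<in> A} \<and> card E = j - ?d})"
  have inj: "inj_on f ?Js"
  proof (rule inj_onI)
    fix J J' assume J: "J \<in> ?Js" "J' \<in> ?Js" "f J = f J'"
    have "J = \<delta> J \<union> (J - \<delta> J)" "J' = \<delta> J' \<union> (J' - \<delta> J')" using \<delta> J(1,2) by blast+
    then show "J = J'" using J(3) unfolding f_def prod.inject by metis
  qed
  have fin: "finite J" if "J \<in> ?Js" for J using that F(1) finite_subset by auto
  have img: "f ` ?Js \<subseteq> Sg"
  proof
    fix y assume "y \<in> f ` ?Js"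
    then obtain J where J: "J \<in> ?Js" "y = f J" by blast
    have D: "\<delta> J \<subseteq> J" "card (\<delta> J) = ?d" "\<forall>A\<in>J. v (\<delta> J) \<in> A" using \<delta> J(1) by blast+
    have JF: "J \<subseteq> F" "card J = j" using J(1) by auto
    have "card (J - \<delta> J) = j - ?d" using D JF fin[OF J(1)] by (simp add: card_Diff_subset finite_subset)
    then show "y \<in> Sg" using D JF unfolding J(2) f_def Sg_def by auto
  qed
  have finSg: "finite Sg" unfolding Sg_def using F(1) by (intro finite_SigmaI) auto
  have "isum F w j = (\<Sum>J\<in>?Js. (\<Prod>A\<in>fst (f J). w A) * (\<Prod>A\<in>snd (f J). w A))"
    unfolding isum_def
  proof (rule sum.cong[OF refl])
    fix J assume J: "J \<in> ?Js"
    have "\<delta> J \<subseteq> J" using \<delta> J by blast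
    then show "(\<Prod>A\<in>J. w A) = (\<Prod>A\<in>fst (f J). w A) * (\<Prod>A\<in>snd (f J). w A)"
      unfolding f_def fst_conv snd_conv using fin[OF J] by (metis prod.subset_diff mult.commute)
  qed
  also have "\<dots> = (\<Sum>y\<in>f ` ?Js. (\<Prod>A\<in>fst y. w A) * (\<Prod>A\<in>snd y. w A))"
    by (simp only: sum.reindex[OF inj] o_def)
  also have "\<dots> \<le> (\<Sum>y\<in>Sg. (\<Prod>A\<in>fst y. w A) * (\<Prod>A\<in>snd y. w A))"
    by (rule sum_mono2[OF finSg img]) (auto intro!: mult_nonneg_nonneg prod_nonneg w)
  also have "\<dots> = (\<Sum>(\<D>, E)\<in>Sg. (\<Prod>A\<in>\<D>. w A) * (\<Prod>A\<in>E. w A))" by (simp add: case_prod_unfold)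
  also have "\<dots> = (\<Sum>\<D> | \<D> \<subseteq> F \<and> card \<D> = ?d. \<Sum>E | E \<subseteq> {A \<in> F. v \<D> \<in> A} \<and> card E = j - ?d. (\<Prod>A\<in>\<D>. w A) * (\<Prod>A\<in>E. w A))"
    unfolding Sg_def using F(1) by (intro sum.Sigma[symmetric]) auto
  also have "\<dots> = (\<Sum>\<D> | \<D> \<subseteq> F \<and> card \<D> = ?d. (\<Prod>A\<in>\<D>. w A) * esym {A \<in> F. v \<D> \<in> A} w (j - ?d))"
    by (simp add: esym_def sum_distrib_left)
  also have "\<dots> \<le> (\<Sum>\<D> | \<D> \<subseteq> F \<and> card \<D> = ?d. (\<Prod>A\<in>\<D>. w A) * \<mu> ^ (j - ?d))"
  proof (intro sum_mono mult_left_mono prod_nonneg)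
    fix \<D>
    have "esym {A \<in> F. v \<D> \<in> A} w (j - ?d) \<le> sum w {A \<in> F. v \<D> \<in> A} ^ (j - ?d)"
      using F(1) w by (intro esym_le_power) auto
    also have "\<dots> \<le> \<mu> ^ (j - ?d)" using \<mu>[of "v \<D>"] w by (intro power_mono sum_nonneg) auto
    finally show "esym {A \<in> F. v \<D> \<in> A} w (j - ?d) \<le> \<mu> ^ (j - ?d)" .
  qed (use w in auto)
  also have "\<dots> = esym F w ?d * \<mu> ^ (j - ?d)" by (simp add: esym_def sum_distrib_right)
  also have "\<dots> \<le> sum w F ^ ?d * \<mu> ^ (j - ?d)"
  proof (intro mult_right_mono esym_le_power F(1) w zero_le_power)
    have "0 \<le> (\<Sum>A | A \<in> F \<and> (0::'a) \<in> A. w A)" by (intro sum_nonneg w)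
    then show "0 \<le> \<mu>" using \<mu>[of 0] by linarith
  qed
  finally show ?thesis .
qed

text \<open>Comparing both estimates of \<open>isum\<close> gives (r W / (2 j k))^j \<le> W^d
  \<mu>^(j-d) for the maximal weight \<mu> at a point; solving for \<mu> yields the exponent j / (j
  - d).\<close>

theorem weighted_fractional_Helly:
  fixes F :: "'a::euclidean_space set set"
  assumes F: "finite F" "\<forall>A\<in>F. compact A \<and> convex A" and w: "\<And>A. w A \<ge> 0" "\<And>A. w A \<le> 1"
    and pq: "has_pq k r F" and W: "sum w F \<ge> 2 * real k" and j: "DIM('a) < j" "j \<le> r" "r \<le> k"
  obtains x where "(\<Sum>A | A \<in> F \<and> x \<in> A. w A) \<ge> (real r / (2 * real j * real k)) powr (real j / real (j - DIM('a))) * sum w F"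
proof -
  let ?d = "DIM('a)"
  define mass where "mass x = (\<Sum>A | A \<in> F \<and> x \<in> A. w A)" for x
  \<comment> \<open>Only finitely many values occur, so the maximal weight is attained.\<close>
  have "range mass \<subseteq> sum w ` Pow F" by (auto simp: mass_def)
  then have finr: "finite (range mass)" using F(1) finite_subset by blast
  have "Max (range mass) \<in> range mass" using finr by (intro Max_in) auto
  then obtain x where x: "mass x = Max (range mass)" by auto
  have max: "mass y \<le> mass x" for y unfolding x using finr by (intro Max_ge) auto
  define W' where "W' = sum w F"
  have k1: "k \<ge> 1" "r \<ge> 1" "j \<ge> 1" using j by auto
  have W0: "W' > 0" using W k1 by (simp add: W'_def)
  have m0: "mass x \<ge> 0" unfolding mass_def by (intro sum_nonneg w)
  have pos: "esym F w (k - j) > 0"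
  proof -
    have "esym F w (0 + (k - j)) \<ge> (sum w F / (2 * real k)) ^ (k - j) * esym F w 0"
      by (rule esym_ratio_power[OF F(1) w W]) simp
    moreover have "(sum w F / (2 * real k)) ^ (k - j) > 0" using W0 k1 by (simp add: W'_def)
    ultimately show ?thesis using esym_0[OF F(1), of w] by simp
  qed
  have "esym F w ((k - j) + j) \<ge> (sum w F / (2 * real k)) ^ j * esym F w (k - j)"
    using j by (intro esym_ratio_power[OF F(1) w W]) simp
  then have "real (r choose j) * ((W' / (2 * real k)) ^ j * esym F w (k - j)) \<le> real (r choose j) * esym F w k"
    using j by (intro mult_left_mono) (auto simp: W'_def)
  also have "\<dots> \<le> isum F w j * esym F w (k - j)" using j by (intro isum_lower F(1) w pq) auto
  finally have "real (r choose j) * (W' / (2 * real k)) ^ j \<le> isum F w j" using pos by simp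
  also have "\<dots> \<le> W' ^ ?d * mass x ^ (j - ?d)"
    unfolding W'_def by (rule isum_upper[OF F w(1)]) (use j max in \<open>auto simp: mass_def\<close>)
  finally have main: "real (r choose j) * (W' / (2 * real k)) ^ j \<le> W' ^ ?d * mass x ^ (j - ?d)" .
  define \<theta> where "\<theta> = (real r / (2 * real j * real k)) powr (real j / real (j - ?d))"
  have base: "real r / (2 * real j * real k) > 0" using k1 by simp
  have th: "\<theta> ^ (j - ?d) = (real r / (2 * real j * real k)) ^ j"
  proof -
    have "\<theta> ^ (j - ?d) = \<theta> powr real (j - ?d)" by (rule powr_realpow[symmetric]) (use k1 in \<open>simp add: \<theta>_def\<close>)
    also have "\<dots> = (real r / (2 * real j * real k)) powr real j" unfolding \<theta>_def powr_powr using j by simp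
    finally show ?thesis using base by (simp add: powr_realpow)
  qed
  have "(\<theta> * W') ^ (j - ?d) * W' ^ ?d = (real r / real j) ^ j * (W' / (2 * real k)) ^ j"
  proof -
    have "(\<theta> * W') ^ (j - ?d) * W' ^ ?d = \<theta> ^ (j - ?d) * (W' ^ (j - ?d) * W' ^ ?d)" by (simp add: power_mult_distrib)
    also have "W' ^ (j - ?d) * W' ^ ?d = W' ^ j" using j by (simp flip: power_add)
    also have "\<theta> ^ (j - ?d) * W' ^ j = (real r / (2 * real j * real k) * W') ^ j" unfolding th power_mult_distrib ..
    also have "real r / (2 * real j * real k) * W' = (real r / real j) * (W' / (2 * real k))" by simp
    finally show ?thesis by (simp only: power_mult_distrib)
  qed
  also have "\<dots> \<le> real (r choose j) * (W' / (2 * real k)) ^ j"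
    using binomial_ge_n_over_k_pow_k[of j r, where 'a = real] j W0 by (intro mult_right_mono) auto
  also have "\<dots> \<le> mass x ^ (j - ?d) * W' ^ ?d" using main by (simp add: mult.commute)
  finally have "(\<theta> * W') ^ (j - ?d) \<le> mass x ^ (j - ?d)" using W0 by simp
  then have "\<theta> * W' \<le> mass x" using m0 j by (simp add: power_mono_iff[OF _ m0] \<theta>_def W0 less_imp_le)
  then show ?thesis using that[of x] by (simp add: mass_def \<theta>_def W'_def)
qed

section \<open>From fractional Helly to a multiset of points that hits most members often\<close>

definition frequency :: "(nat \<Rightarrow> 'a) \<Rightarrow> nat \<Rightarrow> 'a set \<Rightarrow> real" where
  "frequency x T A = real (card {i\<in>{..<T}. x i \<in> A}) / real T"

lemma frequency_Suc:
  "frequency (x(T := p)) (Suc T) A = frequency x T A + (of_bool (p \<in> A) - frequency x T A) / real (Suc T)"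
proof -
  have "{i\<in>{..<Suc T}. (x(T := p)) i \<in> A} = {i\<in>{..<T}. x i \<in> A} \<union> (if p \<in> A then {T} else {})"
    by (auto simp: less_Suc_eq)
  then have "card {i\<in>{..<Suc T}. (x(T := p)) i \<in> A} = card {i\<in>{..<T}. x i \<in> A} + (if p \<in> A then 1 else 0)"
    by simp
  then have eq: "frequency (x(T := p)) (Suc T) A = (real (card {i\<in>{..<T}. x i \<in> A}) + of_bool (p \<in> A)) / (real T + 1)"
    by (simp add: frequency_def add.commute)
  have alg: "(c + b) / (t + 1) = c / t + (b - c / t) / (t + 1)" if "t > 0" for b c t :: real
  proof -
    have "c / t = (c / t) * (t + 1) / (t + 1)" using that by simp
    also have "\<dots> = (c + c / t) / (t + 1)" using that by (simp add: distrib_left)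
    finally have "c / t + (b - c / t) / (t + 1) = (c + c / t + (b - c / t)) / (t + 1)"
      by (simp only: add_divide_distrib)
    then show ?thesis by simp
  qed
  show ?thesis
  proof (cases "T = 0")
    \<comment> \<open>Division by zero makes the frequency 0 for T = 0, so that the update rule
      holds from the first point on.\<close>
    case True
    then show ?thesis unfolding eq by (simp add: frequency_def)
  next
    case False
    then show ?thesis unfolding eq
      using alg[of "real T" "real (card {i\<in>{..<T}. x i \<in> A})" "of_bool (p \<in> A)"]
      by (simp only: frequency_def of_nat_Suc add.commute[of 1 "real T"])
  qed
qed

lemma frequency_bounds: "0 \<le> frequency x T A" "frequency x T A \<le> 1"
proof -
  have "card {i\<in>{..<T}. x i \<in> A} \<le> card {..<T}" by (intro card_mono) auto
  then show "frequency x T A \<le> 1" by (simp add: frequency_def divide_le_eq)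
qed (simp add: frequency_def)

lemma sum_inverse_squares: "n \<ge> 1 \<Longrightarrow> (\<Sum>i<n. 1 / (real (Suc i))\<^sup>2) \<le> 2 - 1 / real n"
proof (induction n rule: nat_induct_at_least)
  case (Suc n)
  have n: "real n > 0" using Suc by simp
  have "1 / (real (Suc n))\<^sup>2 \<le> 1 / (real n * real (Suc n))"
    using n by (intro divide_left_mono) (auto simp: power2_eq_square)
  also have "\<dots> = 1 / real n - 1 / real (Suc n)" using n by (simp add: field_simps)
  finally show ?case using Suc.IH by simp
qed simp

text \<open>Adding one point at a time is a gradient descent with step sizes 1/T for the squared deficits;
  the steps have a divergent sum, so the descent cannot go on forever.\<close>
lemma frequent_points:
  fixes F :: "'a set set"
  assumes F: "finite F" and \<beta>: "\<beta> > 0" and k: "k \<ge> 1"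
    and rich: "\<And>w. (\<And>A. 0 \<le> w A) \<Longrightarrow> (\<And>A. w A \<le> 1) \<Longrightarrow> 2 * real k \<le> sum w F \<Longrightarrow>
      \<exists>p. 3 * \<beta> * sum w F \<le> (\<Sum>A | A \<in> F \<and> p \<in> A. w A)"
  shows "\<exists>x T. card {A\<in>F. frequency x T A < \<beta>} < 4 * k"
proof (rule ccontr)
  assume neg: "\<not> ?thesis"
  \<comment> \<open>The deficit is measured from 2 \<beta> although only frequencies below \<beta>
    are bad: a bad set then has weight at least 1/2 after scaling, so 4 k bad sets provide the total
    weight 2 k that \<open>rich\<close> asks for.\<close>
  define m where "m u = max 0 (2 * \<beta> - u)" for u :: real
  define \<Psi> where "\<Psi> x T = (\<Sum>A\<in>F. (m (frequency x T A))\<^sup>2)" for x T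
  define a where "a = 8 * \<beta>\<^sup>2 * real k"
  \<comment> \<open>Truncating the deficit at 0 can only help, so it may be replaced by a linear
    change inside the square.\<close>
  have m_step: "(m (u + h))\<^sup>2 \<le> (m u - h)\<^sup>2" for u h
  proof (cases "m (u + h) = 0")
    case False
    then have "m (u + h) = 2 * \<beta> - u - h" "m (u + h) \<ge> 0" by (auto simp: m_def max_def split: if_splits)
    moreover have "m u \<ge> 2 * \<beta> - u" by (simp add: m_def)
    ultimately show ?thesis by (intro power_mono) linarith+
  qed simp
  have step: "\<exists>p. \<Psi> (x(T := p)) (Suc T) \<le> \<Psi> x T - a / real (Suc T) + real (card F) / (real (Suc T))\<^sup>2" for x :: "nat \<Rightarrow> 'a" and T
  proof -
    define u where "u A = frequency x T A" for A
    define w where "w A = m (u A) / (2 * \<beta>)" for A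
    define t where "t = 1 / real (Suc T)"
    have t: "t > 0" by (simp add: t_def)
    have u: "0 \<le> u A" "u A \<le> 1" for A using frequency_bounds by (auto simp: u_def)
    have mw: "m (u A) = 2 * \<beta> * w A" for A using \<beta> by (simp add: w_def)
    have w: "0 \<le> w A" "w A \<le> 1" for A
      using \<beta> u[of A] by (auto simp: w_def m_def divide_le_eq)
    define E where "E = {A\<in>F. u A < \<beta>}"
    have "card E \<ge> 4 * k" using neg by (auto simp: E_def u_def not_less)
    then have "2 * real k \<le> (\<Sum>A\<in>E. 1/2)" by simp
    also have "\<dots> \<le> (\<Sum>A\<in>E. w A)"
      using \<beta> by (intro sum_mono) (auto simp: E_def w_def m_def field_simps max_def)
    also have "\<dots> \<le> sum w F" using F w by (intro sum_mono2) (auto simp: E_def)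
    finally have W: "2 * real k \<le> sum w F" .
    obtain p where p: "3 * \<beta> * sum w F \<le> (\<Sum>A | A \<in> F \<and> p \<in> A. w A)" using rich[of w, OF w W] by blast
    define h where "h A = t * (of_bool (p \<in> A) - u A)" for A
    have "\<Psi> (x(T := p)) (Suc T) = (\<Sum>A\<in>F. (m (u A + h A))\<^sup>2)"
      unfolding \<Psi>_def frequency_Suc u_def[symmetric] h_def t_def by simp
    also have "\<dots> \<le> (\<Sum>A\<in>F. (m (u A) - h A)\<^sup>2)" by (intro sum_mono m_step)
    also have "\<dots> = \<Psi> x T - 2 * (\<Sum>A\<in>F. m (u A) * h A) + (\<Sum>A\<in>F. (h A)\<^sup>2)"
      by (simp add: power2_diff sum.distrib sum_subtractf \<Psi>_def u_def sum_distrib_left algebra_simps)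
    also have "\<dots> \<le> \<Psi> x T - a * t + real (card F) * t\<^sup>2"
    proof -
      have "(\<Sum>A\<in>F. (h A)\<^sup>2) \<le> (\<Sum>A\<in>F. t\<^sup>2)"
      proof (rule sum_mono)
        fix A
        have "\<bar>of_bool (p \<in> A) - u A\<bar> \<le> 1" using u[of A] by (auto simp: of_bool_def)
        then have "\<bar>h A\<bar> \<le> t" using t by (simp add: h_def abs_mult)
        then show "(h A)\<^sup>2 \<le> t\<^sup>2" using t abs_le_square_iff[of "h A" t] by simp
      qed
      moreover have "(\<Sum>A\<in>F. m (u A) * h A) = t * ((\<Sum>A\<in>F. m (u A) * of_bool (p \<in> A)) - (\<Sum>A\<in>F. m (u A) * u A))"
        by (simp add: h_def sum_distrib_left sum_subtractf[symmetric] algebra_simps)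
      moreover have "(\<Sum>A\<in>F. m (u A) * of_bool (p \<in> A)) \<ge> 2 * \<beta> * (3 * \<beta> * sum w F)"
      proof -
        have "(\<Sum>A\<in>F. m (u A) * of_bool (p \<in> A)) = 2 * \<beta> * (\<Sum>A\<in>F. if p \<in> A then w A else 0)"
          by (auto simp: mw sum_distrib_left intro!: sum.cong)
        also have "(\<Sum>A\<in>F. if p \<in> A then w A else 0) = (\<Sum>A | A \<in> F \<and> p \<in> A. w A)"
          by (rule sum.inter_filter[OF F, symmetric])
        finally show ?thesis using p \<beta> by simp
      qed
      moreover have "(\<Sum>A\<in>F. m (u A) * u A) \<le> 2 * \<beta> * (2 * \<beta> * sum w F)"
      proof -
        have "(\<Sum>A\<in>F. m (u A) * u A) \<le> (\<Sum>A\<in>F. m (u A) * (2 * \<beta>))"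
        proof (rule sum_mono)
          fix A show "m (u A) * u A \<le> m (u A) * (2 * \<beta>)"
            by (cases "u A \<le> 2 * \<beta>") (auto simp: m_def intro!: mult_left_mono)
        qed
        also have "\<dots> = (\<Sum>A\<in>F. 2 * \<beta> * (2 * \<beta> * w A))" by (simp add: mw mult_ac)
        also have "\<dots> = 2 * \<beta> * (2 * \<beta> * sum w F)" by (simp only: sum_distrib_left)
        finally show ?thesis .
      qed
      \<comment> \<open>The new point collects 3 \<beta> of the weight, while the current
        frequencies account for at most 2 \<beta>; the gap, together with total weight at least 2 k,
        gives the gain a = 8 \<beta>^2 k per unit of step size.\<close>
      moreover have "2 * (t * (2 * \<beta> * (3 * \<beta> * sum w F) - 2 * \<beta> * (2 * \<beta> * sum w F))) \<ge> a * t"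
      proof -
        have "2 * (t * (2 * \<beta> * (3 * \<beta> * sum w F) - 2 * \<beta> * (2 * \<beta> * sum w F))) = (4 * \<beta>\<^sup>2 * t) * sum w F"
          by (simp add: power2_eq_square algebra_simps)
        also have "\<dots> \<ge> (4 * \<beta>\<^sup>2 * t) * (2 * real k)" using W t by (intro mult_left_mono) auto
        finally show ?thesis by (simp add: a_def mult_ac)
      qed
      moreover have "t * ((\<Sum>A\<in>F. m (u A) * of_bool (p \<in> A)) - (\<Sum>A\<in>F. m (u A) * u A)) \<ge>
          t * (2 * \<beta> * (3 * \<beta> * sum w F) - 2 * \<beta> * (2 * \<beta> * sum w F))"
        using t calculation(3,4) by (intro mult_left_mono) auto
      ultimately show ?thesis by simp
    qed
    finally show ?thesis by (intro exI[of _ p]) (simp add: t_def power_one_over)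
  qed
  have bound: "\<exists>x. \<Psi> x T \<le> 4 * \<beta>\<^sup>2 * real (card F) - a * (\<Sum>i<T. 1 / real (Suc i)) + real (card F) * (\<Sum>i<T. 1 / (real (Suc i))\<^sup>2)" for T
  proof (induction T)
    case 0
    have "\<Psi> (\<lambda>_. undefined) 0 = 4 * \<beta>\<^sup>2 * real (card F)"
      using \<beta> by (simp add: \<Psi>_def frequency_def m_def power2_eq_square)
    then show ?case by (intro exI[of _ "\<lambda>_. undefined"]) simp
  next
    case (Suc T)
    then obtain x where x: "\<Psi> x T \<le> 4 * \<beta>\<^sup>2 * real (card F) - a * (\<Sum>i<T. 1 / real (Suc i)) + real (card F) * (\<Sum>i<T. 1 / (real (Suc i))\<^sup>2)" by blast
    obtain p where "\<Psi> (x(T := p)) (Suc T) \<le> \<Psi> x T - a / real (Suc T) + real (card F) / (real (Suc T))\<^sup>2" using step by blast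
    then show ?case using x by (intro exI[of _ "x(T := p)"]) (simp add: distrib_left del: fun_upd_apply)
  qed
  have a0: "a > 0" using \<beta> k by (simp add: a_def)
  \<comment> \<open>Once the harmonic sum exceeds c, the gain outweighs the initial potential 4
    \<beta>^2 |F| and the second-order errors, whose sum is at most 2 |F|.\<close>
  define c where "c = (4 * \<beta>\<^sup>2 * real (card F) + 2 * real (card F)) / a"
  have "\<forall>\<^sub>F n in sequentially. harm n > c" using harm_at_top by (simp add: filterlim_at_top_dense)
  moreover have "\<forall>\<^sub>F n::nat in sequentially. n \<ge> 1" by (rule eventually_ge_at_top)
  ultimately have "\<forall>\<^sub>F n in sequentially. harm n > c \<and> n \<ge> 1" by (rule eventually_conj)
  then obtain T where T: "harm T > c" "T \<ge> 1" by (auto simp: eventually_sequentially)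
  have hT: "(\<Sum>i<T. 1 / real (Suc i)) = harm T"
    by (induction T) (auto simp: harm_Suc inverse_eq_divide harm_expand)
  obtain x where x: "\<Psi> x T \<le> 4 * \<beta>\<^sup>2 * real (card F) - a * harm T + real (card F) * (\<Sum>i<T. 1 / (real (Suc i))\<^sup>2)"
    using bound[of T] hT by auto
  have "(\<Sum>i<T. 1 / (real (Suc i))\<^sup>2) \<le> 2"
    using sum_inverse_squares[OF T(2)] by (smt (verit) divide_nonneg_nonneg of_nat_0_le_iff)
  then have "real (card F) * (\<Sum>i<T. 1 / (real (Suc i))\<^sup>2) \<le> real (card F) * 2" by (rule mult_left_mono) simp
  moreover have "a * harm T > 4 * \<beta>\<^sup>2 * real (card F) + 2 * real (card F)"
    using T(1) a0 by (simp add: c_def divide_less_eq mult.commute)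
  ultimately have "\<Psi> x T < 0" using x by linarith
  moreover have "\<Psi> x T \<ge> 0" by (simp add: \<Psi>_def sum_nonneg)
  ultimately show False by simp
qed

lemma pierced_card:
  assumes "finite F" "\<forall>A\<in>F. A \<noteq> {}" shows "pierced (card F) F"
proof -
  define f where "f A = (SOME a. a \<in> A)" for A :: "'a set"
  have f: "f A \<in> A" if "A \<in> F" for A using assms(2) that unfolding f_def by (simp add: some_in_eq)
  then show ?thesis unfolding pierced_def transversal_def using assms(1) card_image_le[OF assms(1), of f]
    by (intro exI[of _ "f ` F"]) auto
qed

text \<open>Fewer than 4 k members are hit rarely by the points of \<open>frequent_points\<close>
  and are pierced one by one; a weak net for these points pierces all others.\<close>

theorem pierced_by_weak_net:
  fixes \<eta> :: real
  assumes \<eta>: "\<eta> > 0" and d2: "DIM('a::euclidean_space) \<ge> 2"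
  shows "\<exists>C>0. \<exists>j\<ge>1. \<forall>k r (F :: 'a set set). j \<le> r \<and> r \<le> k \<and> finite F \<and> (\<forall>A\<in>F. compact A \<and> convex A \<and> A \<noteq> {}) \<and> has_pq k r F \<longrightarrow>
    (\<exists>s. real s \<le> 4 * real k + C * (real k / real r) powr (real DIM('a) + \<eta>) \<and> pierced s F)"
proof -
  let ?d = "DIM('a)"
  define D where "D = real ?d + \<eta>"
  \<comment> \<open>The exponents of the net and of fractional Helly multiply; j is chosen so large
    that \<open>D1\<close> times j / (j - d) is still at most \<open>D\<close>.\<close>
  define D1 where "D1 = real ?d + \<eta> / 2"
  have "\<forall>\<^sub>F j::nat in at_top. D1 * (real j / (real j - real ?d)) \<le> D \<and> j > ?d"
  proof (rule eventually_conj)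
    have "D1 < D" using \<eta> by (simp add: D1_def D_def)
    moreover have "((\<lambda>j::nat. D1 * (real j / (real j - real ?d))) \<longlongrightarrow> D1) at_top" by real_asymp
    ultimately have "\<forall>\<^sub>F j::nat in at_top. D1 * (real j / (real j - real ?d)) < D" by (rule order_tendstoD(2)[rotated])
    then show "\<forall>\<^sub>F j::nat in at_top. D1 * (real j / (real j - real ?d)) \<le> D" by eventually_elim simp
  qed (rule eventually_gt_at_top)
  then obtain j where j: "D1 * (real j / (real j - real ?d)) \<le> D" "j > ?d" unfolding eventually_at_top_linorder by blast
  define e where "e = real j / real (j - ?d)"
  have e: "D1 * e \<le> D" "e > 0" using j by (auto simp: e_def of_nat_diff)
  obtain C0 where C0: "C0 > 0" and net: "\<forall>\<epsilon> N (x :: nat \<Rightarrow> 'a). 0 < \<epsilon> \<and> \<epsilon> \<le> 1 \<and> finite N \<and> N \<noteq> {} \<longrightarrow>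
     (\<exists>Z. finite Z \<and> real (card Z) \<le> C0 * (1 / \<epsilon>) powr D1 \<and>
       (\<forall>K. convex K \<and> real (card {i\<in>N. x i \<in> K}) \<ge> \<epsilon> * real (card N) \<longrightarrow> K \<inter> Z \<noteq> {}))"
    using weak_net[where 'a = 'a, of "\<eta> / 2"] \<eta> d2 unfolding D1_def by auto
  define C where "C = C0 * 3 powr D1 * (2 * real j) powr D"
  have j0: "real j > 0" using j(2) by simp
  have C: "C > 0" using C0 j0 by (simp add: C_def)
  have main: "\<exists>s. real s \<le> 4 * real k + C * (real k / real r) powr D \<and> pierced s F"
    if jr: "j \<le> r" "r \<le> k" and F: "finite F" "\<forall>A\<in>F. compact A \<and> convex A \<and> A \<noteq> {}" and pq: "has_pq k r F" for k r and F :: "'a set set"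
  proof -
    have F2: "\<forall>A\<in>F. compact A \<and> convex A" using F(2) by blast
    have r1: "r \<ge> 1" "k \<ge> 1" using j(2) jr by auto
    define X where "X = 2 * real j * real k / real r"
    have X1: "X \<ge> 1"
    proof -
      have "real r \<le> 1 * real k" using jr by simp
      also have "\<dots> \<le> (2 * real j) * real k" using j(2) by (intro mult_right_mono) auto
      finally show ?thesis using r1 by (simp add: X_def field_simps)
    qed
    \<comment> \<open>The division by 3 provides the factor 3 in \<open>rich\<close>.\<close>
    define \<beta> where "\<beta> = (1 / X) powr e / 3"
    have \<beta>: "\<beta> > 0" using X1 by (simp add: \<beta>_def)
    have "(1 / X) powr e \<le> 1" using X1 e(2) by (intro powr_le1) auto
    then have \<beta>1: "\<beta> \<le> 1" by (simp add: \<beta>_def)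
    have rX: "real r / (2 * real j * real k) = 1 / X" by (simp add: X_def)
    have rich: "\<exists>p. 3 * \<beta> * sum w F \<le> (\<Sum>A | A \<in> F \<and> p \<in> A. w A)"
      if w: "\<And>A. 0 \<le> w A" "\<And>A. w A \<le> 1" "2 * real k \<le> sum w F" for w :: "'a set \<Rightarrow> real"
    proof -
      obtain p where "(\<Sum>A | A \<in> F \<and> p \<in> A. w A) \<ge> (real r / (2 * real j * real k)) powr (real j / real (j - ?d)) * sum w F"
        using weighted_fractional_Helly[OF F(1) F2 w(1,2) pq w(3) j(2) jr] by blast
      then show ?thesis unfolding rX e_def[symmetric] by (intro exI[of _ p]) (simp add: \<beta>_def)
    qed
    obtain x T where xT: "card {A\<in>F. frequency x T A < \<beta>} < 4 * k"
      using frequent_points[OF F(1) \<beta> r1(2) rich] by blast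
    define E where "E = {A\<in>F. frequency x T A < \<beta>}"
    have EF: "E \<subseteq> F" by (auto simp: E_def)
    have pE: "pierced (4 * k) E"
      by (rule pierced_mono[OF pierced_card[of E]]) (use F EF finite_subset xT in \<open>auto simp: E_def\<close>)
    show ?thesis
    proof (cases "T = 0")
      \<comment> \<open>Without points all frequencies are 0 < \<beta>, so every member is among the
        fewer than 4 k exceptional ones.\<close>
      case True
      then have "E = F" using \<beta> by (auto simp: E_def frequency_def)
      then show ?thesis using pE C by (intro exI[of _ "4 * k"]) simp
    next
      case False
      then have N: "finite {..<T}" "{..<T} \<noteq> {}" by auto
      obtain Z where Z: "finite Z" "real (card Z) \<le> C0 * (1 / \<beta>) powr D1"
         "\<forall>K. convex K \<and> real (card {i\<in>{..<T}. x i \<in> K}) \<ge> \<beta> * real (card {..<T}) \<longrightarrow> K \<inter> Z \<noteq> {}"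
        using net[rule_format, of \<beta> "{..<T}" x] \<beta> \<beta>1 N by blast
      have "transversal Z (F - E)" unfolding transversal_def
      proof
        fix A assume A: "A \<in> F - E"
        then have "frequency x T A \<ge> \<beta>" by (auto simp: E_def)
        then have "real (card {i\<in>{..<T}. x i \<in> A}) \<ge> \<beta> * real (card {..<T})"
          using False by (simp add: frequency_def field_simps)
        moreover have "convex A" using A F2 by blast
        ultimately show "Z \<inter> A \<noteq> {}" using Z(3) by blast
      qed
      then have "pierced (card Z) (F - E)" using Z(1) unfolding pierced_def by blast
      from pierced_Un[OF pE this] have "pierced (4 * k + card Z) F"
        by (rule pierced_mono) auto
      moreover have "real (card Z) \<le> C * (real k / real r) powr D"
      proof -
        have "1 / \<beta> = 3 * X powr e" using X1 by (simp add: \<beta>_def powr_divide)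
        then have "(1 / \<beta>) powr D1 = 3 powr D1 * X powr (e * D1)" using X1 by (simp add: powr_mult powr_powr)
        also have "\<dots> \<le> 3 powr D1 * X powr D" using e(1) X1 by (intro mult_left_mono powr_mono) (auto simp: mult.commute)
        also have "X powr D = (2 * real j) powr D * (real k / real r) powr D"
          unfolding X_def by (subst powr_mult[symmetric]) (auto simp: field_simps)
        finally have "C0 * (1 / \<beta>) powr D1 \<le> C0 * (3 powr D1 * ((2 * real j) powr D * (real k / real r) powr D))"
          using C0 by (intro mult_left_mono) auto
        then show ?thesis using Z(2) by (simp add: C_def mult_ac)
      qed
      ultimately show ?thesis by (intro exI[of _ "4 * k + card Z"]) simp
    qed
  qed
  have j1: "j \<ge> 1" using j(2) by simp
  show ?thesis unfolding D_def[symmetric]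
  proof (rule exI[of _ C], rule conjI[OF C], rule exI[of _ j], rule conjI[OF j1], intro allI impI)
    fix k r and F :: "'a set set"
    assume "j \<le> r \<and> r \<le> k \<and> finite F \<and> (\<forall>A\<in>F. compact A \<and> convex A \<and> A \<noteq> {}) \<and> has_pq k r F"
    then show "\<exists>s. real s \<le> 4 * real k + C * (real k / real r) powr D \<and> pierced s F"
      by (elim conjE) (rule main)
  qed
qed

section \<open>Compactness and the lower bound\<close>

text \<open>Piercing by s points amounts to a colouring of F with s colours whose classes have
  common points. The colourings that work on a finite subfamily form a nonempty closed set in a
  product of finite discrete spaces, so by Tychonoff one colouring works on all of them.\<close>

lemma pierced_compactness:
  fixes F :: "'a::euclidean_space set set"
  assumes F: "\<And>A. A \<in> F \<Longrightarrow> compact A"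
    and fin: "\<And>G. finite G \<Longrightarrow> G \<subseteq> F \<Longrightarrow> pierced s G"
  shows "pierced s F"
proof -
  define X where "X = product_topology (\<lambda>_::'a set. discrete_topology {..<s}) F"
  have comp: "compact_space X"
    unfolding X_def compact_space_product_topology by (simp add: compact_space_discrete_topology)
  define good where "good G = {c \<in> topspace X. \<forall>i<s. {A\<in>G. c A = i} \<noteq> {} \<longrightarrow> \<Inter>{A\<in>G. c A = i} \<noteq> {}}" for G
  have topX: "topspace X = PiE F (\<lambda>_. {..<s})" by (simp add: X_def)
  have anti: "good G' \<subseteq> good G" if "G \<subseteq> G'" for G G'
  proof
    fix c assume c: "c \<in> good G'"
    show "c \<in> good G" unfolding good_def
    proof (intro CollectI conjI allI impI)
      show "c \<in> topspace X" using c by (simp add: good_def)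
      fix i assume i: "i < s" "{A\<in>G. c A = i} \<noteq> {}"
      have sub: "{A\<in>G. c A = i} \<subseteq> {A\<in>G'. c A = i}" using that by blast
      then have "{A\<in>G'. c A = i} \<noteq> {}" using i(2) by (metis subset_empty)
      then have "\<Inter>{A\<in>G'. c A = i} \<noteq> {}" using c i(1) by (simp add: good_def)
      then show "\<Inter>{A\<in>G. c A = i} \<noteq> {}" using Inter_anti_mono[OF sub] by (metis subset_empty)
    qed
  qed
  have nonempty: "good G \<noteq> {}" if G: "finite G" "G \<subseteq> F" for G
  proof -
    obtain T where T: "finite T" "card T \<le> s" "transversal T G" using fin[OF G] by (auto simp: pierced_def)
    obtain f where f: "bij_betw f T {..<card T}" using T(1) ex_bij_betw_finite_nat by (metis atLeast0LessThan)
    define \<tau> where "\<tau> A = (SOME p. p \<in> T \<and> p \<in> A)" for A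
    have \<tau>: "\<tau> A \<in> T" "\<tau> A \<in> A" if A: "A \<in> G" for A
    proof -
      have "\<exists>p. p \<in> T \<and> p \<in> A" using T(3) A by (auto simp: transversal_def)
      then have "\<tau> A \<in> T \<and> \<tau> A \<in> A" unfolding \<tau>_def by (rule someI_ex)
      then show "\<tau> A \<in> T" "\<tau> A \<in> A" by auto
    qed
    show ?thesis
    proof (cases "s = 0")
      case True
      then have "G = {}" using T \<tau> by auto
      show ?thesis
      proof (cases "F = {}")
        case True
        have "(\<lambda>_. undefined) \<in> good G" using True \<open>G = {}\<close> by (simp add: good_def topX)
        then show ?thesis by blast
      next
        case False
        then obtain A where "A \<in> F" by blast
        then have "pierced 0 {A}" using fin[of "{A}"] True by simp
        then show ?thesis by (auto simp: pierced_def transversal_def)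
      qed
    next
      case False
      define c where "c = (\<lambda>A\<in>F. if A \<in> G then f (\<tau> A) else 0)"
      have fT: "f (\<tau> A) < s" if "A \<in> G" for A
        using bij_betwE[OF f] \<tau>(1)[OF that] T(2) by fastforce
      have "c \<in> topspace X" using False fT by (auto simp: topX c_def)
      moreover have "\<Inter>{A\<in>G. c A = i} \<noteq> {}" if i: "{A\<in>G. c A = i} \<noteq> {}" for i
      proof -
        obtain B where B: "B \<in> G" "c B = i" using i by blast
        have "\<tau> B \<in> A" if A: "A \<in> G" "c A = i" for A
        proof -
          have "A \<in> F" "B \<in> F" using A(1) B(1) G(2) by blast+
          then have "f (\<tau> A) = f (\<tau> B)" using A B by (simp add: c_def)
          then have "\<tau> A = \<tau> B" using f \<tau>(1) A(1) B(1) by (auto simp: bij_betw_def inj_on_def)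
          then show ?thesis using \<tau>(2)[OF A(1)] by simp
        qed
        then show ?thesis by blast
      qed
      ultimately have "c \<in> good G" by (simp add: good_def)
      then show ?thesis by blast
    qed
  qed
  have closed: "closedin X (good G)" if G: "finite G" "G \<subseteq> F" for G
  proof -
    have "openin X {c \<in> topspace X. c \<notin> good G}"
    proof (subst openin_subopen, intro ballI)
      fix c assume c: "c \<in> {c \<in> topspace X. c \<notin> good G}"
      \<comment> \<open>Being good for a finite G depends on finitely many coordinates only, so
        fixing them gives an open neighbourhood.\<close>
      define U where "U = {c' \<in> topspace X. \<forall>A\<in>G. c' A = c A}"
      have "openin X U"
      proof -
        have "U = topspace X \<inter> (\<Inter>A\<in>G. {c' \<in> topspace X. c' A \<in> {c A}})" by (auto simp: U_def)
        moreover have "openin X {c' \<in> topspace X. c' A \<in> {c A}}" if A: "A \<in> G" for A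
        proof (rule openin_continuous_map_preimage)
          show "continuous_map X (discrete_topology {..<s}) (\<lambda>c'. c' A)"
            unfolding X_def using A G(2) by (intro continuous_map_product_projection) blast
          show "openin (discrete_topology {..<s}) {c A}"
            using c A G(2) by (auto simp: topX PiE_iff)
        qed
        ultimately show ?thesis using G(1) by (cases "G = {}") (auto intro!: openin_Int openin_Inter)
      qed
      moreover have "c \<in> U" using c by (auto simp: U_def)
      moreover have "U \<subseteq> {c \<in> topspace X. c \<notin> good G}"
      proof
        fix c' assume c': "c' \<in> U"
        have eq: "{A\<in>G. c' A = i} = {A\<in>G. c A = i}" for i using c' by (auto simp: U_def)
        have top: "c' \<in> topspace X" "c \<in> topspace X" using c c' by (auto simp: U_def)
        have "c' \<in> good G \<longleftrightarrow> c \<in> good G" unfolding good_def by (simp only: mem_Collect_eq eq top)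
        then show "c' \<in> {c \<in> topspace X. c \<notin> good G}" using c c' by (simp add: U_def)
      qed
      ultimately show "\<exists>T. openin X T \<and> c \<in> T \<and> T \<subseteq> {c \<in> topspace X. c \<notin> good G}" by blast
    qed
    moreover have "topspace X - good G = {c \<in> topspace X. c \<notin> good G}" by blast
    moreover have "good G \<subseteq> topspace X" by (auto simp: good_def)
    ultimately show ?thesis by (simp add: closedin_def)
  qed
  have "\<Inter>(good ` {G. finite G \<and> G \<subseteq> F}) \<noteq> {}"
  proof (rule comp[unfolded compact_space_fip, rule_format], intro conjI ballI allI impI)
    fix C assume "C \<in> good ` {G. finite G \<and> G \<subseteq> F}"
    then show "closedin X C" using closed by blast
  next
    fix \<G> assume "finite \<G> \<and> \<G> \<subseteq> good ` {G. finite G \<and> G \<subseteq> F}"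
    then obtain \<H> where H: "finite \<H>" "\<H> \<subseteq> {G. finite G \<and> G \<subseteq> F}" "\<G> = good ` \<H>"
      by (meson finite_subset_image)
    have "finite (\<Union>\<H>)" "\<Union>\<H> \<subseteq> F" using H(1,2) by auto
    then obtain c where "c \<in> good (\<Union>\<H>)" using nonempty by blast
    then have "c \<in> good G" if "G \<in> \<H>" for G using anti[of G "\<Union>\<H>"] that by blast
    then show "\<Inter>\<G> \<noteq> {}" unfolding H(3) by blast
  qed
  then obtain c where c: "\<And>G. finite G \<Longrightarrow> G \<subseteq> F \<Longrightarrow> c \<in> good G" by blast
  have cF: "c A < s" if "A \<in> F" for A
  proof -
    have "c \<in> topspace X" using c[of "{}"] by (simp add: good_def)
    then show ?thesis using that by (auto simp: topX)
  qed
  \<comment> \<open>A colour class may be infinite; its members are compact and any finitely many of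
    them intersect.\<close>
  have meet: "\<Inter>{A\<in>F. c A = i} \<noteq> {}" for i
  proof (rule compact_fip_Heine_Borel)
    show "compact A" if "A \<in> {A\<in>F. c A = i}" for A using F that by blast
    fix \<G> assume G: "finite \<G>" "\<G> \<subseteq> {A\<in>F. c A = i}"
    show "\<Inter>\<G> \<noteq> {}"
    proof (cases "\<G> = {}")
      case False
      have eq: "{A\<in>\<G>. c A = i} = \<G>" using G(2) by blast
      obtain A where "A \<in> \<G>" using False by blast
      then have "i < s" using cF[of A] G(2) by auto
      moreover have "c \<in> good \<G>" using c[OF G(1)] G(2) by blast
      ultimately have "{A\<in>\<G>. c A = i} \<noteq> {} \<longrightarrow> \<Inter>{A\<in>\<G>. c A = i} \<noteq> {}" unfolding good_def by blast
      then show ?thesis unfolding eq using False by blast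
    qed simp
  qed
  define q where "q i = (SOME z. z \<in> \<Inter>{A\<in>F. c A = i})" for i
  have q: "q i \<in> \<Inter>{A\<in>F. c A = i}" for i unfolding q_def using meet[of i] by (rule some_in_eq[THEN iffD2])
  have "transversal (q ` {..<s}) F" unfolding transversal_def
  proof
    fix A assume A: "A \<in> F"
    then have "q (c A) \<in> A" using q[of "c A"] by blast
    then show "q ` {..<s} \<inter> A \<noteq> {}" using cF[OF A] by blast
  qed
  moreover have "card (q ` {..<s}) \<le> s" using card_image_le[of "{..<s}" q] by simp
  ultimately show ?thesis unfolding pierced_def by (intro exI[of _ "q ` {..<s}"]) simp
qed

section \<open>A family that needs p - q + 1 points\<close>

lemma lower_bound_family:
  assumes "1 \<le> q" "q \<le> p"
  obtains F :: "'a::euclidean_space set set" where "\<forall>C\<in>F. compact C \<and> convex C" "pq_property p q F" "\<not> pierced (p - q) F"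
proof -
  obtain e :: 'a where e: "e \<in> Basis" using nonempty_Basis by blast
  have ne: "norm e = 1" using e by simp
  \<comment> \<open>q concentric balls, the largest of radius q, and p - q distinct singletons
    beyond it. The family has exactly p members, so the (p,q)-property only asks for the common
    point of the balls.\<close>
  define B where "B i = cball (0::'a) (real (Suc i))" for i :: nat
  define P where "P i = (real (q + 1 + i)) *\<^sub>R e" for i :: nat
  define G1 where "G1 = B ` {..<q}"
  define G2 where "G2 = (\<lambda>i. {P i}) ` {..<p - q}"
  have injB: "inj_on B {..<q}" by (auto simp: inj_on_def B_def cball_eq_cball_iff)
  have e0: "e \<noteq> 0" using ne by auto
  have injP: "inj P" using e0 by (auto simp: inj_on_def P_def)
  have c1: "card G1 = q" using injB by (simp add: G1_def card_image)
  have c2: "card G2 = p - q" using injP by (subst G2_def, subst card_image) (auto simp: inj_on_def)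
  have Pout: "P i \<notin> cball 0 (real q)" for i using ne by (simp add: P_def)
  have Bin: "B i \<subseteq> cball 0 (real q)" if "i < q" for i using that by (auto simp: B_def)
  have z1: "0 \<in> A" if "A \<in> G1" for A using that by (auto simp: G1_def B_def)
  have z2: "0 \<notin> A" if "A \<in> G2" for A
  proof -
    have "0 \<noteq> P i" for i using Pout[of i] by auto
    then show ?thesis using that by (auto simp: G2_def)
  qed
  have disj: "G1 \<inter> G2 = {}" using z1 z2 by blast
  define F where "F = G1 \<union> G2"
  have fin: "finite G1" "finite G2" by (auto simp: G1_def G2_def)
  have cF: "card F = p" using c1 c2 disj fin assms by (simp add: F_def card_Un_disjoint)
  have i1: "\<Inter>G1 \<noteq> {}" using z1 by blast
  have "pq_property p q F"
    unfolding pq_property_def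
  proof (intro conjI ballI allI impI)
    show "\<exists>G\<subseteq>F. finite G \<and> card G = p" using cF fin by (intro exI[of _ F]) (simp add: F_def)
    show "C \<noteq> {}" if "C \<in> F" for C using that z1 by (auto simp: F_def G2_def)
    fix G assume G: "G \<subseteq> F" "finite G \<and> card G = p"
    have "G = F" using G cF fin by (intro card_subset_eq) (auto simp: F_def)
    then show "\<exists>H\<subseteq>G. card H = q \<and> \<Inter>H \<noteq> {}" using c1 i1 by (intro exI[of _ G1]) (auto simp: F_def)
  qed
  moreover have "\<forall>C\<in>F. compact C \<and> convex C" by (auto simp: F_def G1_def G2_def B_def)
  moreover have "\<not> pierced (p - q) F"
  proof
    assume "pierced (p - q) F"
    then obtain T where T: "finite T" "card T \<le> p - q" "transversal T F" by (auto simp: pierced_def)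
    have "P ` {..<p - q} \<subseteq> T" using T(3) by (auto simp: transversal_def F_def G2_def)
    moreover have "B 0 \<in> F" using assms by (auto simp: F_def G1_def)
    then obtain z where z: "z \<in> T" "z \<in> B 0" using T(3) by (auto simp: transversal_def)
    have "z \<notin> P ` {..<p - q}" using z(2) Bin[of 0] Pout assms by auto
    then have "card (insert z (P ` {..<p - q})) = Suc (p - q)"
      using injP by (simp add: card_image inj_on_def)
    moreover have "insert z (P ` {..<p - q}) \<subseteq> T" using z(1) calculation(1) by blast
    ultimately show False using T(1,2) card_mono[of T "insert z (P ` {..<p - q})"] by simp
  qed
  ultimately show ?thesis using that by blast
qed

section \<open>The upper bound\<close>

text \<open>A bound instead of the exact depth, so that the pieces can be merged by adding their
  bounds.\<close>

definition depth_le :: "'a set set \<Rightarrow> nat \<Rightarrow> bool" where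
  "depth_le A m \<longleftrightarrow> (\<forall>H\<subseteq>A. \<Inter>H \<noteq> {} \<longrightarrow> card H \<le> m)"

lemma Inter_subset_nonempty: "\<Inter>H \<noteq> {} \<Longrightarrow> H' \<subseteq> H \<Longrightarrow> \<Inter>H' \<noteq> {}"
  using Inter_anti_mono by (metis subset_empty)

lemma depth_le_Un:
  assumes "finite A" "finite B" "depth_le A m" "depth_le B n"
  shows "depth_le (A \<union> B) (m + n)"
  unfolding depth_le_def
proof (intro allI impI)
  fix H assume H: "H \<subseteq> A \<union> B" "\<Inter>H \<noteq> {}"
  have "card H \<le> card ((H \<inter> A) \<union> (H \<inter> B))" using H(1) assms(1,2) by (intro card_mono) auto
  also have "\<dots> \<le> card (H \<inter> A) + card (H \<inter> B)" by (rule card_Un_le)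
  also have "\<dots> \<le> m + n"
    using assms(3,4) Inter_subset_nonempty[OF H(2), of "H \<inter> A"] Inter_subset_nonempty[OF H(2), of "H \<inter> B"]
    unfolding depth_le_def by (intro add_mono) auto
  finally show "card H \<le> m + n" .
qed

text \<open>A subfamily of small depth may be pierced set by set: it lowers p much more than q,
  which brings the rest of the family into the range of the Hadwiger-Debrunner theorem.\<close>
lemma pierced_after_removal:
  fixes F :: "'a::euclidean_space set set"
  assumes F: "finite F" "\<forall>A\<in>F. compact A \<and> convex A \<and> A \<noteq> {}" "p \<le> card F" "has_pq p q F"
    and A: "A \<subseteq> F" "depth_le A m" "card A + q \<le> p"
    and q: "DIM('a) + 1 + m \<le> q" and ineq: "(DIM('a) - 1) * (p - card A) < DIM('a) * (q - m - 1)"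
  shows "pierced (p - q + 2) F"
proof -
  let ?S = "{H. H \<subseteq> A \<and> \<Inter>H \<noteq> {}}"
  have finA: "finite A" using A(1) F(1) finite_subset by blast
  have finS: "finite ?S" using finA by simp
  have "{} \<in> ?S" by simp
  then have "Max (card ` ?S) \<in> card ` ?S" using finS by (intro Max_in) auto
  then obtain H0 where H0: "H0 \<subseteq> A" "\<Inter>H0 \<noteq> {}" "card H0 = Max (card ` ?S)"
    by (metis (mono_tags, lifting) imageE mem_Collect_eq)
  \<comment> \<open>The exact depth, not merely the bound m: the same number must be saved on A and
    lost by the rest, so that it cancels in (|A| - \<nu> + 1) + (p - |A| - (q - \<nu>) + 1).\<close>
  define \<nu> where "\<nu> = card H0"
  have \<nu>max: "card H \<le> \<nu>" if "H \<subseteq> A" "\<Inter>H \<noteq> {}" for H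
    unfolding \<nu>_def H0(3) using finS that by (intro Max_ge) auto
  have \<nu>m: "\<nu> \<le> m" using A(2) H0(1,2) unfolding depth_le_def \<nu>_def by blast
  have \<nu>A: "\<nu> \<le> card A" unfolding \<nu>_def using H0(1) finA by (rule card_mono[rotated])
  define p' where "p' = p - card A"
  have FA: "card (F - A) = card F - card A" using finA A(1) by (simp add: card_Diff_subset)
  have "pierced (card A - \<nu> + 1) A"
    unfolding \<nu>_def by (rule pierced_by_points[OF finA _ H0(1,2)]) (use A(1) F(2) in blast)
  moreover have "pierced (p' - (q - \<nu>) + 1) (F - A)"
  proof (rule Hadwiger_Debrunner)
    show "finite (F - A)" using F(1) by simp
    show "\<forall>C\<in>F - A. compact C \<and> convex C \<and> C \<noteq> {}" using F(2) by blast
    show "p' \<le> card (F - A)" using F(3) FA by (simp add: p'_def)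
    show "has_pq p' (q - \<nu>) (F - A)"
      unfolding has_pq_def
    proof (intro allI impI)
      fix G assume G: "G \<subseteq> F - A" "card G = p'"
      have finG: "finite G" using G(1) F(1) finite_subset by blast
      have "card (G \<union> A) = card G + card A" using finG finA G(1) by (intro card_Un_disjoint) auto
      then have "card (G \<union> A) = p" using G(2) A(3) by (simp add: p'_def)
      moreover have "G \<union> A \<subseteq> F" using G(1) A(1) by blast
      ultimately obtain H where H: "H \<subseteq> G \<union> A" "card H = q" "\<Inter>H \<noteq> {}" using F(4) unfolding has_pq_def by metis
      have "card H \<le> card ((H \<inter> G) \<union> (H \<inter> A))" using H(1) finG finA by (intro card_mono) auto
      also have "\<dots> \<le> card (H \<inter> G) + card (H \<inter> A)" by (rule card_Un_le)
      finally have "q - \<nu> \<le> card (H \<inter> G)"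
        using H(2) \<nu>max[of "H \<inter> A"] Inter_subset_nonempty[OF H(3), of "H \<inter> A"] by auto
      then obtain H' where H': "H' \<subseteq> H \<inter> G" "card H' = q - \<nu>" by (meson obtain_subset_with_card_n)
      have "H' \<subseteq> H" using H'(1) by blast
      then show "\<exists>H\<subseteq>G. card H = q - \<nu> \<and> \<Inter>H \<noteq> {}"
        using H' Inter_subset_nonempty[OF H(3)] by (intro exI[of _ H']) auto
    qed
    show "q - \<nu> \<le> p'" using A(3) by (simp add: p'_def)
    show "DIM('a) + 1 \<le> q - \<nu>" using q \<nu>m by simp
    have "DIM('a) * (q - m - 1) \<le> DIM('a) * (q - \<nu> - 1)" using \<nu>m by (intro mult_le_mono2) simp
    then show "(DIM('a) - 1) * p' < DIM('a) * (q - \<nu> - 1)" unfolding p'_def by (rule less_le_trans[OF ineq])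
  qed
  ultimately have "pierced ((card A - \<nu> + 1) + (p' - (q - \<nu>) + 1)) (A \<union> (F - A))" by (rule pierced_Un)
  moreover have "(card A - \<nu> + 1) + (p' - (q - \<nu>) + 1) = p - q + 2"
    using \<nu>A \<nu>m A(3) q by (simp add: p'_def)
  moreover have "A \<union> (F - A) = F" using A(1) by blast
  ultimately show ?thesis by simp
qed

text \<open>After i rounds either the goal is reached, or p - |A| has come close to q, or it has
  shrunk by the factor (1 - \<delta>/2)^i. Each round adds at most r to the depth of A.\<close>

lemma removal_ladder:
  fixes F :: "'a::euclidean_space set set" and \<delta> \<gamma> C D :: real
  assumes F: "finite F" "\<forall>A\<in>F. compact A \<and> convex A \<and> A \<noteq> {}" "p \<le> card F" "q \<le> p"
    and net: "\<And>k G. \<lbrakk>G \<subseteq> F; r \<le> k; has_pq k r G\<rbrakk> \<Longrightarrow>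
       \<exists>s. real s \<le> 4 * real k + C * (real k / real r) powr D \<and> pierced s G"
    and small: "\<And>y. real q \<le> y \<Longrightarrow> y \<le> real p \<Longrightarrow> C * (y / real r) powr D \<le> \<delta> * y"
    and \<delta>: "0 < \<delta>" "\<delta> \<le> 1/10" "(1 - 5 * \<delta>) * (1 + \<gamma>) \<ge> 1" and \<gamma>: "\<gamma> \<ge> 0"
    and r: "1 \<le> r" "real r \<le> \<delta> * real q / 2" and C: "C > 0" "D > 0"
  shows "pierced (p - q) F \<or> (\<exists>A\<subseteq>F. card A + q \<le> p \<and> depth_le A (i * r) \<and>
     (real (p - card A) < (1 + \<gamma>) * real q \<or> real (p - card A) \<le> (1 - \<delta>/2) ^ i * real p))"
proof (induction i)
  case 0
  have "depth_le {} 0" by (simp add: depth_le_def)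
  then show ?case using F(4) by (intro disjI2 exI[of _ "{}"]) simp
next
  case (Suc i)
  then consider "pierced (p - q) F" |
    A where "A \<subseteq> F" "card A + q \<le> p" "depth_le A (i * r)" "real (p - card A) < (1 + \<gamma>) * real q"
    | A where "A \<subseteq> F" "card A + q \<le> p" "depth_le A (i * r)" "real (p - card A) \<ge> (1 + \<gamma>) * real q"
      "real (p - card A) \<le> (1 - \<delta>/2) ^ i * real p" by (metis not_less)
  then show ?case
  proof cases
    case 1 then show ?thesis by blast
  next
    case 2
    have "depth_le A (Suc i * r)" using 2(3) unfolding depth_le_def by (metis le_add2 le_trans mult_Suc)
    then show ?thesis using 2 by blast
  next
    case 3
    define y where "y = real (p - card A)"
    have "real r \<ge> 1" using r(1) by simp
    then have "\<delta> * real q \<ge> 2" using r(2) by linarith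
    then have q2: "real q * \<delta> \<ge> 2" by (simp add: mult.commute)
    have "(1 + \<gamma>) * real q \<ge> real q" using \<gamma> by (simp add: distrib_right)
    then have yq: "y \<ge> real q" using 3(4) by (simp add: y_def)
    have yp: "y \<le> real p" by (simp add: y_def)
    have \<delta>y: "\<delta> * y \<ge> \<delta> * real q" using yq \<delta>(1) by (intro mult_left_mono) auto
    \<comment> \<open>A piece takes the fraction \<delta> of y = p - |A|; as \<delta> q \<ge> 2,
      rounding down loses at most half of it.\<close>
    define k where "k = nat \<lfloor>\<delta> * y\<rfloor>"
    have "\<delta> * y \<ge> 0" using \<delta>y q2 by (simp add: mult.commute)
    then have k: "real k \<le> \<delta> * y" "real k > \<delta> * y - 1" unfolding k_def by linarith+
    have k2: "real k \<ge> \<delta> * y / 2" using k(2) \<delta>y q2 by (simp add: mult.commute)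
    have rk: "r \<le> k"
    proof -
      have "real r \<le> real k" using r(2) \<delta>y k2 by linarith
      then show ?thesis by simp
    qed
    have finA: "finite A" using 3(1) F(1) finite_subset by blast
    show ?thesis
    proof (cases "has_pq k r (F - A)")
      case True
      then obtain s where s: "real s \<le> 4 * real k + C * (real k / real r) powr D" "pierced s (F - A)"
        using net[of "F - A" k] rk by blast
      have "(real k / real r) powr D \<le> (y / real r) powr D"
      proof (intro powr_mono2 divide_right_mono)
        have "\<delta> * y \<le> 1 * y" using \<delta> yq by (intro mult_right_mono) auto
        then show "real k \<le> y" using k(1) by linarith
      qed (use C in auto)
      then have "C * (real k / real r) powr D \<le> C * (y / real r) powr D" using C by simp
      also have "\<dots> \<le> \<delta> * y" by (rule small[OF yq yp])
      finally have s5: "real s \<le> 5 * (\<delta> * y)" using s(1) k(1) by linarith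
      \<comment> \<open>The rest costs at most 4 \<delta> y for the rarely hit members and \<delta>
        y for the net. Since y \<ge> (1 + \<gamma>) q, this leaves q + s \<le> y, and A can be
        pierced one set at a time.\<close>
      have "real q \<le> ((1 - 5 * \<delta>) * (1 + \<gamma>)) * real q" using \<delta>(3) mult_right_mono[of 1 _ "real q"] by simp
      also have "\<dots> = (1 - 5 * \<delta>) * ((1 + \<gamma>) * real q)" by simp
      also have "\<dots> \<le> (1 - 5 * \<delta>) * y" using 3(4) \<delta>(2) by (intro mult_left_mono) (auto simp: y_def)
      finally have "real q + real s \<le> y" using s5 by (simp add: algebra_simps)
      then have "real (q + s) \<le> real (p - card A)" by (simp add: y_def)
      then have le: "q + s \<le> p - card A" by (simp only: of_nat_le_iff)
      have "pierced (card A) A" using 3(1) F(2) finA by (intro pierced_card) auto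
      then have "pierced (card A + s) (A \<union> (F - A))" using s(2) by (rule pierced_Un)
      then have "pierced (p - q) F" by (rule pierced_mono) (use le 3(1,2) in auto)
      then show ?thesis by blast
    next
      \<comment> \<open>A violation of the (k,r)-property is exactly a piece of k members with no r
        of them meeting.\<close>
      case False
      then obtain B where B: "B \<subseteq> F - A" "card B = k" "\<not> (\<exists>H\<subseteq>B. card H = r \<and> \<Inter>H \<noteq> {})"
        unfolding has_pq_def by blast
      have finB: "finite B" using B(1) F(1) finite_subset by blast
      have "depth_le B r" unfolding depth_le_def
      proof (intro allI impI, rule ccontr)
        fix H assume H: "H \<subseteq> B" "\<Inter>H \<noteq> {}" "\<not> card H \<le> r"
        then obtain H' where H': "H' \<subseteq> H" "card H' = r" by (meson nle_le obtain_subset_with_card_n)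
        then show False using B(3) Inter_subset_nonempty[OF H(2) H'(1)] H(1) by blast
      qed
      then have dep: "depth_le (A \<union> B) (i * r + r)" by (rule depth_le_Un[OF finA finB 3(3)])
      have card: "card (A \<union> B) = card A + k" using finA finB B by (subst card_Un_disjoint) auto
      \<comment> \<open>The same slack ensures that removing the piece does not push p - |A| below
        q.\<close>
      have "real q \<le> ((1 - 5 * \<delta>) * (1 + \<gamma>)) * real q" using \<delta>(3) mult_right_mono[of 1 _ "real q"] by simp
      also have "\<dots> = (1 - 5 * \<delta>) * ((1 + \<gamma>) * real q)" by simp
      also have "\<dots> \<le> (1 - 5 * \<delta>) * y" using 3(4) \<delta>(2) by (intro mult_left_mono) (auto simp: y_def)
      also have "\<dots> \<le> y - \<delta> * y" using \<open>\<delta> * y \<ge> 0\<close> by (simp add: algebra_simps)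
      finally have "real (q + k) \<le> real (p - card A)" using k(1) by (simp add: y_def)
      then have le: "q + k \<le> p - card A" by (simp only: of_nat_le_iff)
      have new: "real (p - card (A \<union> B)) = y - real k" unfolding card y_def using le by (simp add: of_nat_diff)
      have "y - real k \<le> (1 - \<delta>/2) * y" using k2 by (simp add: algebra_simps)
      also have "\<dots> \<le> (1 - \<delta>/2) * ((1 - \<delta>/2) ^ i * real p)" using 3(5) \<delta> by (intro mult_left_mono) (auto simp: y_def)
      finally have "real (p - card (A \<union> B)) \<le> (1 - \<delta>/2) ^ Suc i * real p" using new by simp
      moreover have "A \<union> B \<subseteq> F" using 3(1) B(1) by blast
      moreover have "card (A \<union> B) + q \<le> p" using le 3(2) card by linarith
      moreover have "depth_le (A \<union> B) (Suc i * r)" using dep by (simp add: add.commute)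
      ultimately show ?thesis by blast
    qed
  qed
qed

text \<open>Choice of parameters: run the ladder for J rounds, then either it has already succeeded
  or A satisfies the hypotheses of \<open>pierced_after_removal\<close>.\<close>

lemma pierced_finite_family:
  fixes \<epsilon> :: real
  assumes \<epsilon>: "\<epsilon> > 0" and d2: "DIM('a::euclidean_space) \<ge> 2"
  shows "\<exists>p0. \<forall>p\<ge>p0. \<forall>q (F :: 'a set set). real p powr ((real DIM('a) - 1) / real DIM('a) + \<epsilon>) \<le> real q \<and> q \<le> p \<and>
     finite F \<and> (\<forall>A\<in>F. compact A \<and> convex A \<and> A \<noteq> {}) \<and> p \<le> card F \<and> has_pq p q F \<longrightarrow> pierced (p - q + 2) F"
proof -
  let ?d = "DIM('a)"
  define d where "d = real ?d"
  have d: "d \<ge> 2" using d2 by (simp add: d_def)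
  \<comment> \<open>With \<gamma> = 1/(2d), (d - 1)(1 + \<gamma>) stays below d - 1/2, which leaves
    q/2 of slack for the Hadwiger-Debrunner inequality. \<delta> = \<gamma>/10 gives (1 - 5
    \<delta>)(1 + \<gamma>) \<ge> 1, and \<eta> is small enough that \<eta>/d is d \<epsilon>/4,
    half of the gain d \<epsilon>/2.\<close>
  define \<delta> where "\<delta> = 1 / (20 * d)"
  define \<gamma> where "\<gamma> = 1 / (2 * d)"
  define \<eta> where "\<eta> = \<epsilon> * d\<^sup>2 / 4"
  define D where "D = d + \<eta>"
  have \<eta>: "\<eta> > 0" using \<epsilon> d by (simp add: \<eta>_def)
  have D0: "D > 0" using \<eta> d by (simp add: D_def)
  have \<delta>: "0 < \<delta>" "\<delta> \<le> 1/10" using d by (auto simp: \<delta>_def field_simps)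
  have \<gamma>: "0 \<le> \<gamma>" "\<gamma> \<le> 1" using d by (auto simp: \<gamma>_def field_simps)
  have \<delta>\<gamma>: "(1 - 5 * \<delta>) * (1 + \<gamma>) \<ge> 1"
  proof -
    have "\<delta> = \<gamma> / 10" by (simp add: \<delta>_def \<gamma>_def)
    then have "(1 - 5 * \<delta>) * (1 + \<gamma>) = 1 + \<gamma> * (1 - \<gamma>) / 2" by (simp add: field_simps)
    then show ?thesis using \<gamma> by simp
  qed
  obtain C j where C: "C > 0" and j: "j \<ge> 1" and net: "\<forall>k r (F :: 'a set set). j \<le> r \<and> r \<le> k \<and> finite F \<and> (\<forall>A\<in>F. compact A \<and> convex A \<and> A \<noteq> {}) \<and> has_pq k r F \<longrightarrow>
    (\<exists>s. real s \<le> 4 * real k + C * (real k / real r) powr D \<and> pierced s F)"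
    using pierced_by_weak_net[where 'a = 'a, OF \<eta> d2] unfolding D_def d_def by (elim exE conjE)
  have "\<forall>\<^sub>F p::nat in at_top. 16 * d * (40 * d * ln (real p) + 1) \<le> real p powr (\<epsilon>/2) \<and> real j \<le> real p powr (1/2) \<and>
      C / \<delta> \<le> real p powr (d * \<epsilon> / 4) \<and> 4 * d \<le> real p powr (1/2) \<and> 1 \<le> ln (real p)"
  proof (intro eventually_conj)
    show "\<forall>\<^sub>F p::nat in at_top. 16 * d * (40 * d * ln (real p) + 1) \<le> real p powr (\<epsilon>/2)" using \<epsilon> d by real_asymp
    show "\<forall>\<^sub>F p::nat in at_top. real j \<le> real p powr (1/2)" by real_asymp
    define \<kappa> where "\<kappa> = d * \<epsilon> / 4"
    have "\<kappa> > 0" using \<epsilon> d by (simp add: \<kappa>_def)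
    then show "\<forall>\<^sub>F p::nat in at_top. C / \<delta> \<le> real p powr (d * \<epsilon> / 4)" unfolding \<kappa>_def[symmetric] by real_asymp
    show "\<forall>\<^sub>F p::nat in at_top. 4 * d \<le> real p powr (1/2)" by real_asymp
    show "\<forall>\<^sub>F p::nat in at_top. 1 \<le> ln (real p)" by real_asymp
  qed
  then obtain p0 where p0: "\<And>p. p \<ge> p0 \<Longrightarrow> 16 * d * (40 * d * ln (real p) + 1) \<le> real p powr (\<epsilon>/2) \<and> real j \<le> real p powr (1/2) \<and>
      C / \<delta> \<le> real p powr (d * \<epsilon> / 4) \<and> 4 * d \<le> real p powr (1/2) \<and> 1 \<le> ln (real p)"
    unfolding eventually_at_top_linorder by blast
  have main: "pierced (p - q + 2) F"
    if p: "p \<ge> p0" and q: "real p powr ((d - 1) / d + \<epsilon>) \<le> real q" "q \<le> p"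
      and F: "finite F" "\<forall>A\<in>F. compact A \<and> convex A \<and> A \<noteq> {}" "p \<le> card F" "has_pq p q F" for p q and F :: "'a set set"
  proof -
    have P1: "16 * d * (40 * d * ln (real p) + 1) \<le> real p powr (\<epsilon>/2)" and P2: "real j \<le> real p powr (1/2)"
      and P3: "C / \<delta> \<le> real p powr (d * \<epsilon> / 4)" and P4: "4 * d \<le> real p powr (1/2)" and P5: "1 \<le> ln (real p)"
      using p0[OF p] by blast+
    have p1: "real p > 1"
    proof (cases "p = 0")
      case False
      then have "real p > 0" by simp
      moreover have "ln (real p) > 0" using P5 by linarith
      ultimately show ?thesis by (rule ln_gt_zero_imp_gt_one[rotated])
    qed (use P5 in simp)
    \<comment> \<open>As \<delta>/2 = 1/(40 d), this many rounds shrink p by a factor of at least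
      p.\<close>
    define J where "J = nat \<lceil>40 * d * ln (real p)\<rceil>"
    have J: "real J \<ge> 40 * d * ln (real p)" "real J \<le> 40 * d * ln (real p) + 1"
    proof -
      show "real J \<ge> 40 * d * ln (real p)" unfolding J_def by (rule real_nat_ceiling_ge)
      have "40 * d * ln (real p) \<ge> 0" using d P5 by simp
      then show "real J \<le> 40 * d * ln (real p) + 1" unfolding J_def by linarith
    qed
    have J40: "real J \<ge> 40 * d"
      using J(1) mult_left_mono[OF P5, of "40 * d"] d by linarith
    \<comment> \<open>r will be q div m, so that the total depth J r of the removed family is at
      most q / (8 d).\<close>
    define m where "m = 8 * ?d * J"
    have md: "real m = 8 * d * real J" by (simp add: m_def d_def)
    define x0 where "x0 = real p powr (\<epsilon>/2)"
    have x0: "x0 > 0" using p1 by (simp add: x0_def)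
    have m0: "real m > 0" using md J40 d by simp
    have mx: "2 * real m \<le> x0"
    proof -
      have "2 * real m = 16 * d * real J" using md by simp
      also have "\<dots> \<le> 16 * d * (40 * d * ln (real p) + 1)" using J(2) d by (intro mult_left_mono) auto
      finally show ?thesis using P1 by (simp add: x0_def)
    qed
    \<comment> \<open>The logarithmic factor m costs p^(\<epsilon>/2), so r is still at least p^a
      with half of \<epsilon> left.\<close>
    define a where "a = (d - 1) / d + \<epsilon>/2"
    have "(d - 1) / d \<ge> 1/2" using d by (simp add: field_simps)
    then have a: "a \<ge> 1/2" using \<epsilon> unfolding a_def by linarith
    have qx: "real p powr a \<le> real q / x0"
    proof -
      have "real p powr a * x0 = real p powr ((d - 1) / d + \<epsilon>)" by (simp add: a_def x0_def add.commute flip: powr_add)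
      then show ?thesis using q(1) x0 by (simp add: field_simps)
    qed
    have pa: "real p powr (1/2) \<le> real p powr a" using a p1 by (intro powr_mono) auto
    have x01: "x0 \<ge> 1" using p1 \<epsilon> by (simp add: x0_def ge_one_powr_ge_zero)
    have q4: "real q \<ge> 4 * d"
    proof -
      have "4 * d \<le> real q / x0" using P4 pa qx by linarith
      also have "\<dots> \<le> real q" using divide_left_mono[OF x01, of "real q"] x0 by simp
      finally show ?thesis .
    qed
    define r where "r = q div m"
    have mr: "m * r \<le> q" by (simp add: r_def)
    have r_lower: "real r \<ge> real p powr a"
    proof -
      have "m > 0" using m0 by simp
      then have "q < m * (r + 1)" using dividend_less_times_div[of m q] by (simp add: r_def)
      then have "real q < real (m * (r + 1))" by (simp only: of_nat_less_iff)
      then have "real q < real m * (real r + 1)" by (simp add: distrib_left)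
      also have "\<dots> \<le> (x0 / 2) * (real r + 1)" using mx by (intro mult_right_mono) auto
      finally have "2 * (real q / x0) < real r + 1" using x0 by (simp add: field_simps)
      then show ?thesis using qx pa P4 d by linarith
    qed
    have jr: "j \<le> r"
    proof -
      have "real j \<le> real r" using P2 pa r_lower by linarith
      then show ?thesis by simp
    qed
    have r1: "r \<ge> 1" using jr j by simp
    have mrR: "real m * real r \<le> real q" using mr by (simp only: of_nat_mult[symmetric] of_nat_le_iff)
    have r_upper: "real r \<le> \<delta> * real q / 2"
    proof -
      have "40 * d * real r \<le> real m * real r"
      proof (rule mult_right_mono)
        have "40 * d * 1 \<le> 40 * d * (8 * d)" using d by (intro mult_left_mono) auto
        also have "\<dots> = 8 * d * (40 * d)" by simp
        also have "\<dots> \<le> 8 * d * real J" using J40 d by (intro mult_left_mono) auto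
        finally show "40 * d \<le> real m" using md by simp
      qed simp
      then have "40 * d * real r \<le> real q" using mrR by linarith
      then show ?thesis using d by (simp add: \<delta>_def field_simps)
    qed
    \<comment> \<open>Everything rests on D - 1 - a D = \<eta>/d - D \<epsilon>/2 being at most -d
      \<epsilon>/4; the negative power of p then absorbs C / \<delta>.\<close>
    have small: "C * (y / real r) powr D \<le> \<delta> * y" if y: "real q \<le> y" "y \<le> real p" for y
    proof -
      have y0: "y > 0" using y(1) q4 d by linarith
      have "(y / real r) powr D = y * (y powr (D - 1) / real r powr D)"
        using y0 r1 by (simp add: powr_divide powr_diff)
      also have "\<dots> \<le> y * (real p powr (D - 1) / (real p powr a) powr D)"
      proof (intro mult_left_mono frac_le powr_mono2)
        show "0 \<le> D - 1" using d \<eta> by (simp add: D_def)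
      qed (use y y0 D0 r_lower p1 in auto)
      also have "\<dots> = y * real p powr (D - 1 - a * D)" by (simp add: powr_powr powr_diff)
      also have "\<dots> \<le> y * real p powr (- (d * \<epsilon> / 4))"
      proof (intro mult_left_mono powr_mono)
        have "D - 1 - a * D = \<eta> / d - D * \<epsilon> / 2" using d by (simp add: a_def D_def field_simps)
        moreover have "\<eta> / d = d * \<epsilon> / 4" using d by (simp add: \<eta>_def power2_eq_square)
        moreover have "D * \<epsilon> / 2 \<ge> d * \<epsilon> / 2" using \<eta> \<epsilon> by (simp add: D_def)
        ultimately show "D - 1 - a * D \<le> - (d * \<epsilon> / 4)" by linarith
      qed (use y0 p1 in auto)
      also have "\<dots> \<le> y * (\<delta> / C)"
      proof (intro mult_left_mono)
        have "1 / real p powr (d * \<epsilon> / 4) \<le> 1 / (C / \<delta>)" using P3 C \<delta> p1 by (intro divide_left_mono) auto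
        then show "real p powr (- (d * \<epsilon> / 4)) \<le> \<delta> / C" by (simp add: powr_minus_divide)
      qed (use y0 in auto)
      finally have "C * (y / real r) powr D \<le> C * (y * (\<delta> / C))" using C by (intro mult_left_mono) auto
      then show ?thesis using C by (simp add: mult.commute)
    qed
    have netF: "\<exists>s. real s \<le> 4 * real k + C * (real k / real r) powr D \<and> pierced s G"
      if "G \<subseteq> F" "r \<le> k" "has_pq k r G" for k G
    proof (rule net[rule_format], intro conjI)
      show "finite G" using that(1) F(1) by (rule finite_subset)
      show "\<forall>A\<in>G. compact A \<and> convex A \<and> A \<noteq> {}" using that(1) F(2) by blast
    qed (use that jr in auto)
    have "pierced (p - q) F \<or> (\<exists>A\<subseteq>F. card A + q \<le> p \<and> depth_le A (J * r) \<and>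
     (real (p - card A) < (1 + \<gamma>) * real q \<or> real (p - card A) \<le> (1 - \<delta>/2) ^ J * real p))"
      by (rule removal_ladder[OF F(1-3) q(2) netF small \<delta> \<delta>\<gamma> \<gamma>(1) r1 r_upper C D0])
    then show ?thesis
    proof
      assume "pierced (p - q) F"
      then show ?thesis by (rule pierced_mono) auto
    next
      assume "\<exists>A\<subseteq>F. card A + q \<le> p \<and> depth_le A (J * r) \<and>
        (real (p - card A) < (1 + \<gamma>) * real q \<or> real (p - card A) \<le> (1 - \<delta>/2) ^ J * real p)"
      then obtain A where A: "A \<subseteq> F" "card A + q \<le> p" "depth_le A (J * r)"
        "real (p - card A) < (1 + \<gamma>) * real q \<or> real (p - card A) \<le> (1 - \<delta>/2) ^ J * real p" by blast
      \<comment> \<open>Geometric decay down to 1 would already put p - |A| below (1 + \<gamma>) q,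
        so only the first alternative of the ladder remains.\<close>
      have "(1 - \<delta>/2) ^ J * real p \<le> 1"
      proof -
        have "(1 - \<delta>/2) ^ J \<le> exp (- (\<delta>/2)) ^ J"
          using exp_ge_add_one_self[of "- (\<delta>/2)"] \<delta> by (intro power_mono) auto
        also have "\<dots> = exp (- (real J * (\<delta>/2)))" by (simp flip: exp_of_nat_mult)
        also have "\<dots> \<le> exp (- ln (real p))"
        proof -
          have "ln (real p) = 40 * d * ln (real p) * (\<delta>/2)" using d by (simp add: \<delta>_def)
          also have "\<dots> \<le> real J * (\<delta>/2)" using J(1) \<delta> by (intro mult_right_mono) auto
          finally show ?thesis by simp
        qed
        also have "\<dots> = 1 / real p" using p1 by (simp add: exp_minus inverse_eq_divide)
        finally show ?thesis using p1 by (simp add: field_simps)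
      qed
      moreover have "1 < (1 + \<gamma>) * real q"
      proof -
        have "1 * real q \<le> (1 + \<gamma>) * real q" using \<gamma> by (intro mult_right_mono) auto
        then show ?thesis using q4 d by linarith
      qed
      ultimately have pA: "real (p - card A) < (1 + \<gamma>) * real q" using A(4) by linarith
      have Jr: "8 * d * real (J * r) \<le> real q" using mrR md by (simp add: mult.assoc)
      have Jr16: "16 * real (J * r) \<le> real q"
        using Jr mult_right_mono[of 16 "8 * d" "real (J * r)"] d by linarith
      have room: "?d + 1 + J * r \<le> q"
      proof -
        have "real (?d + 1 + J * r) \<le> real q" using Jr16 q4 d unfolding of_nat_add d_def by simp
        then show ?thesis by (simp only: of_nat_le_iff)
      qed
      \<comment> \<open>Of the slack q/2, the depth uses d J r \<le> q/8 and the constant term uses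
        d \<le> q/4.\<close>
      have "(?d - 1) * (p - card A) < ?d * (q - J * r - 1)"
      proof -
        define y where "y = real (p - card A)"
        define z where "z = real (J * r)"
        have "(d - 1) * y \<le> (d - 1) * ((1 + \<gamma>) * real q)" using pA d by (intro mult_left_mono) (auto simp: y_def)
        also have "\<dots> = (d - 1/2 - 1 / (2 * d)) * real q" using d by (simp add: \<gamma>_def field_simps)
        also have "\<dots> \<le> (d - 1/2) * real q" using d by (intro mult_right_mono) auto
        also have "\<dots> < d * (real q - z - 1)"
        proof -
          have "d * z \<le> real q / 8" using Jr by (simp add: z_def)
          moreover have "d \<le> real q / 4" using q4 by simp
          moreover have "real q > 0" using q4 d by linarith
          ultimately show ?thesis by (simp add: algebra_simps)
        qed
        finally have "(d - 1) * y < d * (real q - z - 1)" .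
        moreover have "real ((?d - 1) * (p - card A)) = (d - 1) * y" using d2 by (simp add: d_def y_def of_nat_diff)
        moreover have "real (?d * (q - J * r - 1)) = d * (real q - z - 1)" using room by (simp add: d_def z_def of_nat_diff)
        ultimately show ?thesis by (metis of_nat_less_iff)
      qed
      then show ?thesis by (rule pierced_after_removal[OF F A(1,3,2) room])
    qed
  qed
  show ?thesis
  proof (intro exI[of _ p0] allI impI)
    fix p q and F :: "'a set set"
    assume "p0 \<le> p" "real p powr ((real ?d - 1) / real ?d + \<epsilon>) \<le> real q \<and> q \<le> p \<and>
     finite F \<and> (\<forall>A\<in>F. compact A \<and> convex A \<and> A \<noteq> {}) \<and> p \<le> card F \<and> has_pq p q F"
    then show "pierced (p - q + 2) F" unfolding d_def[symmetric] by (elim conjE) (rule main)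
  qed
qed

theorem theorem1p3:
  assumes "DIM('a::euclidean_space) \<ge> 2"
  shows "\<forall>\<epsilon>::real. \<epsilon> > 0 \<longrightarrow> (\<exists>p0::nat. \<forall>p q :: nat.
           p \<ge> p0 \<and> real p powr ((real DIM('a) - 1) / real DIM('a) + \<epsilon>) \<le> real q \<and> q \<le> p
           \<longrightarrow> p - q + 1 \<le> HD TYPE('a) p q \<and> HD TYPE('a) p q \<le> p - q + 2)"
proof (intro allI impI)
  fix \<epsilon> :: real assume \<epsilon>: "\<epsilon> > 0"
  obtain p0 where p0: "\<forall>p\<ge>p0. \<forall>q (F :: 'a set set). real p powr ((real DIM('a) - 1) / real DIM('a) + \<epsilon>) \<le> real q \<and> q \<le> p \<and>
     finite F \<and> (\<forall>A\<in>F. compact A \<and> convex A \<and> A \<noteq> {}) \<and> p \<le> card F \<and> has_pq p q F \<longrightarrow> pierced (p - q + 2) F"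
    using pierced_finite_family[OF \<epsilon> assms] by blast
  show "\<exists>p0::nat. \<forall>p q :: nat.
           p \<ge> p0 \<and> real p powr ((real DIM('a) - 1) / real DIM('a) + \<epsilon>) \<le> real q \<and> q \<le> p
           \<longrightarrow> p - q + 1 \<le> HD TYPE('a) p q \<and> HD TYPE('a) p q \<le> p - q + 2"
  \<comment> \<open>p \<ge> 1 makes the power of p positive and so forces q \<ge> 1, which the lower
    bound family requires.\<close>
  proof (intro exI[of _ "max 1 p0"] allI impI)
    fix p q :: nat
    assume pq: "max 1 p0 \<le> p \<and> real p powr ((real DIM('a) - 1) / real DIM('a) + \<epsilon>) \<le> real q \<and> q \<le> p"
    have p1: "p \<ge> 1" and qp: "q \<le> p" using pq by auto
    have q1: "q \<ge> 1"
    proof -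
      have "0 < real p powr ((real DIM('a) - 1) / real DIM('a) + \<epsilon>)" using p1 by simp
      then have "real q > 0" using pq by linarith
      then show ?thesis by simp
    qed
    define P where "P s \<longleftrightarrow> (\<forall>F :: 'a set set. (\<forall>C\<in>F. compact C \<and> convex C) \<and> pq_property p q F \<longrightarrow>
       (\<exists>T. finite T \<and> card T \<le> s \<and> transversal T F))" for s
    have HD: "HD TYPE('a) p q = (LEAST s. P s)" by (simp add: HD_def P_def)
    have upper: "P (p - q + 2)" unfolding P_def pierced_def[symmetric]
    proof (intro allI impI)
      fix F :: "'a set set" assume F: "(\<forall>C\<in>F. compact C \<and> convex C) \<and> pq_property p q F"
      obtain G0 where G0: "G0 \<subseteq> F" "finite G0" "card G0 = p"
        using conjunct2[OF F] unfolding pq_property_def by (elim conjE exE)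
      have ne: "\<forall>C\<in>F. C \<noteq> {}" using conjunct2[OF F] unfolding pq_property_def by (elim conjE)
      show "pierced (p - q + 2) F"
      proof (rule pierced_compactness)
        show "compact A" if "A \<in> F" for A using F that by blast
        fix G assume G: "finite G" "G \<subseteq> F"
        \<comment> \<open>A finite subfamily may have fewer than p members, so p members
          \<open>G0\<close> are added before the finite bound is applied.\<close>
        have GF: "G \<union> G0 \<subseteq> F" "finite (G \<union> G0)" using G G0 by auto
        have "pierced (p - q + 2) (G \<union> G0)"
        proof (rule p0[rule_format], goal_cases)
          case 1 then show ?case using pq by simp
        next
          case 2
          have "has_pq p q (G \<union> G0)" unfolding has_pq_def
          proof (intro allI impI)
            fix H assume H: "H \<subseteq> G \<union> G0" "card H = p"
            have "finite H" using H(1) GF(2) finite_subset by blast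
            moreover have "H \<subseteq> F" using H(1) GF(1) by (rule order_trans)
            ultimately show "\<exists>H'\<subseteq>H. card H' = q \<and> \<Inter>H' \<noteq> {}"
              using conjunct2[OF F] H(2) unfolding pq_property_def by simp
          qed
          moreover have "p \<le> card (G \<union> G0)" using card_mono[of "G \<union> G0" G0] GF(2) G0(3) by simp
          moreover have "\<forall>A\<in>G \<union> G0. compact A \<and> convex A \<and> A \<noteq> {}"
            using subsetD[OF GF(1)] conjunct1[OF F] ne by simp
          ultimately show ?case using pq GF(2) by (intro conjI) simp_all
        qed
        then show "pierced (p - q + 2) G" by (rule pierced_mono) auto
      qed
    qed
    have "\<not> P s" if s: "s \<le> p - q" for s
    proof
      assume Ps: "P s"
      obtain F :: "'a set set" where F: "\<forall>C\<in>F. compact C \<and> convex C" "pq_property p q F" "\<not> pierced (p - q) F"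
        using lower_bound_family[OF q1 qp] by blast
      have "pierced s F" using Ps F(1,2) unfolding P_def pierced_def by blast
      then show False using F(3) pierced_mono[OF _ s, of F F] by blast
    qed
    \<comment> \<open>The least number with property P attains it because the upper bound exhibits
      one; only then does failure for all s \<le> p - q give the lower bound.\<close>
    moreover have "P (HD TYPE('a) p q)" unfolding HD using upper by (rule LeastI)
    ultimately have "\<not> HD TYPE('a) p q \<le> p - q" by blast
    moreover have "HD TYPE('a) p q \<le> p - q + 2" unfolding HD using upper by (rule Least_le)
    ultimately show "p - q + 1 \<le> HD TYPE('a) p q \<and> HD TYPE('a) p q \<le> p - q + 2" by simp
  qed
qed

end
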